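(* Let $c\ge 3$ be an integer. Given a connected vertex-weighted $K_{1,c}$-free graph $G=(V,E,w)$ with $w:V\to\mathbb{N}$ and an integer $k\in\mathbb{N}$, a $(c-1)$-approximation for \textsc{Max-Min BCP} on $(G,k)$ can be computed in time $\mathcal{O}(\log(X^* )\,|E|)$, where $X^*$ is the optimum value.
   Context: $\mathbb{N}$ denotes the positive integers. All graphs are simple, finite and connected. A graph is $K_{1,c}$-free if it has no induced subgraph isomorphic to the star $K_{1,c}$. For $U\subseteq V$, $w(U)=\sum_{u\in U}w(u)$. A connected $k$-partition of $G$ is a partition $T_1,\dots,T_k$ of $V$ such that each $G[T_i]$ is connected. \textsc{Max-Min BCP}: given $(G,k)$, find a connected $k$-partition maximizing $\min_{i\in[k]} w(T_i)$; $X^*$ is this maximum value. A $(c-1)$-approximation is a connected $k$-partition whose lightest part has weight at least $X^*/(c-1)$. *)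

theory Defs
  imports Complex_Main "HOL-Library.Disjoint_Sets"
begin

section \<open>Simple graphs\<close>

record 'a graph =
  verts :: "'a set"
  edges :: "'a set set"

definition simple_graph :: "'a graph \<Rightarrow> bool" where
  "simple_graph G \<longleftrightarrow> finite (verts G) \<and> (\<forall>e\<in>edges G. e \<subseteq> verts G \<and> card e = 2)"

definition connected_graph :: "'a graph \<Rightarrow> bool" where
  "connected_graph G \<longleftrightarrow> verts G \<noteq> {} \<and>
     (\<forall>u\<in>verts G. \<forall>v\<in>verts G. (u, v) \<in> {(x, y). {x, y} \<in> edges G}\<^sup>*)"

definition induced :: "'a graph \<Rightarrow> 'a set \<Rightarrow> 'a graph" where
  "induced G U = \<lparr>verts = U, edges = {e \<in> edges G. e \<subseteq> U}\<rparr>"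

definition isomorphic :: "'a graph \<Rightarrow> 'b graph \<Rightarrow> bool" where
  "isomorphic G H \<longleftrightarrow> (\<exists>f. bij_betw f (verts G) (verts H) \<and> (\<lambda>e. f ` e) ` edges G = edges H)"

definition star :: "nat \<Rightarrow> nat graph" where
  "star c = \<lparr>verts = {0..c}, edges = {{0, i} |i. i \<in> {1..c}}\<rparr>"

definition star_free :: "nat \<Rightarrow> 'a graph \<Rightarrow> bool" where
  "star_free c G \<longleftrightarrow> \<not> (\<exists>U \<subseteq> verts G. isomorphic (induced G U) (star c))"


section \<open>Max-Min balanced connected partition\<close>

text \<open>The blocks of a \<^const>\<open>partition_on\<close> are nonempty, so a connected \<open>k\<close>-partition
  has exactly \<open>k\<close> nonempty parts.\<close>

definition connected_partition :: "'a graph \<Rightarrow> nat \<Rightarrow> 'a set set \<Rightarrow> bool" where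
  "connected_partition G k P \<longleftrightarrow>
     partition_on (verts G) P \<and> card P = k \<and> (\<forall>T\<in>P. connected_graph (induced G T))"

definition min_weight :: "('a \<Rightarrow> nat) \<Rightarrow> 'a set set \<Rightarrow> nat" where
  "min_weight w P = Min ((\<lambda>T. \<Sum>v\<in>T. w v) ` P)"

text \<open>Meaningful only if \<open>G\<close> has a connected \<open>k\<close>-partition
  (for connected \<open>G\<close> and \<open>k \<ge> 1\<close>: if \<open>k\<close> is at most the number of vertices).\<close>

definition max_min_value :: "'a graph \<Rightarrow> ('a \<Rightarrow> nat) \<Rightarrow> nat \<Rightarrow> nat" where
  "max_min_value G w k = Max {min_weight w P |P. connected_partition G k P}"

definition approximation :: "real \<Rightarrow> 'a graph \<Rightarrow> ('a \<Rightarrow> nat) \<Rightarrow> nat \<Rightarrow> 'a set set \<Rightarrow> bool" where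
  "approximation \<alpha> G w k P \<longleftrightarrow>
     connected_partition G k P \<and> real (min_weight w P) \<ge> real (max_min_value G w k) / \<alpha>"


section \<open>Random access machine\<close>

text \<open>A structured random access machine under the uniform cost measure.  A program has finitely
  many scalar registers and finitely many one-dimensional arrays, all holding natural numbers;
  array accesses are computed (indirect) addresses.  The arithmetic operations are addition and
  truncated subtraction only: unit-cost multiplication on unbounded numbers would make
  the model unreasonably powerful.  Every operator, operand, memory access, assignment and branch
  costs one unit.\<close>

record state =
  reg :: "string \<Rightarrow> nat"
  arr :: "string \<Rightarrow> nat \<Rightarrow> nat"

datatype aexp =
    Const nat
  | Reg string
  | Arr string aexp
  | Plus aexp aexp
  | Minus aexp aexp

datatype bexp =
    Less aexp aexp
  | Not bexp
  | And bexp bexp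

datatype com =
    Skip
  | Assign string aexp
  | Store string aexp aexp  \<comment> \<open>\<open>Store A i a\<close> performs \<open>A[i] := a\<close>\<close>
  | Seq com com
  | If bexp com com
  | While bexp com

fun aval :: "aexp \<Rightarrow> state \<Rightarrow> nat" where
  "aval (Const n) s = n"
| "aval (Reg x) s = reg s x"
| "aval (Arr A i) s = arr s A (aval i s)"
| "aval (Plus a b) s = aval a s + aval b s"
| "aval (Minus a b) s = aval a s - aval b s"

fun bval :: "bexp \<Rightarrow> state \<Rightarrow> bool" where
  "bval (Less a b) s \<longleftrightarrow> aval a s < aval b s"
| "bval (Not b) s \<longleftrightarrow> \<not> bval b s"
| "bval (And b d) s \<longleftrightarrow> bval b s \<and> bval d s"

fun acost :: "aexp \<Rightarrow> nat" where
  "acost (Const n) = 1"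
| "acost (Reg x) = 1"
| "acost (Arr A i) = 1 + acost i"
| "acost (Plus a b) = 1 + acost a + acost b"
| "acost (Minus a b) = 1 + acost a + acost b"

fun bcost :: "bexp \<Rightarrow> nat" where
  "bcost (Less a b) = 1 + acost a + acost b"
| "bcost (Not b) = 1 + bcost b"
| "bcost (And b d) = 1 + bcost b + bcost d"

text \<open>\<open>exec p s t s'\<close>: started in state \<open>s\<close>, program \<open>p\<close> halts in state \<open>s'\<close> after \<open>t\<close> time units.
  A non-terminating run has no derivation.\<close>

inductive exec :: "com \<Rightarrow> state \<Rightarrow> nat \<Rightarrow> state \<Rightarrow> bool" where
  Skip: "exec Skip s 1 s"
| Assign: "exec (Assign x a) s (1 + acost a) (s\<lparr>reg := (reg s)(x := aval a s)\<rparr>)"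
| Store: "exec (Store A i a) s (1 + acost i + acost a)
            (s\<lparr>arr := (arr s)(A := (arr s A)(aval i s := aval a s))\<rparr>)"
| Seq: "exec p s t s' \<Longrightarrow> exec q s' u s'' \<Longrightarrow> exec (Seq p q) s (t + u) s''"
| IfTrue: "bval b s \<Longrightarrow> exec p s t s' \<Longrightarrow> exec (If b p q) s (1 + bcost b + t) s'"
| IfFalse: "\<not> bval b s \<Longrightarrow> exec q s t s' \<Longrightarrow> exec (If b p q) s (1 + bcost b + t) s'"
| WhileFalse: "\<not> bval b s \<Longrightarrow> exec (While b p) s (1 + bcost b) s"
| WhileTrue: "bval b s \<Longrightarrow> exec p s t s' \<Longrightarrow> exec (While b p) s' u s'' \<Longrightarrow>
    exec (While b p) s (1 + bcost b + t + u) s''"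

inductive_cases exec_SkipE: "exec Skip s t s'"
inductive_cases exec_AssignE: "exec (Assign x a) s t s'"
inductive_cases exec_StoreE: "exec (Store A i a) s t s'"
inductive_cases exec_SeqE: "exec (Seq p q) s t s'"
inductive_cases exec_IfE: "exec (If b p q) s t s'"
inductive_cases exec_WhileE: "exec (While b p) s t s'"

lemma exec_deterministic:
  "exec p s t s' \<Longrightarrow> exec p s u s'' \<Longrightarrow> t = u \<and> s' = s''"
proof (induction arbitrary: u s'' rule: exec.induct)
  case (Skip s)
  then show ?case by (auto elim: exec_SkipE)
next
  case (Assign x a s)
  then show ?case by (auto elim: exec_AssignE)
next
  case (Store A i a s)
  then show ?case by (auto elim: exec_StoreE)
next
  case (Seq p s t s' q v s2)
  from Seq.prems show ?case by (rule exec_SeqE) (auto dest!: Seq.IH)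
next
  case (IfTrue b s p t s' q)
  from IfTrue.prems show ?case by (rule exec_IfE) (use IfTrue.hyps(1) in \<open>auto dest: IfTrue.IH\<close>)
next
  case (IfFalse b s q t s' p)
  from IfFalse.prems show ?case by (rule exec_IfE) (use IfFalse.hyps(1) in \<open>auto dest: IfFalse.IH\<close>)
next
  case (WhileFalse b s p)
  from WhileFalse.prems show ?case by (rule exec_WhileE) (use WhileFalse.hyps in simp_all)
next
  case (WhileTrue b s p t s' v s2)
  from WhileTrue.prems show ?case by (rule exec_WhileE) (use WhileTrue.hyps(1) in \<open>auto dest!: WhileTrue.IH\<close>)
qed


section \<open>Input and output encoding\<close>

text \<open>The input graph has vertices \<open>0, \<dots>, n - 1\<close> and is given by adjacency lists, each in
  arbitrary order.  In memory they are concatenated in the array \<open>adj\<close>; the neighbours of \<open>v\<close>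
  occupy the positions from \<open>off[v]\<close> (inclusive) to \<open>off[v + 1]\<close> (exclusive).\<close>

definition adjacency_lists :: "nat graph \<Rightarrow> nat list list \<Rightarrow> bool" where
  "adjacency_lists G adj \<longleftrightarrow>
     verts G = {0..<length adj} \<and>
     (\<forall>v < length adj. distinct (adj ! v) \<and> set (adj ! v) = {u. {v, u} \<in> edges G})"

definition list_arr :: "nat list \<Rightarrow> nat \<Rightarrow> nat" where
  "list_arr xs i = (if i < length xs then xs ! i else 0)"

definition input_state :: "nat list list \<Rightarrow> (nat \<Rightarrow> nat) \<Rightarrow> nat \<Rightarrow> state" where
  "input_state adj w k =
     (let n = length adj in
      \<lparr>reg = (\<lambda>_. 0)(''n'' := n, ''k'' := k),
       arr = (\<lambda>_ _. 0)
         (''w'' := list_arr (map w [0..<n]),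
          ''off'' := list_arr (map (\<lambda>v. length (concat (take v adj))) [0..<Suc n]),
          ''adj'' := list_arr (concat adj))\<rparr>)"

text \<open>The output is an array of labels \<open>1, \<dots>, k\<close>; part \<open>T\<^sub>i\<close> consists of the vertices
  labelled \<open>i\<close>.\<close>

definition output_parts :: "nat graph \<Rightarrow> nat \<Rightarrow> state \<Rightarrow> nat set set" where
  "output_parts G k s = (\<lambda>i. {v \<in> verts G. arr s ''part'' v = i}) ` {1..k}"

end

theory Submission
  imports Defs
begin

text \<open>For a guess \<open>X\<close> of the optimum, a linear-time routine either produces \<open>k\<close> connected parts of weight at
  least \<open>X / (c - 1)\<close> each, or shows that no connected \<open>k\<close>-partition has minimum weight \<open>X\<close>; doubling and
  binary search over \<open>X\<close> then give the approximation.

  Vertices of weight at least \<open>X / (c - 1)\<close> are pieces on their own.  On the remaining graph, a depth-first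
  search collects weight bottom-up and cuts off a piece as soon as it reaches \<open>X / (c - 1)\<close>.  Children in a
  depth-first search tree are pairwise non-adjacent, so a vertex has at most \<open>c - 1\<close> of them.  If a
  piece reaches \<open>X\<close>, its top vertex has exactly \<open>c - 1\<close> children, and as the graph has no induced star
  \<open>K\<^bsub>1,c\<^esub>\<close>, one of them is adjacent to the parent of the top vertex and can be hung there
  instead.  Thus all pieces, except one per component, weigh less than \<open>X\<close>, and a component containing \<open>m\<close>
  pieces weighs less than \<open>(m + 1) X\<close>.  Hence the number of pieces is at least the number of disjoint connected
  sets of weight \<open>X\<close>.  If there are at least \<open>k\<close> pieces, the superfluous ones and the left-over
  vertices are merged into neighbouring parts along a breadth-first search.\<close>

section \<open>Timed Hoare triples\<close>

text \<open>No separate search is made for the subtree that an overweight piece gives away: the edge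
  to it turns up when the parent's own scan reaches it. This works because a vertex discovered below
  \<open>v\<close> cannot occur in the part of the parent's list that was scanned before
  \<open>v\<close> was entered.

  After such moves the pieces are no longer subtrees of the search tree. What survives is that a
  vertex hangs at one of its ancestors and that the vertices hanging at a common vertex are pairwise
  incomparable; so they stay independent, and the star condition still bounds their number.

  The thresholds interlock: a vertex with at most \<open>c - 1\<close> hanging subtrees, all below
  \<open>X / (c - 1)\<close>, weighs less than \<open>c X / (c - 1)\<close>, and reaching
  \<open>X\<close> takes all \<open>c - 1\<close> subtrees. Giving one away leaves less than
  \<open>X\<close> but more than \<open>(c - 2) X / (c - 1)\<close>, which still suffices as
  \<open>c\<close> is at least 3.

  Refutations speak of disjoint connected sets, so no existence theorem for connected partitions is
  required. A successful guess is at most \<open>c - 1\<close> times the optimum, which bounds the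
  number of guesses logarithmically.\<close>

fun run :: "com \<Rightarrow> state \<Rightarrow> state" where
  "run (Assign x a) s = s\<lparr>reg := (reg s)(x := aval a s)\<rparr>"
| "run (Store A i a) s = s\<lparr>arr := (arr s)(A := (arr s A)(aval i s := aval a s))\<rparr>"
| "run (Seq p q) s = run q (run p s)"
| "run (If b p q) s = (if bval b s then run p s else run q s)"
| "run _ s = s"

fun loop_free :: "com \<Rightarrow> bool" where
  "loop_free (Seq p q) \<longleftrightarrow> loop_free p \<and> loop_free q"
| "loop_free (If b p q) \<longleftrightarrow> loop_free p \<and> loop_free q"
| "loop_free (While b p) \<longleftrightarrow> False"
| "loop_free _ \<longleftrightarrow> True"

text \<open>Both branches of an \<open>If\<close> are charged, so the bound does not depend on the
  state.\<close>

fun max_cost :: "com \<Rightarrow> nat" where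
  "max_cost (Assign x a) = 1 + acost a"
| "max_cost (Store A i a) = 1 + acost i + acost a"
| "max_cost (Seq p q) = max_cost p + max_cost q"
| "max_cost (If b p q) = 1 + bcost b + max_cost p + max_cost q"
| "max_cost _ = 1"

lemma exec_run: "loop_free p \<Longrightarrow> \<exists>t \<le> max_cost p. exec p s t (run p s)"
proof (induction p arbitrary: s)
  case (Seq p q)
  obtain t where t: "t \<le> max_cost p" "exec p s t (run p s)" using Seq by auto
  obtain u where u: "u \<le> max_cost q" "exec q (run p s) u (run q (run p s))" using Seq by auto
  have "exec (Seq p q) s (t + u) (run q (run p s))" using t u by (auto intro: exec.Seq)
  then show ?case using t u by (auto intro!: exI[of _ "t + u"])
next
  case (If b p q)
  obtain t where t: "t \<le> max_cost p" "exec p s t (run p s)" using If by auto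
  obtain u where u: "u \<le> max_cost q" "exec q s u (run q s)" using If by auto
  show ?case
  proof (cases "bval b s")
    case True
    then show ?thesis using exec.IfTrue[OF True t(2), of q] t(1)
      by (intro exI[of _ "1 + bcost b + t"]) simp
  next
    case False
    then show ?thesis using exec.IfFalse[OF False u(2), of p] u(1)
      by (intro exI[of _ "1 + bcost b + u"]) simp
  qed
next
  case (Assign x a)
  show ?case using exec.Assign[of x a s] by (intro exI[of _ "1 + acost a"]) simp
next
  case (Store A i a)
  show ?case using exec.Store[of A i a s] by (intro exI[of _ "1 + acost i + acost a"]) simp
next
  case Skip
  show ?case using exec.Skip[of s] by (intro exI[of _ 1]) simp
qed simp

definition triple :: "(state \<Rightarrow> bool) \<Rightarrow> com \<Rightarrow> nat \<Rightarrow> (state \<Rightarrow> bool) \<Rightarrow> bool" where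
  "triple P p T Q \<longleftrightarrow> (\<forall>s. P s \<longrightarrow> (\<exists>t s'. exec p s t s' \<and> t \<le> T \<and> Q s'))"

lemma triple_run:
  assumes "loop_free p" "\<And>s. P s \<Longrightarrow> Q (run p s)"
  shows "triple P p (max_cost p) Q"
  unfolding triple_def using exec_run[OF assms(1)] assms(2) by blast

lemma triple_seq:
  assumes "triple P p T Q" "triple Q q U R"
  shows "triple P (Seq p q) (T + U) R"
  unfolding triple_def
proof (intro allI impI)
  fix s assume "P s"
  then obtain t s' where "exec p s t s'" "t \<le> T" "Q s'" using assms(1) unfolding triple_def by blast
  moreover then obtain u s'' where "exec q s' u s''" "u \<le> U" "R s''"
    using assms(2) unfolding triple_def by blast
  ultimately show "\<exists>t s'. exec (Seq p q) s t s' \<and> t \<le> T + U \<and> R s'"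
    by (intro exI[of _ "t + u"] exI[of _ s'']) (auto intro: exec.Seq)
qed

lemma triple_conseq:
  assumes "triple P p T Q" "\<And>s. P' s \<Longrightarrow> P s" "\<And>s. Q s \<Longrightarrow> Q' s" "T \<le> T'"
  shows "triple P' p T' Q'"
  using assms unfolding triple_def by (meson le_trans)

text \<open>The index of \<open>I\<close> bounds the rounds still to come, so invariant and variant
  are a single predicate. The additional round in \<open>m + 1\<close> pays for the final failing
  test.\<close>

lemma triple_while:
  assumes "\<And>m. triple (\<lambda>s. I m s \<and> bval b s) p T (\<lambda>s. \<exists>m' < m. I m' s)"
  shows "triple (I m) (While b p) ((m + 1) * (1 + bcost b + T)) (\<lambda>s. (\<exists>m'. I m' s) \<and> \<not> bval b s)"
  unfolding triple_def
proof (intro allI impI)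
  show "\<exists>t s'. exec (While b p) s t s' \<and> t \<le> (m + 1) * (1 + bcost b + T) \<and>
      (\<exists>m'. I m' s') \<and> \<not> bval b s'" if "I m s" for s
    using that
  proof (induction m arbitrary: s rule: less_induct)
    case (less m)
    show ?case
    proof (cases "bval b s")
      case False
      then show ?thesis using less.prems exec.WhileFalse[OF False, of p]
        by (intro exI[of _ "1 + bcost b"] exI[of _ s]) auto
    next
      case True
      then obtain t s' m' where 1: "exec p s t s'" "t \<le> T" "m' < m" "I m' s'"
        using assms[of m] less.prems unfolding triple_def by blast
      then obtain u s'' where 2: "exec (While b p) s' u s''" "u \<le> (m' + 1) * (1 + bcost b + T)"
        "\<exists>m'. I m' s''" "\<not> bval b s''"
        using less.IH by blast
      have "(m' + 1) * (1 + bcost b + T) \<le> m * (1 + bcost b + T)"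
        using 1(3) by (intro mult_le_mono1) auto
      then have "1 + bcost b + t + u \<le> (m + 1) * (1 + bcost b + T)"
        using 1 2 by (simp add: algebra_simps)
      with exec.WhileTrue[OF True 1(1) 2(1)] 2 show ?thesis by blast
    qed
  qed
qed

fun written_regs :: "com \<Rightarrow> string set" where
  "written_regs (Assign x a) = {x}"
| "written_regs (Seq p q) = written_regs p \<union> written_regs q"
| "written_regs (If b p q) = written_regs p \<union> written_regs q"
| "written_regs (While b p) = written_regs p"
| "written_regs _ = {}"

fun written_arrs :: "com \<Rightarrow> string set" where
  "written_arrs (Store A i a) = {A}"
| "written_arrs (Seq p q) = written_arrs p \<union> written_arrs q"
| "written_arrs (If b p q) = written_arrs p \<union> written_arrs q"
| "written_arrs (While b p) = written_arrs p"
| "written_arrs _ = {}"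

lemma exec_frame_reg: "exec p s t s' \<Longrightarrow> x \<notin> written_regs p \<Longrightarrow> reg s' x = reg s x"
  by (induction rule: exec.induct) auto

lemma exec_frame_arr: "exec p s t s' \<Longrightarrow> A \<notin> written_arrs p \<Longrightarrow> arr s' A = arr s A"
  by (induction rule: exec.induct) auto

text \<open>The machine cannot multiply; since \<open>c\<close> is fixed, comparing
  \<open>c - 1\<close> times a weight with \<open>X\<close> by repeated addition still has constant
  cost.\<close>

fun scaled :: "nat \<Rightarrow> aexp \<Rightarrow> aexp" where
  "scaled 0 a = Const 0"
| "scaled (Suc m) a = Plus a (scaled m a)"

lemma aval_times [simp]: "aval (scaled m a) s = m * aval a s"
  by (induction m) auto

section \<open>Depth-first search with rehanging\<close>

locale adj_graph =
  fixes n :: nat and E :: "nat \<Rightarrow> nat \<Rightarrow> bool" and off nb :: "nat \<Rightarrow> nat"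
  assumes E_sym: "E u v \<Longrightarrow> E v u"
    and E_irrefl: "\<not> E v v"
    and E_less: "E u v \<Longrightarrow> u < n"
    and off_mono: "v < n \<Longrightarrow> off v \<le> off (Suc v)"
    and nb: "v < n \<Longrightarrow> nb ` {off v..<off (Suc v)} = {u. E v u}"

locale bcp_graph = adj_graph +
  fixes w :: "nat \<Rightarrow> nat" and c X :: nat
  assumes c: "c \<ge> 3"
    and star: "S \<subseteq> {u. E v u} \<Longrightarrow> card S = c \<Longrightarrow> \<exists>a\<in>S. \<exists>b\<in>S. E a b"
begin

text \<open>Throughout, \<open>X\<close> is a guess for the optimum, and a vertex is light if it weighs less than
  \<open>X / (c - 1)\<close>.  Vertex names are below \<open>n\<close>, and \<open>n\<close> itself encodes "none".\<close>

definition light :: "nat \<Rightarrow> bool" where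
  "light v \<longleftrightarrow> v < n \<and> (c - 1) * w v < X"

text \<open>The recursion stack: as \<open>A\<close> gives strict ancestors, it consists of the
  current vertex and everything above it. Between two search trees it is empty.\<close>

definition gray :: "(nat \<Rightarrow> nat set) \<Rightarrow> nat \<Rightarrow> nat set" where
  "gray A cur = (if cur = n then {} else insert cur (A cur))"

definition scan :: "(nat \<Rightarrow> nat) \<Rightarrow> nat \<Rightarrow> nat set" where
  "scan ptr v = nb ` {off v..<ptr v}"

lemma scan_upd:
  assumes "off p \<le> ptr p"
  shows "scan (ptr(p := Suc (ptr p))) v = (if v = p then insert (nb (ptr p)) (scan ptr v) else scan ptr v)"
proof -
  have "{off p..<Suc (ptr p)} = insert (ptr p) {off p..<ptr p}" using assms by auto
  then show ?thesis by (simp add: scan_def)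
qed

lemma star_bound:
  assumes "S \<subseteq> {u. E v u}" "\<And>a b. a \<in> S \<Longrightarrow> b \<in> S \<Longrightarrow> \<not> E a b"
  shows "card S < c"
proof (rule ccontr)
  assume "\<not> card S < c"
  then obtain S' where "S' \<subseteq> S" "card S' = c"
    by (meson linorder_not_less obtain_subset_with_card_n)
  with star[of S' v] assms show False by blast
qed

end

text \<open>The invariant of the depth-first search on the light vertices.  \<open>V\<close> is the set of visited
  vertices and \<open>cur\<close> the current one; the ghost variable \<open>A\<close> maps a vertex to its strict ancestors.
  \<open>hang u\<close> is the vertex to whose piece \<open>u\<close> has been attached, and \<open>R v\<close> is the weight collected
  at \<open>v\<close>.  A finished vertex that hangs nowhere has been cut off as a piece.  If such a piece weighs at
  least \<open>X\<close>, then \<open>over\<close> promises that one of its subtrees can still be moved to the parent \<open>par v\<close>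
  when the parent scans the rest of its adjacency list; the scan only meets that subtree's root
  because of \<open>unseen\<close>.\<close>

locale dfs = bcp_graph +
  fixes V :: "nat set" and A :: "nat \<Rightarrow> nat set" and par hang R ptr :: "nat \<Rightarrow> nat" and cur :: nat
  assumes V_light: "v \<in> V \<Longrightarrow> light v"
    and cur_V: "cur \<noteq> n \<Longrightarrow> cur \<in> V"
    and A_V: "v \<in> V \<Longrightarrow> A v \<subseteq> V"
    and A_irrefl: "v \<in> V \<Longrightarrow> v \<notin> A v"
    and A_trans: "v \<in> V \<Longrightarrow> y \<in> A v \<Longrightarrow> A y \<subseteq> A v"
    and A_chain: "v \<in> V \<Longrightarrow> y \<in> A v \<Longrightarrow> z \<in> A v \<Longrightarrow> y = z \<or> y \<in> A z \<or> z \<in> A y"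
    and A_root: "v \<in> V \<Longrightarrow> par v = n \<Longrightarrow> A v = {}"
    and par_V: "v \<in> V \<Longrightarrow> par v \<noteq> n \<Longrightarrow> par v \<in> V"
    and A_par: "v \<in> V \<Longrightarrow> par v \<noteq> n \<Longrightarrow> A v = insert (par v) (A (par v))"
    and E_par: "v \<in> V \<Longrightarrow> par v \<noteq> n \<Longrightarrow> E v (par v)"
    and ptr_ge: "v < n \<Longrightarrow> off v \<le> ptr v"
    and ptr_le: "v < n \<Longrightarrow> ptr v \<le> off (Suc v)"
    and ptr_white: "v < n \<Longrightarrow> v \<notin> V \<Longrightarrow> ptr v = off v"
    and ptr_done: "v \<in> V \<Longrightarrow> v \<notin> gray A cur \<Longrightarrow> ptr v = off (Suc v)"
    and scanned: "v \<in> V \<Longrightarrow> x \<in> scan ptr v \<Longrightarrow> light x \<Longrightarrow> x \<in> V"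
    and no_cross: "u \<in> V \<Longrightarrow> v \<in> V \<Longrightarrow> E u v \<Longrightarrow> u \<in> A v \<or> v \<in> A u"
    and hang_done: "u \<in> V \<Longrightarrow> hang u \<noteq> n \<Longrightarrow> u \<notin> gray A cur"
    and hang_A: "u \<in> V \<Longrightarrow> hang u \<noteq> n \<Longrightarrow> hang u \<in> A u"
    and hang_E: "u \<in> V \<Longrightarrow> hang u \<noteq> n \<Longrightarrow> E u (hang u)"
    and hang_small: "u \<in> V \<Longrightarrow> hang u \<noteq> n \<Longrightarrow> (c - 1) * R u < X"
    and hang_white: "u < n \<Longrightarrow> u \<notin> V \<Longrightarrow> hang u = n"
    and hang_below: "u \<in> V \<Longrightarrow> hang u \<noteq> n \<Longrightarrow> v \<in> gray A cur \<Longrightarrow> v \<in> A u \<Longrightarrow> hang u = v \<or> v \<in> A (hang u)"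
    and hang_inc: "u \<in> V \<Longrightarrow> u' \<in> V \<Longrightarrow> hang u = hang u' \<Longrightarrow> hang u \<noteq> n \<Longrightarrow> u \<notin> A u'"
    and over_sib: "x \<in> V \<Longrightarrow> hang x \<noteq> n \<Longrightarrow> v \<in> V \<Longrightarrow> v \<notin> gray A cur \<Longrightarrow> hang v = n \<Longrightarrow>
      par v = hang x \<Longrightarrow> X \<le> R v \<Longrightarrow> v \<notin> A x"
    and unseen: "v \<in> gray A cur \<Longrightarrow> par v \<noteq> n \<Longrightarrow> u \<in> V \<Longrightarrow> v \<in> A u \<Longrightarrow> u \<notin> scan ptr (par v)"
    and over: "v \<in> V \<Longrightarrow> v \<notin> gray A cur \<Longrightarrow> hang v = n \<Longrightarrow> par v \<noteq> n \<Longrightarrow> X \<le> R v \<Longrightarrow>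
      \<exists>u\<in>V. hang u = v \<and> E u (par v) \<and> u \<notin> scan ptr (par v)"
    and R: "v \<in> V \<Longrightarrow> R v = w v + (\<Sum>u\<in>{u\<in>V. hang u = v}. R u)"
    and R_white: "v < n \<Longrightarrow> v \<notin> V \<Longrightarrow> R v = w v"
    and cut: "v \<in> V \<Longrightarrow> v \<notin> gray A cur \<Longrightarrow> hang v = n \<Longrightarrow> par v \<noteq> n \<Longrightarrow> X \<le> (c - 1) * R v"
begin

lemma V_less: "v \<in> V \<Longrightarrow> v < n"
  using V_light by (simp add: light_def)

lemma n_notin_V [simp]: "n \<notin> V"
  using V_less by auto

lemma finite_V: "finite V"
  using V_less by (meson bounded_nat_set_is_finite)

lemma gray_V: "gray A cur \<subseteq> V"
  using cur_V A_V by (auto simp: gray_def)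

lemma gray_closed: "v \<in> gray A cur \<Longrightarrow> A v \<subseteq> gray A cur"
  using A_trans cur_V by (auto simp: gray_def split: if_splits)

lemma gray_chain: "y \<in> gray A cur \<Longrightarrow> z \<in> gray A cur \<Longrightarrow> y = z \<or> y \<in> A z \<or> z \<in> A y"
  using A_chain cur_V by (auto simp: gray_def split: if_splits)

lemma A_asym: "v \<in> V \<Longrightarrow> y \<in> A v \<Longrightarrow> v \<notin> A y"
  using A_trans A_irrefl by blast

lemma done_scan: "v \<in> V \<Longrightarrow> v \<notin> gray A cur \<Longrightarrow> scan ptr v = {u. E v u}"
  using ptr_done nb V_less by (simp add: scan_def)

lemma done_closed: "v \<in> V \<Longrightarrow> v \<notin> gray A cur \<Longrightarrow> E v u \<Longrightarrow> light u \<Longrightarrow> u \<in> V"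
  using done_scan scanned by blast

lemma kids_E: "v \<in> V \<Longrightarrow> {u\<in>V. hang u = v} \<subseteq> {u. E v u}"
  using hang_E E_sym V_less by blast

lemma kids_indep:
  assumes "v \<in> V" "a \<in> V" "hang a = v" "b \<in> V" "hang b = v"
  shows "\<not> E a b"
  using no_cross hang_inc n_notin_V assms by metis

text \<open>Vertices hanging at \<open>v\<close> are incomparable in the search tree and hence pairwise non-adjacent,
  so star-freeness bounds their number.\<close>

lemma card_kids: "v \<in> V \<Longrightarrow> card {u\<in>V. hang u = v} < c"
  using kids_E kids_indep by (intro star_bound[of _ v]) auto

text \<open>Scaling by \<open>c - 1\<close> avoids division: \<open>v\<close> and each of the
  vertices in \<open>S\<close> contribute at most \<open>X\<close>. The light vertex
  \<open>v\<close> makes the inequality strict even for empty \<open>S\<close>.\<close>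

lemma sum_kids_le:
  assumes "v \<in> V" "S \<subseteq> {u\<in>V. hang u = v}"
  shows "(c - 1) * (w v + (\<Sum>u\<in>S. R u)) < (card S + 1) * X"
proof -
  have "(\<Sum>u\<in>S. (c - 1) * R u) \<le> (\<Sum>u\<in>S. X)"
  proof (rule sum_mono)
    fix u assume "u \<in> S"
    then have "u \<in> V" "hang u = v" using assms by auto
    moreover have "v \<noteq> n" using assms n_notin_V by metis
    ultimately have "u \<in> V" "hang u \<noteq> n" by auto
    then show "(c - 1) * R u \<le> X" using hang_small[of u] by simp
  qed
  moreover have "(c - 1) * w v < X" using assms V_light by (simp add: light_def)
  ultimately show ?thesis
    unfolding add_mult_distrib2 add_mult_distrib sum_distrib_left by simp
qed

section \<open>Steps of the search: discovering, scanning, moving a subtree, finishing\<close>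

lemma discover:
  assumes "light x" "x \<notin> V" "cur \<noteq> n \<Longrightarrow> E x cur"
  shows "dfs n E off nb w c X (insert x V) (A(x := gray A cur)) (par(x := cur)) hang R ptr x"
proof -
  let ?A = "A(x := gray A cur)" and ?par = "par(x := cur)"
  have x: "x < n" "x \<noteq> n" using assms by (auto simp: light_def)
  have xA: "v \<in> V \<Longrightarrow> x \<notin> A v" for v using A_V assms by blast
  have A': "v \<in> V \<Longrightarrow> ?A v = A v" for v using assms by auto
  have g: "gray ?A x = insert x (gray A cur)" using x by (simp add: gray_def)
  have xg: "x \<notin> gray A cur" using gray_V assms by blast
  have hx: "hang x = n" using hang_white x assms by blast
  have hx': "v \<in> V \<Longrightarrow> hang v \<noteq> x" for v using hang_A xA x by metis
  have kids: "{u \<in> insert x V. hang u = v} = {u\<in>V. hang u = v}" if "v \<noteq> n" for v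
    using hx that by auto
  \<comment> \<open>A finished vertex has all its light neighbours visited, so the visited
    neighbours of the undiscovered \<open>x\<close> are gray and become its ancestors. Hence no
    cross edge can arise.\<close>
  have ex: "v \<in> V \<Longrightarrow> E v x \<Longrightarrow> v \<in> gray A cur" for v
    using done_closed[of v x] assms by blast
  have scx: "v \<in> V \<Longrightarrow> x \<notin> scan ptr v" for v using scanned assms by blast
  have px: "scan ptr x = {}" using ptr_white[OF x(1) assms(2)] by (simp add: scan_def)
  show ?thesis
  proof (unfold_locales, goal_cases)
    case (1 v) then show ?case using V_light assms by auto
  next
    case 2 then show ?case by simp
  next
    case (3 v) then show ?case using A_V gray_V by auto
  next
    case (4 v) then show ?case using A_irrefl xg by auto
  next
    case (5 v y)
    then have "y \<noteq> x" using xA xg by (auto split: if_splits)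
    then show ?case using 5 A_trans[of v y] gray_closed[of y] by (auto split: if_splits)
  next
    case (6 v y z)
    show ?case
    proof (cases "v = x")
      case True
      then have "y \<in> gray A cur" "z \<in> gray A cur" using 6 by simp_all
      then show ?thesis using gray_chain[of y z] xg by (metis fun_upd_other)
    next
      case False
      then have "v \<in> V" "y \<in> A v" "z \<in> A v" using 6 by simp_all
      then show ?thesis using A_chain[of v y z] xA[of v] by (metis fun_upd_other)
    qed
  next
    case (7 v) then show ?case using A_root by (auto simp: gray_def split: if_splits)
  next
    case (8 v) then show ?case using par_V cur_V by (auto split: if_splits)
  next
    case (9 v)
    show ?case
    proof (cases "v = x")
      case True
      then have "cur \<noteq> n" using 9 by simp
      moreover have "cur \<noteq> x" using cur_V[OF calculation] assms by blast
      ultimately show ?thesis using True by (simp add: gray_def)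
    next
      case False
      then have v: "v \<in> V" "par v \<noteq> n" using 9 by simp_all
      then have "par v \<noteq> x" using par_V assms(2) by metis
      then show ?thesis using A_par[OF v] False by simp
    qed
  next
    case (10 v) then show ?case using E_par assms by (auto split: if_splits)
  next
    case (11 v) then show ?case using ptr_ge by auto
  next
    case (12 v) then show ?case using ptr_le by auto
  next
    case (13 v) then show ?case using ptr_white by auto
  next
    case (14 v) then show ?case using ptr_done g by auto
  next
    case (15 v y) then show ?case using scanned px by auto
  next
    case (16 u v) then show ?case using no_cross ex E_sym E_irrefl by auto
  next
    case (17 u) then show ?case using hang_done hx g by auto
  next
    case (18 u) then show ?case using hang_A hx assms by auto
  next
    case (19 u) then show ?case using hang_E hx assms by auto
  next
    case (20 u) then show ?case using hang_small hx assms by auto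
  next
    case (21 u) then show ?case using hang_white by auto
  next
    case (22 u v)
    then have "u \<in> V" "u \<noteq> x" using hx by auto
    with 22 have "v \<in> A u" by auto
    then have "v \<noteq> x" using xA \<open>u \<in> V\<close> by auto
    then show ?case using 22 hang_below[of u v] \<open>u \<in> V\<close> \<open>v \<in> A u\<close> g hx' by auto
  next
    case (23 u u') then show ?case using hang_inc[of u u'] hx xA by (auto split: if_splits)
  next
    case (24 y v) then show ?case using over_sib[of y v] hx g assms(2) xA by (auto split: if_splits)
  next
    case (25 v u)
    \<comment> \<open>For \<open>unseen\<close>: the new vertex lies below every gray vertex, yet no
      scanned prefix contains it, because scanned light vertices are visited.\<close>
    show ?case
    proof (cases "v = x")
      case True
      then show ?thesis using 25 xA xg by (auto split: if_splits)
    next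
      case False
      then have "v \<in> gray A cur" "par v \<noteq> n" using 25 g by auto
      then show ?thesis using 25 False unseen[of v u] scx par_V gray_V by (auto split: if_splits)
    qed
  next
    case (26 v) then show ?case using over[of v] g by auto
  next
    case (27 v)
    show ?case
    proof (cases "v = x")
      case True
      have "{u \<in> insert x V. hang u = x} = {}" using hx' hx x by auto
      then show ?thesis unfolding True using R_white[OF x(1) assms(2)] by (metis sum.empty add_0_right)
    next
      case False
      then show ?thesis using 27 kids R V_less[of v] by auto
    qed
  next
    case (28 v) then show ?case using R_white by auto
  next
    case (29 v) then show ?case using cut[of v] g by auto
  qed
qed

text \<open>The pointer may belong to any gray \<open>p\<close>, because a newly discovered vertex
  is already current when the pointer of its parent moves. The last premise excludes passing a
  subtree that an overweight child of \<open>p\<close> still has to give away.\<close>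

lemma advance:
  assumes "cur \<noteq> n" "ptr p < off (Suc p)" "p \<in> gray A cur"
    and "light (nb (ptr p)) \<Longrightarrow> nb (ptr p) \<in> V"
    and "\<And>v. v \<in> gray A cur \<Longrightarrow> par v = p \<Longrightarrow> nb (ptr p) \<in> V \<Longrightarrow> v \<notin> A (nb (ptr p))"
    and "\<not> (hang (nb (ptr p)) \<noteq> n \<and> par (hang (nb (ptr p))) = p \<and> X \<le> R (hang (nb (ptr p))))"
  shows "dfs n E off nb w c X V A par hang R (ptr(p := Suc (ptr p))) cur"
proof -
  have pV: "p \<in> V" using assms gray_V by auto
  have sc: "scan (ptr(p := Suc (ptr p))) v =
      (if v = p then insert (nb (ptr p)) (scan ptr v) else scan ptr v)" for v
    using scan_upd ptr_ge V_less pV by blast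
  show ?thesis
  proof (unfold_locales, goal_cases)
    case (1 v) then show ?case using V_light by auto
  next
    case 2 then show ?case using cur_V by simp
  next
    case (3 v) then show ?case using A_V by auto
  next
    case (4 v) then show ?case using A_irrefl by auto
  next
    case (5 v y) then show ?case using A_trans by auto
  next
    case (6 v y z) then show ?case using A_chain by auto
  next
    case (7 v) then show ?case using A_root by auto
  next
    case (8 v) then show ?case using par_V by auto
  next
    case (9 v) then show ?case using A_par by auto
  next
    case (10 v) then show ?case using E_par by auto
  next
    case (11 v) then show ?case using ptr_ge[of v] by auto
  next
    case (12 v) then show ?case using ptr_le assms by auto
  next
    case (13 v) then show ?case using ptr_white pV by auto
  next
    case (14 v) then show ?case using ptr_done assms by auto
  next
    case (15 v y) then show ?case using scanned assms sc by (auto split: if_splits)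
  next
    case (16 u v) then show ?case using no_cross by auto
  next
    case (17 u) then show ?case using hang_done by auto
  next
    case (18 u) then show ?case using hang_A by auto
  next
    case (19 u) then show ?case using hang_E by auto
  next
    case (20 u) then show ?case using hang_small by auto
  next
    case (21 u) then show ?case using hang_white by auto
  next
    case (22 u v) then show ?case using hang_below[of u v] by auto
  next
    case (23 u u') then show ?case using hang_inc[of u u'] by auto
  next
    case (24 y v) then show ?case using over_sib[of y v] by auto
  next
    case (25 v u) then show ?case using unseen[of v u] assms(5)[of v] sc by (auto split: if_splits)
  next
    case (26 v)
    then obtain u where u: "u \<in> V" "hang u = v" "E u (par v)" "u \<notin> scan ptr (par v)"
      using over[of v] by auto
    moreover have "v \<noteq> n" using 26 n_notin_V by metis
    ultimately have "u \<noteq> nb (ptr p) \<or> par v \<noteq> p" using assms(6) 26 by auto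
    then show ?case using u sc by auto
  next
    case (27 v) then show ?case using R by auto
  next
    case (28 v) then show ?case using R_white by auto
  next
    case (29 v) then show ?case using cut[of v] by auto
  qed
qed

text \<open>More than \<open>X - X / (c - 1)\<close> remains after the subtree is removed, and
  \<open>c\<close> being at least 3 makes this at least \<open>X / (c - 1)\<close>: the reduced
  piece is still good.\<close>

lemma rehang_big:
  assumes "x \<in> V" "hang x \<noteq> n" "X \<le> R v"
  shows "X \<le> (c - 1) * (R v - R x)"
proof -
  have "(c - 1) * X \<le> (c - 1) * R v" using assms by simp
  moreover have "(c - 1) * R x < X" using hang_small assms by blast
  moreover have "2 * X \<le> (c - 1) * X" using c by (intro mult_le_mono1) auto
  ultimately show ?thesis unfolding diff_mult_distrib2 by linarith
qed

text \<open>A single move brings the overweight child of \<open>cur\<close> below \<open>X\<close>,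
  so its promise in \<open>over\<close> is discharged. The moved \<open>x\<close> still hangs at an
  ancestor, now one level higher than before.\<close>

lemma rehang:
  assumes "cur \<noteq> n" "x \<in> V" "hang x \<noteq> n" "par (hang x) = cur" "X \<le> R (hang x)" "E x cur"
  shows "dfs n E off nb w c X V A par (hang(x := cur))
    (R(hang x := R (hang x) - R x, cur := R cur + R x)) ptr cur"
proof -
  define v where "v = hang x"
  have vA: "v \<in> A x" using hang_A assms v_def by blast
  have vV: "v \<in> V" using A_V vA assms by blast
  have vn: "v \<noteq> n" using vV n_notin_V by metis
  have Av: "A v = insert cur (A cur)" using A_par[of v] vV assms by (auto simp: v_def)
  have cV: "cur \<in> V" using cur_V assms by blast
  have cg: "cur \<in> gray A cur" using assms by (simp add: gray_def)
  have vg: "v \<notin> gray A cur" using A_irrefl[of v] Av vV assms by (simp add: gray_def)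
  have vc: "v \<noteq> cur" using vg cg by metis
  have cA: "cur \<in> A x" using A_trans[of x v] vA assms Av by auto
  have xc: "x \<noteq> cur" using A_irrefl cA assms by metis
  have xv: "x \<noteq> v" using A_irrefl vA assms by metis
  have hv: "hang v = n"
  proof (rule ccontr)
    assume "hang v \<noteq> n"
    then have "(c - 1) * R v < X" using hang_small vV by blast
    moreover have "1 * R v \<le> (c - 1) * R v" using c by (intro mult_le_mono1) auto
    moreover have "X \<le> R v" using assms v_def by simp
    ultimately show False by linarith
  qed
  have xg: "x \<notin> gray A cur" using hang_done assms by blast
  let ?h = "hang(x := cur)" and ?R = "R(v := R v - R x, cur := R cur + R x)"
  have sum_x: "R v = w v + R x + (\<Sum>u\<in>{u\<in>V. hang u = v} - {x}. R u)"
    using R[OF vV] sum.remove[of "{u\<in>V. hang u = v}" x R] finite_V assms v_def by auto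
  have Rv: "R v - R x = w v + (\<Sum>u\<in>{u\<in>V. hang u = v} - {x}. R u)"
    using sum_x by simp
  \<comment> \<open>At most \<open>c - 2\<close> vertices keep hanging at \<open>v\<close>; together
    with \<open>v\<close> these are at most \<open>c - 1\<close> terms below
    \<open>X / (c - 1)\<close>.\<close>
  have small: "R v - R x < X"
  proof -
    have "card ({u\<in>V. hang u = v} - {x}) + 2 \<le> c"
      using card_kids[OF vV] c assms v_def by (simp add: card_Diff_singleton)
    then have "(card ({u\<in>V. hang u = v} - {x}) + 1) * X \<le> (c - 1) * X"
      by (intro mult_le_mono1) auto
    then have "(c - 1) * (R v - R x) < (c - 1) * X"
      using sum_kids_le[OF vV, of "{u\<in>V. hang u = v} - {x}"] unfolding Rv
      by (rule less_le_trans[rotated]) blast+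
    then show ?thesis by simp
  qed
  have big: "X \<le> (c - 1) * (R v - R x)"
    using rehang_big assms(2,3,5) v_def by simp
  \<comment> \<open>Vertices already hanging at \<open>cur\<close> are incomparable with
    \<open>x\<close>. By \<open>over_sib\<close> they do not lie below \<open>v\<close>, hence not
    below \<open>x\<close>. One above \<open>x\<close> would then be above \<open>v\<close>, thus
    gray, and gray vertices hang nowhere.\<close>
  have hc: "hang u \<noteq> cur \<or> u \<in> V \<and> u \<noteq> x \<and> u \<notin> A x \<and> x \<notin> A u" if u: "u \<in> V" for u
  proof (rule ccontr)
    assume "\<not> ?thesis"
    then have hu: "hang u = cur" and ux: "u = x \<or> u \<in> A x \<or> x \<in> A u" using u by auto
    have nv: "v \<notin> A u"
      using over_sib[of u v] u hu assms vV vg hv v_def by metis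
    have "u \<noteq> x" using hu vc v_def by metis
    moreover have "x \<notin> A u" using A_trans[of u x] u vA nv by blast
    ultimately have "u \<in> A x" using ux by blast
    moreover have "u \<noteq> v" using hu hv assms by metis
    ultimately have "u \<in> A v" using A_chain[of x u v] assms vA nv by blast
    then have "u \<in> gray A cur" using Av assms by (simp add: gray_def)
    then show False using hang_done hu u assms by metis
  qed
  have "dfs n E off nb w c X V A par ?h ?R ptr cur"
  proof (unfold_locales, goal_cases)
    case (1 v) then show ?case using V_light by auto
  next
    case 2 then show ?case using cur_V by simp
  next
    case (3 v) then show ?case using A_V by auto
  next
    case (4 v) then show ?case using A_irrefl by auto
  next
    case (5 v y) then show ?case using A_trans by auto
  next
    case (6 v y z) then show ?case using A_chain by auto
  next
    case (7 v) then show ?case using A_root by auto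
  next
    case (8 v) then show ?case using par_V by auto
  next
    case (9 v) then show ?case using A_par by auto
  next
    case (10 v) then show ?case using E_par by auto
  next
    case (11 v) then show ?case using ptr_ge by auto
  next
    case (12 v) then show ?case using ptr_le by auto
  next
    case (13 v) then show ?case using ptr_white by auto
  next
    case (14 v) then show ?case using ptr_done by auto
  next
    case (15 v y) then show ?case using scanned by auto
  next
    case (16 u v) then show ?case using no_cross by auto
  next
    case (17 u) then show ?case using hang_done xg by (auto split: if_splits)
  next
    case (18 u) then show ?case using hang_A cA by auto
  next
    case (19 u) then show ?case using hang_E assms by auto
  next
    case (20 u)
    have "u \<noteq> v" using 20 hv xv by auto
    moreover have "u \<noteq> cur" using 20 hang_done[of u] cg xc by auto
    ultimately show ?case using hang_small 20 assms by (auto split: if_splits)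
  next
    case (21 u) then show ?case using hang_white assms by auto
  next
    case (22 u z) 
    show ?case
    proof (cases "u = x")
      case True
      then show ?thesis using 22 by (auto simp: gray_def split: if_splits)
    next
      case False
      then show ?thesis using 22 hang_below[of u z] by auto
    qed
  next
    case (23 u u')
    then show ?case using hang_inc[of u u'] hc[of u] hc[of u'] A_irrefl[of x] by (auto split: if_splits)
  next
    case (24 y z)
    then have zc: "z \<noteq> cur" using cg by auto
    then have zv: "z \<noteq> v" using 24 small by auto
    have zx: "z \<noteq> x" using 24 assms(1) by auto
    have z: "hang z = n" "X \<le> R z" using 24 zc zv zx by auto
    \<comment> \<open>For \<open>over_sib\<close>: \<open>z\<close> and \<open>v\<close> are
      children of the same vertex, so neither is above the other, whereas the ancestors of
      \<open>x\<close> form a chain through \<open>v\<close>.\<close>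
    show ?case
    proof (cases "y = x")
      case True
      show ?thesis
      proof
        assume "z \<in> A y"
        then have "z \<in> A v \<or> v \<in> A z" using A_chain[of x z v] True assms vA zv by blast
        moreover have "par z = cur" using 24 True by simp
        then have "A z = insert cur (A cur)" using A_par[of z] 24 assms by auto
        ultimately show False using A_irrefl[OF vV] A_irrefl[of z] 24(3) Av by auto
      qed
    next
      case False
      then show ?thesis using over_sib[of y z] 24 z by auto
    qed
  next
    case (25 v u) then show ?case using unseen by auto
  next
    case (26 z)
    then have zc: "z \<noteq> cur" using cg by auto
    then have zv: "z \<noteq> v" using 26 small by auto
    have zx: "z \<noteq> x" using 26 assms(1) by auto
    have z: "hang z = n" "X \<le> R z" using 26 zc zv zx by auto
    then obtain u where u: "u \<in> V" "hang u = z" "E u (par z)" "u \<notin> scan ptr (par z)"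
      using over[of z] 26 by auto
    then have "u \<noteq> x" using zv v_def by auto
    then show ?case using u by auto
  next
    case (27 z)
    have nx: "{u\<in>V. ?h u = z} = (if z = cur then insert x {u\<in>V. hang u = cur}
       else if z = v then {u\<in>V. hang u = v} - {x} else {u\<in>V. hang u = z})"
      using assms(2) v_def vc by auto
    \<comment> \<open>\<open>R\<close> changes only at \<open>v\<close> and \<open>cur\<close>.
      Neither of them hangs anywhere, so no sum over hanging vertices sees the change.\<close>
    have nv: "v \<notin> {u\<in>V. ?h u = z}"
      using hv xv 27 n_notin_V by (metis (mono_tags, lifting) fun_upd_other mem_Collect_eq)
    have nc: "cur \<notin> {u\<in>V. ?h u = z}"
      using hang_done[OF cV] cg 27 xc n_notin_V by (metis (mono_tags, lifting) fun_upd_other mem_Collect_eq)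
    have "(\<Sum>u\<in>{u\<in>V. ?h u = z}. ?R u) = (\<Sum>u\<in>{u\<in>V. ?h u = z}. R u)"
      using nv nc by (intro sum.cong) auto
    moreover have "x \<notin> {u\<in>V. hang u = cur}" using vc v_def by auto
    ultimately show ?case using R[OF 27] Rv nx vc finite_V by (auto split: if_splits)
  next
    case (28 z) then show ?case using R_white vV cV by auto
  next
    case (29 z)
    then have "z \<noteq> x" using assms by auto
    then show ?case using cut[of z] 29 big cg by auto
  qed
  then show ?thesis by (simp add: v_def)
qed

lemma gray_par:
  assumes "cur \<noteq> n"
  shows "gray A (par cur) = A cur" "cur \<notin> A cur"
  using assms A_root[of cur] A_par[of cur] cur_V A_irrefl[of cur] by (auto simp: gray_def)

text \<open>If \<open>cur\<close> is finished with weight at least \<open>X\<close>, then exactly \<open>c - 1\<close> vertices hang at it, each of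
  collected weight below \<open>X / (c - 1)\<close>.  Together with the parent they would form an induced star, so the
  parent is adjacent to one of them.\<close>

lemma finish_keep:
  assumes "cur \<noteq> n" "ptr cur = off (Suc cur)" "par cur = n \<or> X \<le> (c - 1) * R cur"
  shows "dfs n E off nb w c X V A par hang R ptr (par cur)"
proof -
  have cV: "cur \<in> V" using cur_V assms by blast
  have cg: "cur \<in> gray A cur" using assms by (simp add: gray_def)
  have g: "gray A (par cur) = gray A cur - {cur}"
    using gray_par[OF assms(1)] assms(1) by (auto simp: gray_def)
  have hc: "hang cur = n" using hang_done cV cg by blast
  have ov: "\<exists>u\<in>V. hang u = cur \<and> E u (par cur) \<and> u \<notin> scan ptr (par cur)"
    if "par cur \<noteq> n" "X \<le> R cur"
  proof -
    let ?K = "{u\<in>V. hang u = cur}"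
    have KA: "u \<in> ?K \<Longrightarrow> cur \<in> A u" for u using hang_A assms(1) by auto
    have pA: "par cur \<in> A cur" using A_par[OF cV] that by auto
    have "par cur \<notin> ?K" using KA A_asym[OF cV pA] by blast
    moreover have "finite ?K" using finite_V by simp
    moreover have "c - 1 \<le> card ?K"
    proof -
      have "(c - 1) * X \<le> (c - 1) * R cur" using that by simp
      also have "\<dots> < (card ?K + 1) * X" using sum_kids_le[OF cV order_refl] R[OF cV] by simp
      finally show ?thesis by (simp del: add_Suc_right)
    qed
    ultimately have 1: "card (insert (par cur) ?K) = c"
      using card_kids[OF cV] by (simp add: card_insert_if)
    have "insert (par cur) ?K \<subseteq> {u. E cur u}"
      using kids_E[OF cV] E_par[OF cV that(1)] by auto
    from star[OF this 1] obtain a b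
      where "a \<in> insert (par cur) ?K" "b \<in> insert (par cur) ?K" "E a b"
      by blast
    then obtain u where "u \<in> ?K" "E u (par cur)"
      using kids_indep[OF cV] E_irrefl E_sym by blast
    then show ?thesis using unseen[OF cg that(1)] KA by blast
  qed
  show ?thesis
  proof (unfold_locales, goal_cases)
    case (1 v) then show ?case using V_light by auto
  next
    case 2 then show ?case using par_V cV by simp
  next
    case (3 v) then show ?case using A_V by auto
  next
    case (4 v) then show ?case using A_irrefl by auto
  next
    case (5 v y) then show ?case using A_trans by auto
  next
    case (6 v y z) then show ?case using A_chain by auto
  next
    case (7 v) then show ?case using A_root by auto
  next
    case (8 v) then show ?case using par_V by auto
  next
    case (9 v) then show ?case using A_par by auto
  next
    case (10 v) then show ?case using E_par by auto
  next
    case (11 v) then show ?case using ptr_ge by auto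
  next
    case (12 v) then show ?case using ptr_le by auto
  next
    case (13 v) then show ?case using ptr_white by auto
  next
    case (14 v) then show ?case using ptr_done[of v] assms g by auto
  next
    case (15 v y) then show ?case using scanned by auto
  next
    case (16 u v) then show ?case using no_cross by auto
  next
    case (17 u) then show ?case using hang_done g by auto
  next
    case (18 u) then show ?case using hang_A by auto
  next
    case (19 u) then show ?case using hang_E by auto
  next
    case (20 u) then show ?case using hang_small by auto
  next
    case (21 u) then show ?case using hang_white by auto
  next
    case (22 u z) then show ?case using hang_below[of u z] g by auto
  next
    case (23 u u') then show ?case using hang_inc[of u u'] by auto
  next
    case (24 y z)
    \<comment> \<open>\<open>over_sib\<close> begins to apply to \<open>cur\<close> here. It holds
      because, by \<open>hang_below\<close>, nothing below the still gray \<open>cur\<close> hangs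
      at a vertex above it.\<close>
    show ?case
    proof (cases "z = cur")
      case True
      show ?thesis
      proof
        assume "z \<in> A y"
        then have "hang y = cur \<or> cur \<in> A (hang y)" using hang_below[of y cur] 24 cg True by auto
        moreover have "hang y = par cur" using 24 True by simp
        moreover have "par cur \<in> A cur" using A_par[OF cV] 24 True by auto
        ultimately show False using A_irrefl[OF cV] A_asym[OF cV] by metis
      qed
    next
      case False
      then show ?thesis using over_sib[of y z] 24 g by auto
    qed
  next
    case (25 z u) then show ?case using unseen g by auto
  next
    case (26 z) then show ?case using over[of z] ov g by auto
  next
    case (27 z) then show ?case using R by auto
  next
    case (28 z) then show ?case using R_white by auto
  next
    case (29 z) then show ?case using cut[of z] assms g by auto
  qed
qed

lemma finish_hang:
  assumes "cur \<noteq> n" "ptr cur = off (Suc cur)" "par cur \<noteq> n" "(c - 1) * R cur < X"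
  shows "dfs n E off nb w c X V A par (hang(cur := par cur))
    (R(par cur := R (par cur) + R cur)) ptr (par cur)"
proof -
  let ?p = "par cur"
  have cV: "cur \<in> V" using cur_V assms by blast
  have pV: "?p \<in> V" using par_V cV assms by blast
  have cg: "cur \<in> gray A cur" using assms by (simp add: gray_def)
  have g: "gray A ?p = gray A cur - {cur}"
    using gray_par[OF assms(1)] assms(1) by (auto simp: gray_def)
  have hc: "hang cur = n" using hang_done cV cg by blast
  have pA: "?p \<in> A cur" using A_par[OF cV] assms by auto
  have pc: "?p \<noteq> cur" using A_irrefl[OF cV] pA by metis
  have pg: "?p \<in> gray A cur" using pA assms by (simp add: gray_def)
  have pg': "?p \<in> gray A ?p" using assms by (simp add: gray_def)
  have hp: "hang ?p = n" using hang_done pV pg by blast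
  \<comment> \<open>A vertex hanging at the parent is not below \<open>cur\<close> by
    \<open>hang_below\<close>, and not above it since it would then be gray. So \<open>cur\<close>
    joins an incomparable family.\<close>
  have ncy: "cur \<notin> A y" if "y \<in> V" "hang y = ?p" for y
  proof
    assume "cur \<in> A y"
    then have "?p = cur \<or> cur \<in> A ?p" using hang_below[of y cur] that cg assms by auto
    then show False using pc A_asym[OF cV pA] by auto
  qed
  have nyc: "y \<notin> A cur" if "y \<in> V" "hang y = ?p" for y
  proof
    assume "y \<in> A cur"
    then have "y \<in> gray A cur" using assms by (simp add: gray_def)
    then show False using hang_done[of y] that assms by auto
  qed
  show ?thesis
  proof (unfold_locales, goal_cases)
    case (1 v) then show ?case using V_light by auto
  next
    case 2 then show ?case using pV by simp
  next
    case (3 v) then show ?case using A_V by auto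
  next
    case (4 v) then show ?case using A_irrefl by auto
  next
    case (5 v y) then show ?case using A_trans by auto
  next
    case (6 v y z) then show ?case using A_chain by auto
  next
    case (7 v) then show ?case using A_root by auto
  next
    case (8 v) then show ?case using par_V by auto
  next
    case (9 v) then show ?case using A_par by auto
  next
    case (10 v) then show ?case using E_par by auto
  next
    case (11 v) then show ?case using ptr_ge by auto
  next
    case (12 v) then show ?case using ptr_le by auto
  next
    case (13 v) then show ?case using ptr_white by auto
  next
    case (14 v) then show ?case using ptr_done[of v] assms g by auto
  next
    case (15 v y) then show ?case using scanned by auto
  next
    case (16 u v) then show ?case using no_cross by auto
  next
    case (17 u) then show ?case using hang_done[of u] g by (auto split: if_splits)
  next
    case (18 u) then show ?case using hang_A pA by auto
  next
    case (19 u) then show ?case using hang_E E_par[OF cV] assms by auto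
  next
    case (20 u)
    have "u \<noteq> ?p" using 20 hp pc by auto
    then show ?case using hang_small[of u] 20 assms by (auto split: if_splits)
  next
    case (21 u) then show ?case using hang_white cV by auto
  next
    case (22 u z)
    then show ?case using hang_below[of u z] g A_par[OF cV] assms by (auto split: if_splits)
  next
    case (23 u u') then show ?case
      using hang_inc[of u u'] ncy[of u'] nyc[of u] A_irrefl[OF cV] by (auto split: if_splits)
  next
    case (24 y z)
    have zc: "z \<noteq> cur" using 24 assms by auto
    have zp: "z \<noteq> ?p" using 24 pg' by auto
    have zg: "z \<notin> gray A cur" "hang z = n" "X \<le> R z" using 24 zc zp g by auto
    show ?case
    proof (cases "y = cur")
      case True
      show ?thesis
      proof
        assume "z \<in> A y"
        then have "z \<in> gray A cur" using True assms by (simp add: gray_def)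
        then show False using zg by auto
      qed
    next
      case False
      then show ?thesis using over_sib[of y z] 24 zg by auto
    qed
  next
    case (25 z u) then show ?case using unseen g by auto
  next
    case (26 z)
    have zc: "z \<noteq> cur" using 26 assms by auto
    have zp: "z \<noteq> ?p" using 26 pg' by auto
    have zg: "z \<notin> gray A cur" "hang z = n" "X \<le> R z" using 26 zc zp g by auto
    then obtain u where u: "u \<in> V" "hang u = z" "E u (par z)" "u \<notin> scan ptr (par z)"
      using over[of z] 26 by auto
    have "z \<noteq> n" using 26 n_notin_V by metis
    then have "u \<noteq> cur" using u hc by metis
    then show ?case using u by auto
  next
    case (27 z)
    have zn: "z \<noteq> n" using 27 n_notin_V by metis
    have nx: "{u\<in>V. (hang(cur := ?p)) u = z} = (if z = ?p then insert cur {u\<in>V. hang u = ?p}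
       else {u\<in>V. hang u = z})"
      using hc zn cV by auto
    have np: "?p \<notin> {u\<in>V. (hang(cur := ?p)) u = z}" using hp pc zn by auto
    have "(\<Sum>u\<in>{u\<in>V. (hang(cur := ?p)) u = z}. (R(?p := R ?p + R cur)) u) =
        (\<Sum>u\<in>{u\<in>V. (hang(cur := ?p)) u = z}. R u)"
      using np by (intro sum.cong) auto
    moreover have "cur \<notin> {u\<in>V. hang u = ?p}" using hc assms by auto
    ultimately show ?case using R[OF 27] nx finite_V by (auto split: if_splits)
  next
    case (28 z) then show ?case using R_white pV by auto
  next
    case (29 z)
    have zc: "z \<noteq> cur" using 29 assms by auto
    have zp: "z \<noteq> ?p" using 29 pg' by auto
    show ?case using cut[of z] 29 zc zp g by auto
  qed
qed

end

section \<open>Pieces cut off by the search\<close>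

context adj_graph
begin

definition adj_in :: "nat set \<Rightarrow> (nat \<times> nat) set" where
  "adj_in S = {(u, v). E u v \<and> u \<in> S \<and> v \<in> S}"

definition con :: "nat set \<Rightarrow> bool" where
  "con S \<longleftrightarrow> (\<forall>u\<in>S. \<forall>v\<in>S. (u, v) \<in> (adj_in S)\<^sup>*)"

lemma adj_in_mono: "S \<subseteq> T \<Longrightarrow> (adj_in S)\<^sup>* \<subseteq> (adj_in T)\<^sup>*"
  by (intro rtrancl_mono) (auto simp: adj_in_def)

lemma adj_in_sym: "(u, v) \<in> (adj_in S)\<^sup>* \<Longrightarrow> (v, u) \<in> (adj_in S)\<^sup>*"
proof -
  have "sym (adj_in S)" using E_sym by (auto simp: sym_def adj_in_def)
  then show "(u, v) \<in> (adj_in S)\<^sup>* \<Longrightarrow> (v, u) \<in> (adj_in S)\<^sup>*"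
    by (metis sym_rtrancl symD)
qed

lemma conI_root:
  assumes "\<And>v. v \<in> S \<Longrightarrow> (v, r) \<in> (adj_in S)\<^sup>*"
  shows "con S"
  unfolding con_def using assms adj_in_sym by (meson rtrancl_trans)

lemma con_union:
  assumes "con S" "con T" "x \<in> S" "y \<in> T" "E x y"
  shows "con (S \<union> T)"
proof (rule conI_root[of _ y])
  have xy: "(x, y) \<in> adj_in (S \<union> T)" using assms by (auto simp: adj_in_def)
  fix v assume "v \<in> S \<union> T"
  then show "(v, y) \<in> (adj_in (S \<union> T))\<^sup>*"
  proof
    assume "v \<in> S"
    then have "(v, x) \<in> (adj_in (S \<union> T))\<^sup>*"
      using assms adj_in_mono[of S "S \<union> T"] by (auto simp: con_def)
    then show ?thesis using xy by (rule rtrancl_into_rtrancl)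
  next
    assume "v \<in> T"
    then show ?thesis using assms adj_in_mono[of T "S \<union> T"] by (auto simp: con_def)
  qed
qed

lemma con_closed:
  assumes "con S" "x \<in> S" "x \<in> D" "\<And>u v. u \<in> S \<Longrightarrow> v \<in> S \<Longrightarrow> E u v \<Longrightarrow> u \<in> D \<Longrightarrow> v \<in> D"
  shows "S \<subseteq> D"
proof
  fix v assume "v \<in> S"
  then have "(x, v) \<in> (adj_in S)\<^sup>*" using assms by (auto simp: con_def)
  then show "v \<in> D" by induction (use assms in \<open>auto simp: adj_in_def\<close>)
qed

end

locale dfs_end = dfs +
  assumes cur_end: "cur = n" and V_all: "light v \<Longrightarrow> v \<in> V"
begin

definition good :: "nat \<Rightarrow> bool" where
  "good v \<longleftrightarrow> v < n \<and> hang v = n \<and> X \<le> (c - 1) * R v"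

definition D :: "nat \<Rightarrow> nat set" where
  "D r = {v\<in>V. v = r \<or> r \<in> A v}"

lemma gray_end [simp]: "gray A cur = {}"
  using cur_end by (simp add: gray_def)

lemma finite_good: "finite {v. good v}"
  unfolding good_def by simp

text \<open>Sum the recurrence for \<open>R\<close> over \<open>P\<close>: the terms of hanging vertices cancel.\<close>

lemma weight_closed:
  assumes "P \<subseteq> V" "\<And>u. u \<in> V \<Longrightarrow> hang u \<noteq> n \<Longrightarrow> u \<in> P \<longleftrightarrow> hang u \<in> P"
  shows "(\<Sum>v\<in>{v\<in>P. hang v = n}. R v) = (\<Sum>v\<in>P. w v)"
proof -
  let ?Q = "{v\<in>P. hang v \<noteq> n}"
  have f: "finite P" using assms finite_V finite_subset by blast
  have kids: "{u\<in>V. hang u = v} = {u\<in>?Q. hang u = v}" if "v \<in> P" for v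
  proof -
    have "v \<noteq> n" using that assms n_notin_V by blast
    then show ?thesis using that assms by auto
  qed
  have "(\<Sum>v\<in>P. R v) = (\<Sum>v\<in>P. w v + (\<Sum>u\<in>{u\<in>V. hang u = v}. R u))"
    using assms R by (intro sum.cong) auto
  also have "\<dots> = (\<Sum>v\<in>P. w v) + (\<Sum>v\<in>P. \<Sum>u\<in>{u\<in>?Q. hang u = v}. R u)"
    using kids by (simp add: sum.distrib)
  also have "(\<Sum>v\<in>P. \<Sum>u\<in>{u\<in>?Q. hang u = v}. R u) = (\<Sum>u\<in>?Q. R u)"
    using f assms by (intro sum.group) auto
  finally have 1: "(\<Sum>v\<in>P. R v) = (\<Sum>v\<in>P. w v) + (\<Sum>u\<in>?Q. R u)" .
  have "(\<Sum>v\<in>P. R v) = (\<Sum>v\<in>{v\<in>P. hang v = n}. R v) + (\<Sum>u\<in>?Q. R u)"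
    using f by (subst sum.union_disjoint[symmetric]) (auto intro: sum.cong)
  with 1 show ?thesis by simp
qed

lemma root_ex: "v \<in> V \<Longrightarrow> \<exists>r\<in>V. A r = {} \<and> v \<in> D r"
proof (induction "card (A v)" arbitrary: v rule: less_induct)
  case less
  show ?case
  proof (cases "par v = n")
    case True
    then show ?thesis using A_root less.prems by (auto simp: D_def)
  next
    case False
    have p: "par v \<in> V" "A v = insert (par v) (A (par v))"
      using par_V A_par less.prems False by blast+
    have "finite (A v)" using A_V less.prems finite_V finite_subset by blast
    then have "card (A (par v)) < card (A v)"
      using p A_irrefl[OF p(1)] by (intro psubset_card_mono) auto
    then obtain r where "r \<in> V" "A r = {}" "par v \<in> D r" using less.hyps p by blast
    then show ?thesis using p less.prems by (auto simp: D_def)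
  qed
qed

lemma root_unique:
  assumes "v \<in> D r" "v \<in> D r'" "A r = {}" "A r' = {}"
  shows "r = r'"
  using assms A_chain[of v r r'] by (auto simp: D_def)

text \<open>Adjacent visited vertices are comparable by \<open>no_cross\<close>, and comparable
  vertices lie below the same root.\<close>

lemma D_adj:
  assumes "E u v" "u \<in> V" "v \<in> V" "A r = {}" "u \<in> D r"
  shows "v \<in> D r"
  using no_cross[OF assms(2,3,1)]
proof
  assume "u \<in> A v"
  then show ?thesis using assms A_trans[of v u] by (auto simp: D_def)
next
  assume "v \<in> A u"
  then show ?thesis using assms A_chain[of u v r] by (auto simp: D_def)
qed

text \<open>\<open>D r\<close> is the vertex set of a component of the light graph.  Every piece in it weighs less than \<open>X\<close>,
  except for the one at the root \<open>r\<close>, which weighs less than \<open>2 X\<close> if it is good and less than \<open>X\<close> otherwise.\<close>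

lemma component_bound:
  assumes "r \<in> V" "A r = {}"
  shows "(\<Sum>v\<in>D r. w v) < (card {v\<in>D r. good v} + 1) * X"
proof -
  let ?K = "{v\<in>D r. hang v = n}"
  have f: "finite (D r)" using finite_V by (simp add: D_def)
  have hr: "hang r = n" using hang_A[OF assms(1)] assms(2) by auto
  have K: "good v \<and> R v < X" if "v \<in> ?K - {r}" for v
  proof -
    have v: "v \<in> V" "hang v = n" "A v \<noteq> {}" using that by (auto simp: D_def)
    then have p: "par v \<noteq> n" using A_root by blast
    \<comment> \<open>Every list is now scanned to its end, so the unscanned neighbour that
      \<open>over\<close> promises for an overweight piece cannot exist.\<close>
    then have "scan ptr (par v) = {u. E (par v) u}" using done_scan par_V v by auto
    then have "R v < X" using over[OF v(1) _ v(2) p] E_sym by force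
    then show ?thesis using cut[OF v(1) _ v(2) p] v V_less by (auto simp: good_def)
  qed
  have "(\<Sum>v\<in>D r. w v) = (\<Sum>v\<in>?K. R v)"
  proof (rule weight_closed[symmetric])
    show "D r \<subseteq> V" by (auto simp: D_def)
    show "u \<in> D r \<longleftrightarrow> hang u \<in> D r" if "u \<in> V" "hang u \<noteq> n" for u
      using D_adj hang_E[OF that] E_sym that A_V hang_A assms(2) by blast
  qed
  also have "\<dots> = R r + (\<Sum>v\<in>?K - {r}. R v)"
  proof (rule sum.remove)
    show "finite ?K" using f by simp
    show "r \<in> ?K" using hr assms(1) by (simp add: D_def)
  qed
  also have "(\<Sum>v\<in>?K - {r}. R v) \<le> (\<Sum>v\<in>?K - {r}. X)"
    using K by (intro sum_mono) (auto intro: less_imp_le)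
  finally have 1: "(\<Sum>v\<in>D r. w v) \<le> R r + card (?K - {r}) * X" by simp
  show ?thesis
  proof (cases "good r")
    case True
    \<comment> \<open>A root has no parent to relieve it, but \<open>c\<close> terms below
      \<open>X / (c - 1)\<close> still make less than \<open>2 X\<close>.\<close>
    have "(c - 1) * R r < (card {u\<in>V. hang u = r} + 1) * X"
      using sum_kids_le[OF assms(1) order_refl] R[OF assms(1)] by simp
    also have "\<dots> \<le> ((c - 1) * 2) * X"
      using card_kids[OF assms(1)] c by (intro mult_le_mono1) linarith
    finally have "R r < 2 * X" by simp
    moreover have "{v\<in>D r. good v} = insert r (?K - {r})"
      using K True assms(1) by (auto simp: good_def D_def)
    moreover have "card (insert r (?K - {r})) = card (?K - {r}) + 1"
      using f by (subst card_insert_disjoint) auto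
    ultimately have "card {v\<in>D r. good v} = card (?K - {r}) + 1" by metis
    moreover note \<open>R r < 2 * X\<close>
    ultimately show ?thesis using 1 by simp
  next
    case False
    then have "(c - 1) * R r < X" using hr assms(1) V_less by (auto simp: good_def)
    moreover have "1 * R r \<le> (c - 1) * R r" using c by (intro mult_le_mono1) auto
    ultimately have "R r < X" by linarith
    moreover have "{v\<in>D r. good v} = ?K - {r}"
      using K False by (auto simp: good_def)
    ultimately show ?thesis using 1 by simp
  qed
qed

text \<open>A set of the packing either contains a heavy vertex, which is a good piece of its own, or lies
  within one component of the light graph.\<close>

lemma packing_bound:
  assumes "finite F" "\<And>T. T \<in> F \<Longrightarrow> T \<subseteq> {..<n}" "\<And>T. T \<in> F \<Longrightarrow> T \<noteq> {}" "\<And>T. T \<in> F \<Longrightarrow> con T"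
    and disj: "\<And>S T. S \<in> F \<Longrightarrow> T \<in> F \<Longrightarrow> S \<noteq> T \<Longrightarrow> S \<inter> T = {}"
    and weight: "\<And>T. T \<in> F \<Longrightarrow> X \<le> (\<Sum>v\<in>T. w v)"
  shows "card F \<le> card {v. good v}"
proof -
  define H where "H = {v. v < n \<and> v \<notin> V}"
  define F1 F2 where "F1 = {T\<in>F. \<not> T \<subseteq> V}" and "F2 = {T\<in>F. T \<subseteq> V}"
  define roots where "roots = {r\<in>V. A r = {}}"
  have H_good: "good v" if "v \<in> H" for v
  proof -
    have v: "v < n" "v \<notin> V" using that by (auto simp: H_def)
    then have "X \<le> (c - 1) * w v" using V_all[of v] by (auto simp: light_def not_less[symmetric])
    then show ?thesis using v hang_white R_white by (simp add: good_def)
  qed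
  have f: "finite F1" "finite F2" "finite H" "finite roots"
    using assms finite_V by (auto simp: F1_def F2_def H_def roots_def)
  have "\<forall>T\<in>F1. \<exists>v. v \<in> T \<and> v \<in> H" using assms(2) by (fastforce simp: F1_def H_def)
  then obtain h where h: "\<And>T. T \<in> F1 \<Longrightarrow> h T \<in> T \<and> h T \<in> H" by metis
  have "inj_on h F1"
  proof (rule inj_onI, rule ccontr)
    fix S T assume "S \<in> F1" "T \<in> F1" "h S = h T" "S \<noteq> T"
    then show False using h[of S] h[of T] disj[of S T] by (auto simp: F1_def)
  qed
  then have c1: "card F1 \<le> card H" using h f by (intro card_inj_on_le) auto
  have "T \<in> (\<Union>r\<in>roots. {T\<in>F2. T \<subseteq> D r})" if "T \<in> F2" for T
  proof -
    have T: "T \<in> F" "T \<subseteq> V" using that by (auto simp: F2_def)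
    obtain x where x: "x \<in> T" using assms(3)[OF T(1)] by blast
    then obtain r where r: "r \<in> V" "A r = {}" "x \<in> D r" using root_ex T by blast
    have "T \<subseteq> D r"
      using con_closed[OF assms(4)[OF T(1)] x r(3)] D_adj T r by blast
    then show ?thesis using r that by (auto simp: roots_def)
  qed
  then have "card F2 \<le> card (\<Union>r\<in>roots. {T\<in>F2. T \<subseteq> D r})"
    using f by (intro card_mono) auto
  also have "\<dots> \<le> (\<Sum>r\<in>roots. card {T\<in>F2. T \<subseteq> D r})"
    using f by (intro card_UN_le) auto
  also have "\<dots> \<le> (\<Sum>r\<in>roots. card {v\<in>D r. good v})"
  proof (rule sum_mono)
    fix r assume "r \<in> roots"
    then have r: "r \<in> V" "A r = {}" by (auto simp: roots_def)
    let ?F = "{T\<in>F2. T \<subseteq> D r}"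
    have fT: "T \<in> ?F \<Longrightarrow> finite T" for T using finite_V by (auto simp: F2_def intro: finite_subset)
    have fD: "finite (D r)" using finite_V by (simp add: D_def)
    have "card ?F * X = (\<Sum>T\<in>?F. X)" by simp
    also have "\<dots> \<le> (\<Sum>T\<in>?F. \<Sum>v\<in>T. w v)"
      using weight by (intro sum_mono) (auto simp: F2_def)
    also have "\<dots> = (\<Sum>v\<in>\<Union>?F. w v)"
      using f fT disj by (subst sum.Union_disjoint) (auto simp: F2_def)
    also have "\<dots> \<le> (\<Sum>v\<in>D r. w v)" using fD by (intro sum_mono2) auto
    also have "\<dots> < (card {v\<in>D r. good v} + 1) * X" by (rule component_bound[OF r])
    \<comment> \<open>The strictness of the component bound absorbs the surplus \<open>X\<close>
      that the root may carry.\<close>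
    finally have "card ?F < card {v\<in>D r. good v} + 1" by (metis mult_less_cancel2)
    then show "card ?F \<le> card {v\<in>D r. good v}" by simp
  qed
  also have "\<dots> = card (\<Union>r\<in>roots. {v\<in>D r. good v})"
    using f finite_V root_unique
    by (intro card_UN_disjoint[symmetric]) (auto simp: roots_def D_def)
  also have "\<dots> \<le> card {v\<in>V. good v}"
    using finite_V by (intro card_mono) (auto simp: D_def)
  finally have c2: "card F2 \<le> card {v\<in>V. good v}" .
  have "F = F1 \<union> F2" by (auto simp: F1_def F2_def)
  then have "card F \<le> card F1 + card F2" using card_Un_le by metis
  also have "\<dots> \<le> card H + card {v\<in>V. good v}" using c1 c2 by simp
  also have "\<dots> = card (H \<union> {v\<in>V. good v})"
    using f finite_V by (intro card_Un_disjoint[symmetric]) (auto simp: H_def)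
  also have "\<dots> \<le> card {v. good v}"
    using H_good finite_good by (intro card_mono) auto
  finally show ?thesis .
qed

section \<open>Pieces as fibres of the map sending a vertex to the end of its hanging chain\<close>

context
  fixes root :: "nat \<Rightarrow> nat"
  assumes root: "\<And>v. v < n \<Longrightarrow> root v = (if hang v = n then v else root (hang v))"
begin

text \<open>Hanging leads to a strict ancestor, so the chain from \<open>v\<close> is finite; its
  steps are edges that stay within one fibre of \<open>root\<close>.\<close>

lemma root_path:
  assumes "v < n"
  shows "root v < n \<and> hang (root v) = n \<and> (v, root v) \<in> (adj_in {u. u < n \<and> root u = root v})\<^sup>*"
  using assms
proof (induction "card (A v)" arbitrary: v rule: less_induct)
  case less
  show ?case
  proof (cases "hang v = n")
    case True
    then show ?thesis using root[OF less.prems] less.prems by simp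
  next
    case False
    then have v: "v \<in> V" using hang_white less.prems by blast
    then have h: "hang v \<in> A v" "hang v \<in> V" "E v (hang v)"
      using hang_A hang_E A_V False by blast+
    have rv: "root v = root (hang v)" using root[OF less.prems] False by simp
    have "finite (A v)" using A_V v finite_V finite_subset by blast
    then have "card (A (hang v)) < card (A v)"
      using h A_trans[OF v] A_irrefl by (intro psubset_card_mono) auto
    then have IH: "root (hang v) < n \<and> hang (root (hang v)) = n \<and>
        (hang v, root (hang v)) \<in> (adj_in {u. u < n \<and> root u = root (hang v)})\<^sup>*"
      using less.hyps h V_less by blast
    have "(v, hang v) \<in> adj_in {u. u < n \<and> root u = root (hang v)}"
      using h rv less.prems V_less by (simp add: adj_in_def)
    then show ?thesis using IH rv by (simp add: converse_rtrancl_into_rtrancl)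
  qed
qed

lemma piece_con:
  assumes "v < n"
  shows "con {u. u < n \<and> root u = root v}"
proof (rule conI_root)
  fix x assume "x \<in> {u. u < n \<and> root u = root v}"
  then show "(x, root v) \<in> (adj_in {u. u < n \<and> root u = root v})\<^sup>*"
    using root_path[of x] by simp
qed

text \<open>The piece of a visited \<open>r\<close> is closed under hanging and \<open>r\<close> is
  its only vertex that hangs nowhere, so the telescoped sum is just \<open>R r\<close>. An unvisited
  \<open>r\<close> is heavy and satisfies \<open>R r = w r\<close>.\<close>

lemma piece_weight:
  assumes "good r"
  shows "root r = r" "X \<le> (c - 1) * (\<Sum>v\<in>{v. v < n \<and> root v = r}. w v)"
proof -
  have r: "r < n" "hang r = n" "X \<le> (c - 1) * R r" using assms by (auto simp: good_def)
  show rr: "root r = r" using root r by simp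
  have "R r \<le> (\<Sum>v\<in>{v. v < n \<and> root v = r}. w v)"
  proof (cases "r \<in> V")
    case True
    let ?P = "{v\<in>V. root v = r}"
    have "(\<Sum>v\<in>{v\<in>?P. hang v = n}. R v) = (\<Sum>v\<in>?P. w v)"
    proof (rule weight_closed)
      show "u \<in> ?P \<longleftrightarrow> hang u \<in> ?P" if u: "u \<in> V" "hang u \<noteq> n" for u
      proof -
        have "hang u \<in> V" using u hang_A A_V by blast
        moreover have "root u = root (hang u)" using root[OF V_less[OF u(1)]] u by simp
        ultimately show ?thesis using u by simp
      qed
    qed simp
    moreover have "{v\<in>?P. hang v = n} = {r}"
    proof -
      have "root v = v" if "v \<in> V" "hang v = n" for v using root[OF V_less[OF that(1)]] that by simp
      then have "v = r" if "v \<in> V" "root v = r" "hang v = n" for v using that by metis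
      moreover have "r \<in> {v\<in>?P. hang v = n}" using rr r True by simp
      ultimately show ?thesis by blast
    qed
    moreover have "(\<Sum>v\<in>?P. w v) \<le> (\<Sum>v\<in>{v. v < n \<and> root v = r}. w v)"
      using V_less by (intro sum_mono2) auto
    ultimately show ?thesis by simp
  next
    case False
    have "w r \<le> (\<Sum>v\<in>{v. v < n \<and> root v = r}. w v)"
      using r rr by (intro member_le_sum) auto
    then show ?thesis using R_white[OF r(1) False] by simp
  qed
  then have "(c - 1) * R r \<le> (c - 1) * (\<Sum>v\<in>{v. v < n \<and> root v = r}. w v)" by simp
  with r show "X \<le> (c - 1) * (\<Sum>v\<in>{v. v < n \<and> root v = r}. w v)" by linarith
qed

end

end

section \<open>Merging pieces along a breadth-first search\<close>

text \<open>Merging sees the weights only through \<open>good\<close>: a part is heavy enough as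
  soon as it contains one good piece.\<close>

locale pieces = adj_graph +
  fixes k :: nat and root :: "nat \<Rightarrow> nat" and good :: "nat \<Rightarrow> bool"
  assumes k: "1 \<le> k"
    and conn: "con {..<n}"
    and root_less: "v < n \<Longrightarrow> root v < n"
    and root_root: "v < n \<Longrightarrow> root (root v) = root v"
    and piece_con: "v < n \<Longrightarrow> con {u. u < n \<and> root u = root v}"
    and good_less: "good r \<Longrightarrow> r < n"
    and good_root: "good r \<Longrightarrow> root r = r"
    and good_many: "k \<le> card {r. good r}"
begin

lemma finite_good: "finite {r. good r}"
  using good_less by (meson bounded_nat_set_is_finite mem_Collect_eq)

text \<open>List entries still to be read, plus one unit per vertex not yet processed, which pays
  for moving the head. Vertices not yet in the queue are included, so appending one leaves the value
  unchanged.\<close>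

definition remaining :: "(nat \<Rightarrow> nat) \<Rightarrow> nat \<Rightarrow> nat \<Rightarrow> nat \<Rightarrow> nat" where
  "remaining q head tail e =
    (\<Sum>v\<in>{..<n} - q ` {..<head}. off (Suc v) - off v + 1) - (if head < tail then e - off (q head) else 0)"

end

text \<open>A piece gets its label when the search first meets it: a new label if it is good and fewer than
  \<open>k\<close> labels are in use, otherwise the label of the vertex from which it was met.\<close>

locale bfs = pieces +
  fixes q part plab :: "nat \<Rightarrow> nat" and lab head tail e :: nat
  assumes head_le: "head \<le> tail"
    and tail_pos: "0 < tail"
    and q_less: "i < tail \<Longrightarrow> q i < n"
    and q_inj: "inj_on q {..<tail}"
    and part: "v < n \<Longrightarrow> part v \<noteq> 0 \<longleftrightarrow> v \<in> q ` {..<tail}"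
    and part_plab: "v \<in> q ` {..<tail} \<Longrightarrow> part v = plab (root v)"
    and processed: "i < head \<Longrightarrow> E (q i) u \<Longrightarrow> u \<in> q ` {..<tail}"
    and e_ge: "head < tail \<Longrightarrow> off (q head) \<le> e"
    and e_le: "head < tail \<Longrightarrow> e \<le> off (Suc (q head))"
    and seen: "head < tail \<Longrightarrow> off (q head) \<le> i \<Longrightarrow> i < e \<Longrightarrow> nb i \<in> q ` {..<tail}"
    and lab: "1 \<le> lab" "lab \<le> k"
    and plab_le: "v < n \<Longrightarrow> plab (root v) \<le> lab"
    and class_con: "1 \<le> l \<Longrightarrow> l \<le> lab \<Longrightarrow> con {v. v < n \<and> plab (root v) = l}"
    and class_good: "1 \<le> l \<Longrightarrow> l \<le> lab \<Longrightarrow> \<exists>g. good g \<and> plab g = l"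
    and good_count: "lab < k \<Longrightarrow> card {g. good g \<and> plab g \<noteq> 0} \<le> lab"
begin

lemma new_label:
  assumes "good r" "plab r = 0" "lab < k"
  shows "bfs n E off nb k root good q part (plab(r := Suc lab)) (Suc lab) head tail e"
proof -
  have r: "r < n" "root r = r" using assms good_less good_root by auto
  \<comment> \<open>Queued vertices have the nonzero label of their piece. So a piece without label
    has no queued vertex, and labelling it leaves \<open>part\<close> consistent.\<close>
  have nq: "root v \<noteq> r" if "v \<in> q ` {..<tail}" for v
    using part_plab[OF that] part that q_less assms by fastforce
  show ?thesis
  proof (unfold_locales, goal_cases)
    case 1 then show ?case using head_le by auto
  next
    case 2 then show ?case using tail_pos by auto
  next
    case (3 i) then show ?case using q_less by auto
  next
    case 4 then show ?case using q_inj by auto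
  next
    case (5 v) then show ?case using part by auto
  next
    case (6 v) then show ?case using part_plab nq by auto
  next
    case (7 i u) then show ?case using processed by auto
  next
    case 8 then show ?case using e_ge by auto
  next
    case 9 then show ?case using e_le by auto
  next
    case (10 i) then show ?case using seen by auto
  next
    case 11 then show ?case using lab by auto
  next
    case 12 then show ?case using assms by auto
  next
    case (13 v) then show ?case using plab_le[of v] by auto
  next
    case (14 l)
    show ?case
    proof (cases "l = Suc lab")
      case True
      then have "{v. v < n \<and> (plab(r := Suc lab)) (root v) = l} = {v. v < n \<and> root v = root r}"
      proof -
        have "plab (root v) \<noteq> l" if "v < n" for v using plab_le[OF that] True by simp
        then show ?thesis using r True by auto
      qed
      then show ?thesis using piece_con r by metis
    next
      case False
      then have "{v. v < n \<and> (plab(r := Suc lab)) (root v) = l} = {v. v < n \<and> plab (root v) = l}"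
        using assms 14 by auto
      then show ?thesis using class_con 14 False by simp
    qed
  next
    case (15 l)
    show ?case
    proof (cases "l = Suc lab")
      case True
      then show ?thesis using assms by auto
    next
      case False
      then obtain g where "good g" "plab g = l" using class_good[of l] 15 by auto
      then show ?thesis using assms 15 by (intro exI[of _ g]) auto
    qed
  next
    case 16
    have "{g. good g \<and> (plab(r := Suc lab)) g \<noteq> 0} = insert r {g. good g \<and> plab g \<noteq> 0}"
      using assms by auto
    then show ?case using good_count assms finite_good by simp
  qed
qed

text \<open>Classes are unions of whole pieces, including vertices not yet reached. Hence the one
  edge from the queue head to \<open>y\<close> connects the entire piece of \<open>y\<close> to the
  class. A good piece is absorbed only when all \<open>k\<close> labels are taken, so
  \<open>good_count\<close> is not endangered.\<close>

lemma join_label: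
  assumes "head < tail" "E (q head) y" "plab (root y) = 0" "\<not> (good (root y) \<and> lab < k)"
  shows "bfs n E off nb k root good q part (plab(root y := part (q head))) lab head tail e"
proof -
  let ?r = "root y" and ?x = "q head"
  have y: "y < n" using assms E_sym E_less by blast
  have x: "?x < n" "?x \<in> q ` {..<tail}" using q_less assms by auto
  have px: "part ?x \<noteq> 0" "part ?x = plab (root ?x)" "part ?x \<le> lab"
    using part[OF x(1)] part_plab[OF x(2)] plab_le[OF x(1)] x(2) by simp_all
  have nq: "root v \<noteq> ?r" if "v \<in> q ` {..<tail}" for v
    using part_plab[OF that] part that q_less assms by fastforce
  show ?thesis
  proof (unfold_locales, goal_cases)
    case 1 then show ?case using head_le by auto
  next
    case 2 then show ?case using tail_pos by auto
  next
    case (3 i) then show ?case using q_less by auto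
  next
    case 4 then show ?case using q_inj by auto
  next
    case (5 v) then show ?case using part by auto
  next
    case (6 v) then show ?case using part_plab nq by auto
  next
    case (7 i u) then show ?case using processed by auto
  next
    case 8 then show ?case using e_ge by auto
  next
    case 9 then show ?case using e_le by auto
  next
    case (10 i) then show ?case using seen by auto
  next
    case 11 then show ?case using lab by auto
  next
    case 12 then show ?case using lab by auto
  next
    case (13 v) then show ?case using plab_le[of v] px by auto
  next
    case (14 l)
    show ?case
    proof (cases "l = part ?x")
      case True
      have eq: "{v. v < n \<and> (plab(?r := part ?x)) (root v) = l} =
          {v. v < n \<and> plab (root v) = l} \<union> {v. v < n \<and> root v = root y}"
        using True by auto
      show ?thesis unfolding eq
      proof (rule con_union[of _ _ ?x y])
        show "con {v. v < n \<and> plab (root v) = l}" using class_con 14 by blast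
        show "con {v. v < n \<and> root v = root y}" using piece_con y by blast
        show "?x \<in> {v. v < n \<and> plab (root v) = l}" using x px True by simp
      qed (use y assms in auto)
    next
      case False
      then have "{v. v < n \<and> (plab(?r := part ?x)) (root v) = l} = {v. v < n \<and> plab (root v) = l}"
        using assms 14 by auto
      then show ?thesis using class_con 14 by simp
    qed
  next
    case (15 l)
    then obtain g where "good g" "plab g = l" using class_good[of l] by auto
    then show ?case using assms 15 by (intro exI[of _ g]) auto
  next
    case 16
    then have "\<not> good ?r" using assms by blast
    then have "{g. good g \<and> (plab(?r := part ?x)) g \<noteq> 0} = {g. good g \<and> plab g \<noteq> 0}" by auto
    then show ?case using good_count 16 by simp
  qed
qed

lemma visit:
  assumes "head < tail" "y < n" "part y = 0" "plab (root y) \<noteq> 0"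
  shows "bfs n E off nb k root good (q(tail := y)) (part(y := plab (root y))) plab lab head (Suc tail) e"
proof -
  have im: "(q(tail := y)) ` {..<Suc tail} = insert y (q ` {..<tail})"
    by (auto simp: lessThan_Suc)
  have yq: "y \<notin> q ` {..<tail}" using part assms by blast
  show ?thesis
  proof (unfold_locales, goal_cases)
    case 1 then show ?case using head_le by auto
  next
    case 2 then show ?case by auto
  next
    case (3 i) then show ?case using q_less assms by auto
  next
    case 4
    have "inj_on (q(tail := y)) {..<tail}" using q_inj by (auto simp: inj_on_def)
    moreover have "(q(tail := y)) ` {..<tail} = q ` {..<tail}" by auto
    ultimately show ?case using yq by (auto simp: lessThan_Suc)
  next
    case (5 v) then show ?case unfolding im using part assms by auto
  next
    case (6 v) then show ?case unfolding im using part_plab yq by auto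
  next
    case (7 i u) then show ?case unfolding im using processed[of i u] head_le by auto
  next
    case 8 then show ?case using e_ge assms by auto
  next
    case 9 then show ?case using e_le assms by auto
  next
    case (10 i) then show ?case unfolding im using seen[of i] assms by auto
  next
    case 11 then show ?case using lab by auto
  next
    case 12 then show ?case using lab by auto
  next
    case (13 v) then show ?case using plab_le by auto
  next
    case (14 l) then show ?case using class_con by auto
  next
    case (15 l) then show ?case using class_good by auto
  next
    case 16 then show ?case using good_count by auto
  qed
qed

lemma skip:
  assumes "head < tail" "e < off (Suc (q head))" "nb e \<in> q ` {..<tail}"
  shows "bfs n E off nb k root good q part plab lab head tail (Suc e)"
proof (unfold_locales, goal_cases)
  case 1 then show ?case using head_le by auto
next
  case 2 then show ?case using tail_pos by auto
next
  case (3 i) then show ?case using q_less assms by auto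
next
  case 4 then show ?case using q_inj by auto
next
  case (5 v) then show ?case using part by auto
next
  case (6 v) then show ?case using part_plab by auto
next
  case (7 i u) then show ?case using processed by auto
next
  case 8 then show ?case using e_ge by auto
next
  case 9 then show ?case using assms by auto
next
  case (10 i) then show ?case using seen[of i] assms by (cases "i = e") auto
next
  case 11 then show ?case using lab by auto
next
  case 12 then show ?case using lab by auto
next
  case (13 v) then show ?case using plab_le by auto
next
  case (14 l) then show ?case using class_con by auto
next
  case (15 l) then show ?case using class_good by auto
next
  case 16 then show ?case using good_count by auto
qed

text \<open>When the queue runs empty, \<open>e\<close> receives a meaningless offset; every
  condition on \<open>e\<close> therefore presupposes \<open>head < tail\<close>.\<close>

lemma step_head:
  assumes "head < tail" "\<not> e < off (Suc (q head))"
  shows "bfs n E off nb k root good q part plab lab (Suc head) tail (off (q (Suc head)))"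
proof (unfold_locales, goal_cases)
  case 1 then show ?case using assms by auto
next
  case 2 then show ?case using tail_pos by auto
next
  case (3 i) then show ?case using q_less assms by auto
next
  case 4 then show ?case using q_inj by auto
next
  case (5 v) then show ?case using part by auto
next
  case (6 v) then show ?case using part_plab by auto
next
  case (7 i u)
  show ?case
  proof (cases "i = head")
    case True
    have "u \<in> nb ` {off (q head)..<off (Suc (q head))}" using 7 True nb[OF q_less] assms by auto
    then show ?thesis using seen assms by auto
  next
    case False
    then have "i < head" using 7 by simp
    then show ?thesis using 7 processed by blast
  qed
next
  case 8 then show ?case by auto
next
  case 9 then show ?case using off_mono q_less by auto
next
  case (10 i) then show ?case by auto
next
  case 11 then show ?case using lab by auto
next
  case 12 then show ?case using lab by auto
next
  case (13 v) then show ?case using plab_le by auto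
next
  case (14 l) then show ?case using class_con by auto
next
  case (15 l) then show ?case using class_good by auto
next
  case 16 then show ?case using good_count by auto
qed

lemma remaining_split:
  assumes "head < tail"
  shows "(\<Sum>v\<in>{..<n} - q ` {..<head}. off (Suc v) - off v + 1) =
    (\<Sum>v\<in>{..<n} - q ` {..<Suc head}. off (Suc v) - off v + 1) + (off (Suc (q head)) - off (q head) + 1)"
proof -
  have "q head \<notin> q ` {..<head}" using q_inj assms by (force simp: inj_on_def)
  then have "q head \<in> {..<n} - q ` {..<head}" using q_less assms by auto
  moreover have "{..<n} - q ` {..<Suc head} = ({..<n} - q ` {..<head}) - {q head}"
    by (auto simp: lessThan_Suc)
  ultimately show ?thesis by (simp add: sum.remove)
qed

lemma remaining_skip:
  assumes "head < tail" "e < off (Suc (q head))"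
  shows "remaining q head tail (Suc e) < remaining q head tail e"
  using remaining_split[OF assms(1)] assms e_ge[OF assms(1)] by (simp add: remaining_def)

lemma remaining_visit: "head < tail \<Longrightarrow> remaining (q(tail := y)) head (Suc tail) e' = remaining q head tail e'"
proof -
  assume h: "head < tail"
  then have "(q(tail := y)) ` {..<head} = q ` {..<head}" by auto
  then show ?thesis using h by (simp add: remaining_def del: fun_upd_image)
qed

lemma remaining_head:
  assumes "head < tail" "\<not> e < off (Suc (q head))"
  shows "remaining q (Suc head) tail (off (q (Suc head))) < remaining q head tail e"
  using remaining_split[OF assms(1)] assms e_le[OF assms(1)] by (simp add: remaining_def)

text \<open>With an empty queue the set of queued vertices is closed under adjacency, and
  connectedness of the graph makes it everything.\<close>

lemma all_labelled:
  assumes "\<not> head < tail" "v < n"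
  shows "part v = plab (root v)" "1 \<le> part v" "part v \<le> lab"
proof -
  have ht: "head = tail" using assms head_le by simp
  have q0: "q 0 \<in> q ` {..<tail}" using tail_pos by blast
  have "{..<n} \<subseteq> q ` {..<tail}"
    using con_closed[OF conn, of "q 0" "q ` {..<tail}"] q0 q_less[OF tail_pos] processed ht by blast
  then have "v \<in> q ` {..<tail}" using assms by blast
  then show "part v = plab (root v)" "1 \<le> part v" "part v \<le> lab"
    using part_plab part[OF assms(2)] plab_le[OF assms(2)] by auto
qed

text \<open>As long as labels are left, good pieces open new ones, so at most \<open>lab\<close> of
  them are labelled. At the end all good pieces are labelled, and there are at least
  \<open>k\<close>.\<close>

lemma lab_end:
  assumes "\<not> head < tail"
  shows "lab = k"
proof (rule ccontr)
  assume "lab \<noteq> k"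
  then have "lab < k" using lab by simp
  moreover have "plab g \<noteq> 0" if "good g" for g
    using all_labelled[OF assms, of g] that good_less good_root by fastforce
  then have "{g. good g \<and> plab g \<noteq> 0} = {g. good g}" by auto
  ultimately show False using good_count good_many by simp
qed

lemma class_end:
  assumes "\<not> head < tail" "l \<in> {1..k}"
  shows "con {v. v < n \<and> part v = l}" "\<exists>g. good g \<and> {v. v < n \<and> root v = g} \<subseteq> {v. v < n \<and> part v = l}"
proof -
  have eq: "{v. v < n \<and> part v = l} = {v. v < n \<and> plab (root v) = l}"
    using all_labelled(1)[OF assms(1)] by auto
  show "con {v. v < n \<and> part v = l}"
    using class_con assms lab_end by (simp add: eq)
  obtain g where "good g" "plab g = l" using class_good assms lab_end by auto
  then show "\<exists>g. good g \<and> {v. v < n \<and> root v = g} \<subseteq> {v. v < n \<and> part v = l}"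
    unfolding eq by auto
qed

end

context pieces
begin

text \<open>The search starts at a good root because label 1, like every other label in use, must
  own a good piece.\<close>

lemma bfs_init:
  assumes "good s" "q 0 = s" "\<And>v. v < n \<Longrightarrow> part v = (if v = s then 1 else 0)"
    "\<And>v. v < n \<Longrightarrow> plab v = (if v = s then 1 else 0)"
  shows "bfs n E off nb k root good q part plab 1 0 1 (off s)"
proof -
  have s: "s < n" "root s = s" using assms good_less good_root by auto
  have one: "{..<Suc 0} = {0::nat}" by auto
  show ?thesis
  proof (unfold_locales, goal_cases)
    case 1 then show ?case by auto
  next
    case 2 then show ?case by auto
  next
    case (3 i) then show ?case using assms s by auto
  next
    case 4 then show ?case by (auto simp: one)
  next
    case (5 v) then show ?case using assms by (auto simp: one)
  next
    case (6 v) then show ?case using assms s by (auto simp: one)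
  next
    case (7 i u) then show ?case by auto
  next
    case 8 then show ?case using assms by auto
  next
    case 9 then show ?case using assms s off_mono by auto
  next
    case (10 i) then show ?case using assms by auto
  next
    case 11 then show ?case by auto
  next
    case 12 then show ?case using k by auto
  next
    case (13 v) then show ?case using assms root_less by auto
  next
    case (14 l)
    then have "plab (root v) = l \<longleftrightarrow> root v = root s" if "v < n" for v
      using assms(4)[OF root_less[OF that]] s(2) by (cases "root v = s") simp_all
    then have "{v. v < n \<and> plab (root v) = l} = {v. v < n \<and> root v = root s}" by blast
    then show ?case using piece_con[OF s(1)] s(2) by simp
  next
    case (15 l)
    then show ?case using assms(1) assms(4)[OF s(1)] by (intro exI[of _ s]) simp
  next
    case 16
    have "{g. good g \<and> plab g \<noteq> 0} \<subseteq> {s}"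
      using assms(4) good_less by (auto split: if_splits)
    then have "card {g. good g \<and> plab g \<noteq> 0} \<le> card {s}" by (intro card_mono) auto
    then show ?case by simp
  qed
qed

lemma remaining_le: "remaining q head tail e \<le> (\<Sum>v<n. off (Suc v) - off v + 1)"
proof -
  have "(\<Sum>v\<in>{..<n} - q ` {..<head}. off (Suc v) - off v + 1) \<le> (\<Sum>v<n. off (Suc v) - off v + 1)"
    by (intro sum_mono2) auto
  then show ?thesis by (simp add: remaining_def)
qed

end

section \<open>The search program\<close>

notation Assign ("_ ::= _" [80, 61] 61)
notation Store ("_\<lbrakk>_\<rbrakk> ::= _" [80, 0, 61] 61)
notation Seq (infixr ";;" 60)

text \<open>Pieces are moved in the last branch of \<open>scan_code\<close>: the scanned vertex \<open>x\<close> hangs at \<open>y\<close>, which is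
  a child of \<open>cur\<close> whose piece is too heavy.\<close>

definition visit_code :: "string \<Rightarrow> com" where
  "visit_code x =
    ''par''\<lbrakk>Reg x\<rbrakk> ::= Reg ''cur'';;
    ''cur'' ::= Reg x;;
    ''vis''\<lbrakk>Reg x\<rbrakk> ::= Const 1;;
    ''ord''\<lbrakk>Reg ''num''\<rbrakk> ::= Reg x;;
    ''num'' ::= Plus (Reg ''num'') (Const 1)"

definition scan_code :: com where
  "scan_code =
    ''x'' ::= Arr ''adj'' (Arr ''ptr'' (Reg ''cur''));;
    ''ptr''\<lbrakk>Reg ''cur''\<rbrakk> ::= Plus (Arr ''ptr'' (Reg ''cur'')) (Const 1);;
    If (Less (Arr ''vis'' (Reg ''x'')) (Const 1))
      (visit_code ''x'')
      (''y'' ::= Arr ''hang'' (Reg ''x'');;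
       If (And (Less (Reg ''y'') (Reg ''n''))
            (And (Not (Less (Arr ''R'' (Reg ''y'')) (Reg ''X'')))
              (And (Not (Less (Arr ''par'' (Reg ''y'')) (Reg ''cur'')))
                (Not (Less (Reg ''cur'') (Arr ''par'' (Reg ''y'')))))))
         (''R''\<lbrakk>Reg ''y''\<rbrakk> ::= Minus (Arr ''R'' (Reg ''y'')) (Arr ''R'' (Reg ''x''));;
          ''R''\<lbrakk>Reg ''cur''\<rbrakk> ::= Plus (Arr ''R'' (Reg ''cur'')) (Arr ''R'' (Reg ''x''));;
          ''hang''\<lbrakk>Reg ''x''\<rbrakk> ::= Reg ''cur'')
         Skip)"

definition finish_code :: "nat \<Rightarrow> com" where
  "finish_code c =
    ''y'' ::= Arr ''par'' (Reg ''cur'');;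
    If (Less (scaled (c - 1) (Arr ''R'' (Reg ''cur''))) (Reg ''X''))
      (If (Less (Reg ''y'') (Reg ''n''))
        (''hang''\<lbrakk>Reg ''cur''\<rbrakk> ::= Reg ''y'';;
         ''R''\<lbrakk>Reg ''y''\<rbrakk> ::= Plus (Arr ''R'' (Reg ''y'')) (Arr ''R'' (Reg ''cur'')))
        Skip)
      (''cnt'' ::= Plus (Reg ''cnt'') (Const 1));;
    ''cur'' ::= Reg ''y''"

definition dfs_body :: "nat \<Rightarrow> com" where
  "dfs_body c =
    If (Less (Reg ''cur'') (Reg ''n''))
      (If (Less (Arr ''ptr'' (Reg ''cur'')) (Arr ''off'' (Plus (Reg ''cur'') (Const 1))))
        scan_code
        (finish_code c))
      (If (Less (Arr ''vis'' (Reg ''r'')) (Const 1)) (visit_code ''r'') Skip;;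
       ''r'' ::= Plus (Reg ''r'') (Const 1))"

definition dfs_guard :: bexp where
  "dfs_guard = Not (And (Not (Less (Reg ''r'') (Reg ''n''))) (Not (Less (Reg ''cur'') (Reg ''n''))))"

text \<open>Heavy vertices are marked as visited at once, so the search never enters them; each is
  already counted as a good piece, and they come first in \<open>ord\<close>.\<close>

definition init_body :: "nat \<Rightarrow> com" where
  "init_body c =
    ''ptr''\<lbrakk>Reg ''j''\<rbrakk> ::= Arr ''off'' (Reg ''j'');;
    ''hang''\<lbrakk>Reg ''j''\<rbrakk> ::= Reg ''n'';;
    ''R''\<lbrakk>Reg ''j''\<rbrakk> ::= Arr ''w'' (Reg ''j'');;
    If (Less (scaled (c - 1) (Arr ''w'' (Reg ''j''))) (Reg ''X''))
      (''vis''\<lbrakk>Reg ''j''\<rbrakk> ::= Const 0)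
      (''vis''\<lbrakk>Reg ''j''\<rbrakk> ::= Const 1;;
       ''cnt'' ::= Plus (Reg ''cnt'') (Const 1);;
       ''ord''\<lbrakk>Reg ''num''\<rbrakk> ::= Reg ''j'';;
       ''num'' ::= Plus (Reg ''num'') (Const 1));;
    ''j'' ::= Plus (Reg ''j'') (Const 1)"

definition search_code :: "nat \<Rightarrow> com" where
  "search_code c =
    (''j'' ::= Const 0;; ''cnt'' ::= Const 0;; ''num'' ::= Const 0);;
    While (Less (Reg ''j'') (Reg ''n'')) (init_body c);;
    (''cur'' ::= Reg ''n'';; ''r'' ::= Const 0);;
    While dfs_guard (dfs_body c)"

section \<open>The search invariant together with its measure\<close>

context bcp_graph
begin

definition goods :: "(nat \<Rightarrow> nat set) \<Rightarrow> (nat \<Rightarrow> nat) \<Rightarrow> (nat \<Rightarrow> nat) \<Rightarrow> nat \<Rightarrow> nat set" where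
  "goods A hang R cur = {v. v < n \<and> v \<notin> gray A cur \<and> hang v = n \<and> X \<le> (c - 1) * R v}"

text \<open>Discovery only turns a white vertex gray and keeps this set; finishing shrinks it. A
  discovering step is paid for by the pointer or the counter \<open>r\<close> that advances with
  it.\<close>

definition pending :: "nat set \<Rightarrow> (nat \<Rightarrow> nat set) \<Rightarrow> nat \<Rightarrow> nat set" where
  "pending V A cur = {v. light v \<and> v \<notin> V} \<union> gray A cur"

definition unscanned :: "(nat \<Rightarrow> nat) \<Rightarrow> nat" where
  "unscanned ptr = (\<Sum>v<n. off (Suc v) - ptr v)"

text \<open>In order of discovery, ancestors precede descendants. As vertices hang at ancestors,
  \<open>root\<close> can later be filled in by one pass along \<open>ord\<close>.\<close>

definition ordered :: "(nat \<Rightarrow> nat) \<Rightarrow> nat \<Rightarrow> nat set \<Rightarrow> (nat \<Rightarrow> nat set) \<Rightarrow> bool" where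
  "ordered ord num V A \<longleftrightarrow> inj_on ord {..<num} \<and> ord ` {..<num} = {v. v < n \<and> (light v \<longrightarrow> v \<in> V)} \<and>
    (\<forall>i<num. ord i \<in> V \<longrightarrow> A (ord i) \<subseteq> ord ` {..<i})"

definition dfs_comp where
  "dfs_comp m V A par hang R ptr vis ord cur r num cnt \<longleftrightarrow>
    dfs n E off nb w c X V A par hang R ptr cur \<and>
    (\<forall>v<n. vis v = 0 \<longleftrightarrow> light v \<and> v \<notin> V) \<and>
    r \<le> n \<and> (\<forall>v<r. vis v \<noteq> 0) \<and>
    ordered ord num V A \<and> cnt = card (goods A hang R cur) \<and>
    (n - r) + unscanned ptr + card (pending V A cur) \<le> m"

lemma pending_finite: "dfs n E off nb w c X V A par hang R ptr cur \<Longrightarrow> finite (pending V A cur)"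
proof -
  assume "dfs n E off nb w c X V A par hang R ptr cur"
  then interpret dfs n E off nb w c X V A par hang R ptr cur .
  show ?thesis unfolding pending_def using finite_V gray_V finite_subset by (auto simp: light_def)
qed

lemma ordered_visit:
  assumes "ordered ord num V A" "x < n" "light x" "x \<notin> V" "\<And>v. v \<in> V \<Longrightarrow> A v \<subseteq> V"
    "B \<subseteq> V" "\<And>v. v \<in> V \<Longrightarrow> v < n"
  shows "ordered (ord(num := x)) (Suc num) (insert x V) (A(x := B))"
proof -
  have o: "inj_on ord {..<num}" "ord ` {..<num} = {v. v < n \<and> (light v \<longrightarrow> v \<in> V)}"
    "\<And>i. i < num \<Longrightarrow> ord i \<in> V \<Longrightarrow> A (ord i) \<subseteq> ord ` {..<i}"
    using assms(1) by (auto simp: ordered_def)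
  have xo: "x \<notin> ord ` {..<num}" using o(2) assms by auto
  have im: "(ord(num := x)) ` {..<i} = ord ` {..<i}" if "i \<le> num" for i using that by auto
  have "inj_on (ord(num := x)) {..<num}" using o(1) by (auto simp: inj_on_def)
  then have 1: "inj_on (ord(num := x)) {..<Suc num}"
    using xo im[of num] by (simp add: lessThan_Suc)
  have 2: "(ord(num := x)) ` {..<Suc num} = insert x (ord ` {..<num})"
    by (simp only: lessThan_Suc image_insert im[OF order_refl] fun_upd_same)
  have 3: "(A(x := B)) ((ord(num := x)) i) \<subseteq> (ord(num := x)) ` {..<i}"
    if i: "i < Suc num" "(ord(num := x)) i \<in> insert x V" for i
  proof (cases "i = num")
    case True
    have "B \<subseteq> ord ` {..<num}" using o(2) assms(6,7) by blast
    then show ?thesis using True im[of num] by simp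
  next
    case False
    then have "i < num" "ord i \<noteq> x" using i xo by auto
    then show ?thesis using o(3)[of i] i im[of i] by simp
  qed
  show ?thesis unfolding ordered_def using 1 2 3 o(2) assms(2,3) by auto
qed

lemma comp_visit:
  assumes inv: "dfs_comp m V A par hang R ptr vis ord cur r num cnt"
    and x: "x < n" "vis x = 0" "cur \<noteq> n \<Longrightarrow> E x cur"
  shows "dfs_comp m (insert x V) (A(x := gray A cur)) (par(x := cur)) hang R ptr (vis(x := Suc 0))
    (ord(num := x)) x r (Suc num) cnt"
proof -
  interpret dfs n E off nb w c X V A par hang R ptr cur using inv by (simp add: dfs_comp_def)
  have l: "light x" "x \<notin> V" using inv x by (auto simp: dfs_comp_def)
  have g: "gray (A(x := gray A cur)) x = insert x (gray A cur)" using x by (simp add: gray_def)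
  have "goods (A(x := gray A cur)) hang R x = goods A hang R cur"
    unfolding goods_def g using R_white[OF x(1) l(2)] l(1) by (auto simp: light_def)
  moreover have "pending (insert x V) (A(x := gray A cur)) x = pending V A cur"
    unfolding pending_def g using l by auto
  moreover have "ordered (ord(num := x)) (Suc num) (insert x V) (A(x := gray A cur))"
    using inv x l A_V gray_V V_less by (intro ordered_visit) (auto simp: dfs_comp_def)
  ultimately show ?thesis
    using discover[OF l x(3)] inv by (auto simp: dfs_comp_def)
qed

lemma unscanned_less:
  assumes "p < n" "ptr p < off (Suc p)"
  shows "unscanned (ptr(p := Suc (ptr p))) < unscanned ptr"
  unfolding unscanned_def using assms by (intro sum_strict_mono_ex1) (auto intro!: bexI[of _ p])

lemma comp_advance:
  assumes inv: "dfs_comp m V A par hang R ptr vis ord cur r num cnt"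
    and p: "ptr p < off (Suc p)" "p \<in> gray A cur" "nb (ptr p) < n" "vis (nb (ptr p)) \<noteq> 0"
    and other: "\<And>v. v \<in> gray A cur \<Longrightarrow> par v = p \<Longrightarrow> nb (ptr p) \<in> V \<Longrightarrow> v \<notin> A (nb (ptr p))"
    and none: "\<not> (hang (nb (ptr p)) \<noteq> n \<and> par (hang (nb (ptr p))) = p \<and> X \<le> R (hang (nb (ptr p))))"
  shows "\<exists>m'<m. dfs_comp m' V A par hang R (ptr(p := Suc (ptr p))) vis ord cur r num cnt"
proof -
  interpret dfs n E off nb w c X V A par hang R ptr cur using inv by (simp add: dfs_comp_def)
  have "cur \<noteq> n" using p by (auto simp: gray_def)
  have pn: "p < n" using gray_V p V_less by blast
  have "light (nb (ptr p)) \<Longrightarrow> nb (ptr p) \<in> V" using inv p by (auto simp: dfs_comp_def)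
  then have "dfs n E off nb w c X V A par hang R (ptr(p := Suc (ptr p))) cur"
    by (intro advance \<open>cur \<noteq> n\<close> p(1,2) other none)
  then show ?thesis
    using inv unscanned_less[of p ptr] pn p(1)
    by (intro exI[of _ "(n - r) + unscanned (ptr(p := Suc (ptr p))) + card (pending V A cur)"])
      (auto simp: dfs_comp_def)
qed

text \<open>The count needs no update: the relieved vertex was good and remains so by
  \<open>rehang_big\<close>, \<open>x\<close> hangs before and after, and \<open>cur\<close> is
  gray.\<close>

lemma comp_rehang:
  assumes inv: "dfs_comp m V A par hang R ptr vis ord cur r num cnt"
    and x: "cur \<noteq> n" "x < n" "hang x \<noteq> n" "par (hang x) = cur" "X \<le> R (hang x)" "E x cur"
  shows "dfs_comp m V A par (hang(x := cur)) (R(hang x := R (hang x) - R x, cur := R cur + R x))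
    ptr vis ord cur r num cnt" "hang x \<noteq> cur" "hang x \<noteq> x"
proof -
  interpret dfs n E off nb w c X V A par hang R ptr cur using inv by (simp add: dfs_comp_def)
  have xV: "x \<in> V" using hang_white x by blast
  have vV: "hang x \<in> V" using hang_A A_V xV x by blast
  have Av: "A (hang x) = insert cur (A cur)" using A_par[of "hang x"] vV x by auto
  show hc: "hang x \<noteq> cur" by (metis insertI1 Av A_irrefl cur_V x(1))
  show "hang x \<noteq> x" by (metis hang_A A_irrefl xV x(3))
  have cg: "cur \<in> gray A cur" using x by (simp add: gray_def)
  have "goods A (hang(x := cur)) (R(hang x := R (hang x) - R x, cur := R cur + R x)) cur = goods A hang R cur"
  proof -
    have "X \<le> (c - 1) * R (hang x)"
      using rehang_big[OF xV x(3,5)] by (meson diff_le_self le_trans mult_le_mono2)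
    then show ?thesis
      unfolding goods_def using rehang_big[OF xV x(3,5)] cg x(1,3) by auto
  qed
  then show "dfs_comp m V A par (hang(x := cur)) (R(hang x := R (hang x) - R x, cur := R cur + R x))
    ptr vis ord cur r num cnt"
    using rehang[OF x(1) xV x(3-6)] inv by (auto simp: dfs_comp_def)
qed

lemma comp_finish_keep:
  assumes inv: "dfs_comp m V A par hang R ptr vis ord cur r num cnt"
    and p: "cur \<noteq> n" "ptr cur = off (Suc cur)"
    and keep: "par cur = n \<or> X \<le> (c - 1) * R cur"
  shows "\<exists>m'<m. dfs_comp m' V A par hang R ptr vis ord (par cur) r num
    (if X \<le> (c - 1) * R cur then Suc cnt else cnt)"
proof -
  interpret dfs n E off nb w c X V A par hang R ptr cur using inv by (simp add: dfs_comp_def)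
  have g: "gray A cur = insert cur (gray A (par cur))" "cur \<notin> gray A (par cur)"
    using gray_par[OF p(1)] p(1) by (auto simp: gray_def)
  have cV: "cur \<in> V" using cur_V p by blast
  have hc: "hang cur = n" using hang_done cV g by blast
  have pe: "pending V A cur = insert cur (pending V A (par cur))" "cur \<notin> pending V A (par cur)"
    using g cV by (auto simp: pending_def)
  then have "card (pending V A (par cur)) < card (pending V A cur)"
    using pending_finite[of V A par hang R ptr cur] inv by (simp add: dfs_comp_def)
  moreover have "goods A hang R (par cur) = (if X \<le> (c - 1) * R cur then insert cur (goods A hang R cur)
      else goods A hang R cur)" "cur \<notin> goods A hang R cur"
    unfolding goods_def using g hc V_less[OF cV] by auto
  then have "card (goods A hang R (par cur)) = (if X \<le> (c - 1) * R cur then Suc cnt else cnt)"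
    using inv by (auto simp: dfs_comp_def goods_def)
  ultimately show ?thesis
    using inv finish_keep[OF p keep]
    by (intro exI[of _ "(n - r) + unscanned ptr + card (pending V A (par cur))"])
      (auto simp: dfs_comp_def)
qed

lemma comp_finish_hang:
  assumes inv: "dfs_comp m V A par hang R ptr vis ord cur r num cnt"
    and p: "cur \<noteq> n" "ptr cur = off (Suc cur)" "par cur \<noteq> n" "(c - 1) * R cur < X"
  shows "\<exists>m'<m. dfs_comp m' V A par (hang(cur := par cur)) (R(par cur := R (par cur) + R cur))
    ptr vis ord (par cur) r num cnt"
proof -
  interpret dfs n E off nb w c X V A par hang R ptr cur using inv by (simp add: dfs_comp_def)
  have g: "gray A cur = insert cur (gray A (par cur))" "cur \<notin> gray A (par cur)"
    using gray_par[OF p(1)] p(1) by (auto simp: gray_def)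
  have pg: "par cur \<in> gray A (par cur)" using p by (simp add: gray_def)
  have cV: "cur \<in> V" using cur_V p by blast
  have pe: "pending V A cur = insert cur (pending V A (par cur))" "cur \<notin> pending V A (par cur)"
    using g cV by (auto simp: pending_def)
  then have "card (pending V A (par cur)) < card (pending V A cur)"
    using pending_finite[of V A par hang R ptr cur] inv by (simp add: dfs_comp_def)
  moreover have "goods A (hang(cur := par cur)) (R(par cur := R (par cur) + R cur)) (par cur) =
      goods A hang R cur"
    unfolding goods_def using g pg p(3,4) by auto
  ultimately show ?thesis
    using inv finish_hang[OF p]
    by (intro exI[of _ "(n - r) + unscanned ptr + card (pending V A (par cur))"])
      (auto simp: dfs_comp_def)
qed

lemma comp_next:
  assumes inv: "dfs_comp m V A par hang R ptr vis ord cur r num cnt" and "r < n" "vis r \<noteq> 0"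
  shows "\<exists>m'<m. dfs_comp m' V A par hang R ptr vis ord cur (Suc r) num cnt"
  using assms less_Suc_eq
  by (intro exI[of _ "(n - Suc r) + unscanned ptr + card (pending V A cur)"])
    (auto simp: dfs_comp_def)

lemma comp_init:
  assumes "\<And>v. v < n \<Longrightarrow> ptr v = off v" "\<And>v. v < n \<Longrightarrow> hang v = n" "\<And>v. v < n \<Longrightarrow> R v = w v"
    "\<And>v. v < n \<Longrightarrow> vis v = 0 \<longleftrightarrow> light v" "inj_on ord {..<num}" "ord ` {..<num} = {v. v < n \<and> \<not> light v}"
    "cnt = card {v. v < n \<and> \<not> light v}"
  shows "dfs_comp (n + (\<Sum>v<n. off (Suc v) - off v) + n) {} (\<lambda>_. {}) par hang R ptr vis ord n 0 num cnt"
proof -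
  have "dfs n E off nb w c X {} (\<lambda>_. {}) par hang R ptr n"
    by unfold_locales (use assms(1-3) off_mono in auto)
  moreover have "goods (\<lambda>_. {}) hang R n = {v. v < n \<and> \<not> light v}"
    using assms(2,3) by (simp add: goods_def gray_def light_def not_less cong: conj_cong)
  moreover have "unscanned ptr = (\<Sum>v<n. off (Suc v) - off v)" using assms(1) by (simp add: unscanned_def)
  moreover have "card (pending {} (\<lambda>_. {}) n) \<le> card {..<n}"
    by (intro card_mono) (auto simp: pending_def gray_def light_def)
  ultimately show ?thesis using assms by (auto simp: dfs_comp_def ordered_def)
qed

end

section \<open>Correctness of the search program\<close>

locale machine = bcp_graph +
  fixes k :: nat
  assumes k: "1 \<le> k" and conn: "con {..<n}"
begin

definition agrees :: "state \<Rightarrow> bool" where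
  "agrees s \<longleftrightarrow> reg s ''n'' = n \<and> reg s ''k'' = k \<and> reg s ''X'' = X \<and>
    arr s ''w'' = w \<and> arr s ''off'' = off \<and> arr s ''adj'' = nb"

definition dfs_inv :: "nat \<Rightarrow> state \<Rightarrow> bool" where
  "dfs_inv m s \<longleftrightarrow> agrees s \<and>
    (\<exists>V A. dfs_comp m V A (arr s ''par'') (arr s ''hang'') (arr s ''R'') (arr s ''ptr'')
      (arr s ''vis'') (arr s ''ord'') (reg s ''cur'') (reg s ''r'') (reg s ''num'') (reg s ''cnt''))"

lemma scan_step:
  assumes inv: "dfs_inv m s" and g: "reg s ''cur'' < n"
    "arr s ''ptr'' (reg s ''cur'') < off (Suc (reg s ''cur''))"
  shows "\<exists>m'<m. dfs_inv m' (run scan_code s)"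
proof -
  define par hang R ptr vis ord cur r num cnt where defs: "par = arr s ''par''" "hang = arr s ''hang''"
    "R = arr s ''R''" "ptr = arr s ''ptr''" "vis = arr s ''vis''" "ord = arr s ''ord''"
    "cur = reg s ''cur''" "r = reg s ''r''" "num = reg s ''num''" "cnt = reg s ''cnt''"
  have ag: "reg s ''n'' = n" "reg s ''k'' = k" "reg s ''X'' = X"
    "arr s ''w'' = w" "arr s ''off'' = off" "arr s ''adj'' = nb"
    using inv by (auto simp: dfs_inv_def agrees_def)
  obtain V A where comp: "dfs_comp m V A par hang R ptr vis ord cur r num cnt"
    using inv by (auto simp: dfs_inv_def defs)
  interpret dfs n E off nb w c X V A par hang R ptr cur using comp by (simp add: dfs_comp_def)
  have cn: "cur < n" "cur \<noteq> n" "ptr cur < off (Suc cur)" using g by (auto simp: defs)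
  have cg: "cur \<in> gray A cur" using cn by (simp add: gray_def)
  define x where "x = nb (ptr cur)"
  have "x \<in> nb ` {off cur..<off (Suc cur)}" using cn ptr_ge[of cur] by (auto simp: x_def)
  then have xE: "E x cur" using nb cn E_sym by blast
  then have x: "x < n" "x \<noteq> cur" using E_less E_irrefl by metis+
  have cA: "v \<noteq> cur" "cur \<in> A v" if "v \<in> V" "par v = cur" for v
    using A_par[of v] that cn A_irrefl[of v] by auto
  have nogray: "v \<notin> gray A cur" if "v \<in> V" "par v = cur" for v
    using cA[OF that] A_asym[of cur v] that(1) cur_V cn by (auto simp: gray_def)
  show ?thesis
  proof (cases "vis x = 0")
    case True
    \<comment> \<open>The program moves the pointer before visiting \<open>x\<close>; the invariant
      is restored in the opposite order, since the pointer may pass a light vertex only once it is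
      visited.\<close>
    have v: "dfs_comp m (insert x V) (A(x := gray A cur)) (par(x := cur)) hang R ptr (vis(x := Suc 0))
        (ord(num := x)) x r (Suc num) cnt"
      using comp_visit[OF comp x(1) True] xE by blast
    have g': "gray (A(x := gray A cur)) x = insert x (gray A cur)" using x by (simp add: gray_def)
    have xV: "x \<notin> V" using comp True x by (auto simp: dfs_comp_def)
    have hx: "hang x = n" using hang_white x xV by blast
    have "v \<notin> (A(x := gray A cur)) x" if "v \<in> insert x (gray A cur)" "(par(x := cur)) v = cur" for v
      using that nogray gray_V xV by (auto split: if_splits)
    then obtain m' where "m' < m" and m': "dfs_comp m' (insert x V) (A(x := gray A cur)) (par(x := cur)) hang R
        (ptr(cur := Suc (ptr cur))) (vis(x := Suc 0)) (ord(num := x)) x r (Suc num) cnt"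
      using comp_advance[OF v cn(3)] g' cg x hx unfolding x_def by auto
    moreover have "dfs_inv m' (run scan_code s)"
      unfolding dfs_inv_def
    proof (intro conjI exI)
      show "agrees (run scan_code s)" using ag by (simp add: agrees_def scan_code_def visit_code_def)
      have "vis (nb (ptr cur)) = 0" using True x_def by simp
      then show "dfs_comp m' (insert x V) (A(x := gray A cur)) (arr (run scan_code s) ''par'')
          (arr (run scan_code s) ''hang'') (arr (run scan_code s) ''R'') (arr (run scan_code s) ''ptr'')
          (arr (run scan_code s) ''vis'') (arr (run scan_code s) ''ord'') (reg (run scan_code s) ''cur'')
          (reg (run scan_code s) ''r'') (reg (run scan_code s) ''num'') (reg (run scan_code s) ''cnt'')"
        using m' ag by (simp add: scan_code_def visit_code_def x_def defs)
    qed
    ultimately show ?thesis by blast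
  next
    case False
    have other: "v \<notin> A x" if "v \<in> gray A cur" "par v = cur" for v
      using that nogray gray_V by blast
    show ?thesis
    proof (cases "hang x \<noteq> n \<and> par (hang x) = cur \<and> X \<le> R (hang x)")
      case True
      then have h: "hang x \<noteq> n" "par (hang x) = cur" "X \<le> R (hang x)" by auto
      have hn: "hang x < n" using h hang_A A_V hang_white x V_less by blast
      note v = comp_rehang[OF comp cn(2) x(1) h xE]
      \<comment> \<open>After the move \<open>x\<close> hangs at \<open>cur\<close>, which is not
        its own parent, so no overweight child waits for \<open>x\<close> any longer and the pointer
        may pass it.\<close>
      obtain m' where "m' < m" and m': "dfs_comp m' V A par (hang(x := cur))
          (R(hang x := R (hang x) - R x, cur := R cur + R x)) (ptr(cur := Suc (ptr cur))) vis ord cur r num cnt"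
        using comp_advance[OF v(1) cn(3) cg] x False other nogray[OF cur_V[OF cn(2)]] cg
        unfolding x_def by auto
      moreover have "dfs_inv m' (run scan_code s)"
        unfolding dfs_inv_def
      proof (intro conjI exI)
        show "agrees (run scan_code s)" using ag by (simp add: agrees_def scan_code_def visit_code_def)
        show "dfs_comp m' V A (arr (run scan_code s) ''par'')
            (arr (run scan_code s) ''hang'') (arr (run scan_code s) ''R'') (arr (run scan_code s) ''ptr'')
            (arr (run scan_code s) ''vis'') (arr (run scan_code s) ''ord'') (reg (run scan_code s) ''cur'')
            (reg (run scan_code s) ''r'') (reg (run scan_code s) ''num'') (reg (run scan_code s) ''cnt'')"
          using m' ag False h v(2,3) x hn by (simp add: scan_code_def visit_code_def x_def defs)
      qed
      ultimately show ?thesis by blast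
    next
      case none: False
      obtain m' where "m' < m" and m': "dfs_comp m' V A par hang R (ptr(cur := Suc (ptr cur))) vis ord cur r num cnt"
        using comp_advance[OF comp cn(3) cg] x False other none unfolding x_def by auto
      moreover have "dfs_inv m' (run scan_code s)"
        unfolding dfs_inv_def
      proof (intro conjI exI)
        show "agrees (run scan_code s)" using ag by (simp add: agrees_def scan_code_def visit_code_def)
        have "\<not> (hang x < n \<and> \<not> R (hang x) < X \<and> \<not> par (hang x) < cur \<and> \<not> cur < par (hang x))"
          using none by auto
        then show "dfs_comp m' V A (arr (run scan_code s) ''par'')
            (arr (run scan_code s) ''hang'') (arr (run scan_code s) ''R'') (arr (run scan_code s) ''ptr'')
            (arr (run scan_code s) ''vis'') (arr (run scan_code s) ''ord'') (reg (run scan_code s) ''cur'')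
            (reg (run scan_code s) ''r'') (reg (run scan_code s) ''num'') (reg (run scan_code s) ''cnt'')"
          using m' ag False by (auto simp: scan_code_def visit_code_def x_def defs)
      qed
      ultimately show ?thesis by blast
    qed
  qed
qed

lemma finish_step:
  assumes inv: "dfs_inv m s" and g: "reg s ''cur'' < n"
    "\<not> arr s ''ptr'' (reg s ''cur'') < off (Suc (reg s ''cur''))"
  shows "\<exists>m'<m. dfs_inv m' (run (finish_code c) s)"
proof -
  define par hang R ptr vis ord cur r num cnt where defs: "par = arr s ''par''" "hang = arr s ''hang''"
    "R = arr s ''R''" "ptr = arr s ''ptr''" "vis = arr s ''vis''" "ord = arr s ''ord''"
    "cur = reg s ''cur''" "r = reg s ''r''" "num = reg s ''num''" "cnt = reg s ''cnt''"
  have ag: "reg s ''n'' = n" "reg s ''k'' = k" "reg s ''X'' = X"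
    "arr s ''w'' = w" "arr s ''off'' = off" "arr s ''adj'' = nb"
    using inv by (auto simp: dfs_inv_def agrees_def)
  obtain V A where comp: "dfs_comp m V A par hang R ptr vis ord cur r num cnt"
    using inv by (auto simp: dfs_inv_def defs)
  interpret dfs n E off nb w c X V A par hang R ptr cur using comp by (simp add: dfs_comp_def)
  have cn: "cur < n" "cur \<noteq> n" "ptr cur = off (Suc cur)" using g ptr_le[of cur] by (auto simp: defs)
  have pn: "par cur \<noteq> n \<Longrightarrow> par cur < n" using par_V cur_V cn V_less by blast
  have ag': "agrees (run (finish_code c) s)" using ag by (simp add: agrees_def finish_code_def)
  show ?thesis
  proof (cases "par cur = n \<or> X \<le> (c - 1) * R cur")
    case True
    then obtain m' where "m' < m" and m': "dfs_comp m' V A par hang R ptr vis ord (par cur) r num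
        (if X \<le> (c - 1) * R cur then Suc cnt else cnt)"
      using comp_finish_keep[OF comp cn(2,3)] by blast
    moreover have "dfs_inv m' (run (finish_code c) s)"
      unfolding dfs_inv_def
    proof (intro conjI exI, rule ag')
      show "dfs_comp m' V A (arr (run (finish_code c) s) ''par'')
          (arr (run (finish_code c) s) ''hang'') (arr (run (finish_code c) s) ''R'') (arr (run (finish_code c) s) ''ptr'')
          (arr (run (finish_code c) s) ''vis'') (arr (run (finish_code c) s) ''ord'') (reg (run (finish_code c) s) ''cur'')
          (reg (run (finish_code c) s) ''r'') (reg (run (finish_code c) s) ''num'') (reg (run (finish_code c) s) ''cnt'')"
        using m' ag True by (auto simp: finish_code_def defs split: if_splits)
    qed
    ultimately show ?thesis by blast
  next
    case False
    then obtain m' where "m' < m" and m': "dfs_comp m' V A par (hang(cur := par cur))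
        (R(par cur := R (par cur) + R cur)) ptr vis ord (par cur) r num cnt"
      using comp_finish_hang[OF comp cn(2,3)] by auto
    moreover have "dfs_inv m' (run (finish_code c) s)"
      unfolding dfs_inv_def
    proof (intro conjI exI, rule ag')
      show "dfs_comp m' V A (arr (run (finish_code c) s) ''par'')
          (arr (run (finish_code c) s) ''hang'') (arr (run (finish_code c) s) ''R'') (arr (run (finish_code c) s) ''ptr'')
          (arr (run (finish_code c) s) ''vis'') (arr (run (finish_code c) s) ''ord'') (reg (run (finish_code c) s) ''cur'')
          (reg (run (finish_code c) s) ''r'') (reg (run (finish_code c) s) ''num'') (reg (run (finish_code c) s) ''cnt'')"
        using m' ag False pn by (simp add: finish_code_def defs)
    qed
    ultimately show ?thesis by blast
  qed
qed

lemma root_step: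
  assumes inv: "dfs_inv m s" and g: "\<not> reg s ''cur'' < n" "reg s ''r'' < n"
  shows "\<exists>m'<m. dfs_inv m' (run (If (Less (Arr ''vis'' (Reg ''r'')) (Const 1)) (visit_code ''r'') Skip;;
       ''r'' ::= Plus (Reg ''r'') (Const 1)) s)" (is "\<exists>m'<m. dfs_inv m' ?s")
proof -
  define par hang R ptr vis ord cur r num cnt where defs: "par = arr s ''par''" "hang = arr s ''hang''"
    "R = arr s ''R''" "ptr = arr s ''ptr''" "vis = arr s ''vis''" "ord = arr s ''ord''"
    "cur = reg s ''cur''" "r = reg s ''r''" "num = reg s ''num''" "cnt = reg s ''cnt''"
  have ag: "reg s ''n'' = n" "reg s ''k'' = k" "reg s ''X'' = X"
    "arr s ''w'' = w" "arr s ''off'' = off" "arr s ''adj'' = nb"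
    using inv by (auto simp: dfs_inv_def agrees_def)
  obtain V A where comp: "dfs_comp m V A par hang R ptr vis ord cur r num cnt"
    using inv by (auto simp: dfs_inv_def defs)
  interpret dfs n E off nb w c X V A par hang R ptr cur using comp by (simp add: dfs_comp_def)
  have cn: "cur = n" "r < n" using g cur_V V_less by (auto simp: defs)
  have ag': "agrees ?s" using ag by (simp add: agrees_def visit_code_def)
  show ?thesis
  proof (cases "vis r = 0")
    case True
    have v: "dfs_comp m (insert r V) (A(r := gray A cur)) (par(r := cur)) hang R ptr (vis(r := Suc 0))
        (ord(num := r)) r r (Suc num) cnt"
      using comp_visit[OF comp cn(2) True] cn by blast
    obtain m' where "m' < m" and m': "dfs_comp m' (insert r V) (A(r := gray A cur)) (par(r := cur)) hang R ptr
        (vis(r := Suc 0)) (ord(num := r)) r (Suc r) (Suc num) cnt"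
      using comp_next[OF v cn(2)] by auto
    moreover have "dfs_inv m' ?s"
      unfolding dfs_inv_def
    proof (intro conjI exI, rule ag')
      show "dfs_comp m' (insert r V) (A(r := gray A cur)) (arr ?s ''par'')
          (arr ?s ''hang'') (arr ?s ''R'') (arr ?s ''ptr'')
          (arr ?s ''vis'') (arr ?s ''ord'') (reg ?s ''cur'')
          (reg ?s ''r'') (reg ?s ''num'') (reg ?s ''cnt'')"
        using m' ag True by (simp add: visit_code_def defs)
    qed
    ultimately show ?thesis by blast
  next
    case False
    obtain m' where "m' < m" and m': "dfs_comp m' V A par hang R ptr vis ord cur (Suc r) num cnt"
      using comp_next[OF comp cn(2) False] by blast
    moreover have "dfs_inv m' ?s"
      unfolding dfs_inv_def
    proof (intro conjI exI, rule ag')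
      show "dfs_comp m' V A (arr ?s ''par'')
          (arr ?s ''hang'') (arr ?s ''R'') (arr ?s ''ptr'')
          (arr ?s ''vis'') (arr ?s ''ord'') (reg ?s ''cur'')
          (reg ?s ''r'') (reg ?s ''num'') (reg ?s ''cnt'')"
        using m' ag False by (simp add: visit_code_def defs)
    qed
    ultimately show ?thesis by blast
  qed
qed

lemma dfs_loop:
  "triple (dfs_inv m) (While dfs_guard (dfs_body c)) ((m + 1) * (1 + bcost dfs_guard + max_cost (dfs_body c)))
    (\<lambda>s. (\<exists>m'. dfs_inv m' s) \<and> \<not> bval dfs_guard s)"
proof (rule triple_while, rule triple_run)
  show "loop_free (dfs_body c)"
    by (simp add: dfs_body_def scan_code_def finish_code_def visit_code_def)
  fix m s assume a: "dfs_inv m s \<and> bval dfs_guard s"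
  then have ag: "reg s ''n'' = n" "arr s ''off'' = off" by (auto simp: dfs_inv_def agrees_def)
  show "\<exists>m'<m. dfs_inv m' (run (dfs_body c) s)"
  proof (cases "reg s ''cur'' < n")
    case True
    show ?thesis
    proof (cases "arr s ''ptr'' (reg s ''cur'') < off (Suc (reg s ''cur''))")
      case lt: True
      then show ?thesis using scan_step[of m s] a True ag by (simp add: dfs_body_def)
    next
      case False
      then show ?thesis using finish_step[of m s] a True ag by (simp add: dfs_body_def)
    qed
  next
    case False
    then have "reg s ''r'' < n" using a ag by (simp add: dfs_guard_def)
    then show ?thesis using root_step[of m s] a False ag by (simp add: dfs_body_def)
  qed
qed

definition init_inv :: "nat \<Rightarrow> state \<Rightarrow> bool" where
  "init_inv m s \<longleftrightarrow> agrees s \<and> reg s ''j'' \<le> n \<and> n - reg s ''j'' \<le> m \<and>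
    (\<forall>v<reg s ''j''. arr s ''ptr'' v = off v \<and> arr s ''hang'' v = n \<and> arr s ''R'' v = w v \<and>
      (arr s ''vis'' v = 0 \<longleftrightarrow> light v)) \<and>
    inj_on (arr s ''ord'') {..<reg s ''num''} \<and>
    arr s ''ord'' ` {..<reg s ''num''} = {v. v < reg s ''j'' \<and> \<not> light v} \<and>
    reg s ''cnt'' = card {v. v < reg s ''j'' \<and> \<not> light v}"

lemma init_step:
  assumes inv: "init_inv m s" and g: "reg s ''j'' < n"
  shows "\<exists>m'<m. init_inv m' (run (init_body c) s)"
proof -
  define j num ord where defs: "j = reg s ''j''" "num = reg s ''num''" "ord = arr s ''ord''"
  have ag: "reg s ''n'' = n" "reg s ''k'' = k" "reg s ''X'' = X"
    "arr s ''w'' = w" "arr s ''off'' = off" "arr s ''adj'' = nb"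
    using inv by (auto simp: init_inv_def agrees_def)
  have l: "light j \<longleftrightarrow> (c - 1) * w j < X" using g by (simp add: light_def defs)
  have o: "inj_on ord {..<num}" "ord ` {..<num} = {v. v < j \<and> \<not> light v}"
    using inv by (auto simp: init_inv_def defs)
  have all: "\<forall>v<j. arr s ''ptr'' v = off v \<and> arr s ''hang'' v = n \<and> arr s ''R'' v = w v \<and>
      (arr s ''vis'' v = 0 \<longleftrightarrow> light v)" "reg s ''cnt'' = card {v. v < j \<and> \<not> light v}" "n - j \<le> m" "j < n"
    using inv g by (auto simp: init_inv_def defs)
  have "init_inv (n - Suc j) (run (init_body c) s)"
  proof (cases "light j")
    case True
    have "{v. v < Suc j \<and> \<not> light v} = {v. v < j \<and> \<not> light v}" using True less_Suc_eq by auto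
    then show ?thesis using True l ag all o
      by (auto simp: init_inv_def init_body_def agrees_def defs less_Suc_eq)
  next
    case False
    have s: "{v. v < Suc j \<and> \<not> light v} = insert j {v. v < j \<and> \<not> light v}" using False less_Suc_eq by auto
    have im: "(ord(num := j)) ` {..<num} = ord ` {..<num}" by auto
    have "inj_on (ord(num := j)) {..<num}" using o(1) by (auto simp: inj_on_def)
    then have 1: "inj_on (ord(num := j)) {..<Suc num}" using im o(2) by (simp add: lessThan_Suc)
    have 2: "(ord(num := j)) ` {..<Suc num} = {v. v < Suc j \<and> \<not> light v}"
      unfolding s o(2)[symmetric] by (simp only: lessThan_Suc image_insert im fun_upd_same)
    have 3: "card {v. v < Suc j \<and> \<not> light v} = Suc (card {v. v < j \<and> \<not> light v})"
      unfolding s by simp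
    let ?s = "run (init_body c) s"
    have r: "?s = s
      \<lparr>reg := (reg s)(''cnt'' := Suc (reg s ''cnt''), ''num'' := Suc num, ''j'' := Suc j),
       arr := (arr s)(''ptr'' := (arr s ''ptr'')(j := off j), ''hang'' := (arr s ''hang'')(j := n),
         ''R'' := (arr s ''R'')(j := w j), ''vis'' := (arr s ''vis'')(j := Suc 0), ''ord'' := ord(num := j))\<rparr>"
      using False l ag by (simp add: init_body_def defs)
    have st: "reg ?s ''j'' = Suc j" "reg ?s ''num'' = Suc num" "arr ?s ''ord'' = ord(num := j)"
      unfolding r by simp_all
    have 4: "agrees ?s" unfolding r agrees_def using ag by simp
    have 5: "reg ?s ''cnt'' = card {v. v < Suc j \<and> \<not> light v}" unfolding r 3 using all(2) by simp
    have 6: "\<forall>v<Suc j. arr ?s ''ptr'' v = off v \<and> arr ?s ''hang'' v = n \<and> arr ?s ''R'' v = w v \<and>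
      (arr ?s ''vis'' v = 0 \<longleftrightarrow> light v)"
      unfolding r using all(1) False by (simp add: less_Suc_eq)
    have 7: "Suc j \<le> n" "n - Suc j \<le> n - Suc j" using all(4) by simp_all
    show ?thesis unfolding init_inv_def st by (intro conjI; fact 1 2 4 5 6 7)
  qed
  moreover have "n - Suc j < m" using all by simp
  ultimately show ?thesis by blast
qed

definition volume :: nat where
  "volume = (\<Sum>v<n. off (Suc v) - off v + 1)"

definition searched :: "state \<Rightarrow> bool" where
  "searched s \<longleftrightarrow> agrees s \<and> (\<exists>V A. dfs_end n E off nb w c X V A (arr s ''par'') (arr s ''hang'') (arr s ''R'')
      (arr s ''ptr'') n \<and> ordered (arr s ''ord'') n V A \<and>
     reg s ''cnt'' = card {v. v < n \<and> arr s ''hang'' v = n \<and> X \<le> (c - 1) * arr s ''R'' v})"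

lemma search_code:
  "triple agrees (search_code c)
    (6 + (n + 1) * (4 + max_cost (init_body c)) + 4 +
      (2 * volume + 1) * (1 + bcost dfs_guard + max_cost (dfs_body c))) searched"
proof -
  have 1: "triple agrees (''j'' ::= Const 0;; ''cnt'' ::= Const 0;; ''num'' ::= Const 0) 6 (init_inv n)"
    by (rule triple_conseq[OF triple_run[where P = agrees and Q = "init_inv n"]])
      (auto simp: agrees_def init_inv_def)
  have 2: "triple (init_inv n) (While (Less (Reg ''j'') (Reg ''n'')) (init_body c))
      ((n + 1) * (1 + bcost (Less (Reg ''j'') (Reg ''n'')) + max_cost (init_body c)))
      (\<lambda>s. (\<exists>m. init_inv m s) \<and> \<not> bval (Less (Reg ''j'') (Reg ''n'')) s)"
  proof (rule triple_while, rule triple_run)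
    show "loop_free (init_body c)" by (simp add: init_body_def)
    fix m s assume "init_inv m s \<and> bval (Less (Reg ''j'') (Reg ''n'')) s"
    then show "\<exists>m'<m. init_inv m' (run (init_body c) s)"
      by (intro init_step) (auto simp: init_inv_def agrees_def)
  qed
  have 3: "triple (\<lambda>s. (\<exists>m. init_inv m s) \<and> \<not> bval (Less (Reg ''j'') (Reg ''n'')) s)
      (''cur'' ::= Reg ''n'';; ''r'' ::= Const 0) 4 (dfs_inv (2 * volume))"
  proof (rule triple_conseq[OF triple_run])
    fix s assume "(\<exists>m. init_inv m s) \<and> \<not> bval (Less (Reg ''j'') (Reg ''n'')) s"
    then obtain m where inv: "init_inv m s" "\<not> reg s ''j'' < reg s ''n''" by auto
    then have ag: "agrees s" and j: "reg s ''j'' = n" by (auto simp: init_inv_def agrees_def)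
    have "dfs_comp (n + (\<Sum>v<n. off (Suc v) - off v) + n) {} (\<lambda>_. {}) (arr s ''par'') (arr s ''hang'')
        (arr s ''R'') (arr s ''ptr'') (arr s ''vis'') (arr s ''ord'') n 0 (reg s ''num'') (reg s ''cnt'')"
      using inv(1) j by (intro comp_init) (auto simp: init_inv_def)
    \<comment> \<open>One \<open>n\<close> stands for the counter \<open>r\<close>, the other for
      the pending vertices.\<close>
    moreover have "n + (\<Sum>v<n. off (Suc v) - off v) + n \<le> 2 * volume"
      using sum.distrib[of "\<lambda>v. off (Suc v) - off v" "\<lambda>v. 1" "{..<n}"] by (simp add: volume_def)
    ultimately have "dfs_comp (2 * volume) {} (\<lambda>_. {}) (arr s ''par'') (arr s ''hang'')
        (arr s ''R'') (arr s ''ptr'') (arr s ''vis'') (arr s ''ord'') n 0 (reg s ''num'') (reg s ''cnt'')"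
      unfolding dfs_comp_def by (meson le_trans)
    then show "dfs_inv (2 * volume) (run (''cur'' ::= Reg ''n'';; ''r'' ::= Const 0) s)"
      using ag unfolding dfs_inv_def agrees_def
      by (intro conjI exI[of _ "{}"] exI[of _ "\<lambda>_. {}"]) simp_all
  qed auto
  have 4: "searched s" if inv: "dfs_inv m s" and g: "\<not> bval dfs_guard s" for m s
  proof -
    have ag: "agrees s" and gn: "\<not> reg s ''r'' < n" "\<not> reg s ''cur'' < n"
      using inv g by (auto simp: dfs_inv_def agrees_def dfs_guard_def)
    obtain V A where comp: "dfs_comp m V A (arr s ''par'') (arr s ''hang'') (arr s ''R'') (arr s ''ptr'')
      (arr s ''vis'') (arr s ''ord'') (reg s ''cur'') (reg s ''r'') (reg s ''num'') (reg s ''cnt'')"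
      using inv by (auto simp: dfs_inv_def)
    interpret dfs n E off nb w c X V A "arr s ''par''" "arr s ''hang''" "arr s ''R''" "arr s ''ptr''" "reg s ''cur''"
      using comp by (simp add: dfs_comp_def)
    have cur: "reg s ''cur'' = n" using cur_V V_less gn by blast
    have allV: "v \<in> V" if "light v" for v
    proof -
      have "v < n" using that by (simp add: light_def)
      moreover have "reg s ''r'' = n" using comp gn by (simp add: dfs_comp_def)
      ultimately have "arr s ''vis'' v \<noteq> 0 \<and> (arr s ''vis'' v = 0 \<longleftrightarrow> light v \<and> v \<notin> V)"
        using comp unfolding dfs_comp_def by blast
      then show ?thesis using that by auto
    qed
    have e: "dfs_end n E off nb w c X V A (arr s ''par'') (arr s ''hang'') (arr s ''R'') (arr s ''ptr'') n"
      using dfs_axioms allV cur unfolding dfs_end_def dfs_end_axioms_def by simp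
    have o: "ordered (arr s ''ord'') (reg s ''num'') V A" using comp by (simp add: dfs_comp_def)
    \<comment> \<open>Now \<open>ord\<close> enumerates without repetition all vertices, light and
      heavy, which identifies \<open>num\<close> with \<open>n\<close>.\<close>
    have "card (arr s ''ord'' ` {..<reg s ''num''}) = card {v. v < n}"
      using o allV by (simp add: ordered_def)
    moreover have "card (arr s ''ord'' ` {..<reg s ''num''}) = reg s ''num''"
      using o card_image[of "arr s ''ord''" "{..<reg s ''num''}"] by (simp add: ordered_def)
    ultimately have "reg s ''num'' = n" by simp
    moreover have "reg s ''cnt'' = card {v. v < n \<and> arr s ''hang'' v = n \<and> X \<le> (c - 1) * arr s ''R'' v}"
      using comp cur by (simp add: dfs_comp_def goods_def gray_def)
    ultimately show ?thesis using ag e o unfolding searched_def by auto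
  qed
  show ?thesis
    unfolding search_code_def
    using triple_seq[OF 1 triple_seq[OF 2 triple_seq[OF 3 dfs_loop]]]
    by (rule triple_conseq) (use 4 in \<open>auto simp: algebra_simps\<close>)
qed

end

section \<open>The labelling program\<close>

text \<open>Labels of an earlier probe are still in memory and must be cleared. The same pass leaves
  some good root in \<open>st\<close> as the start of the breadth-first search.\<close>

definition roots_body :: "nat \<Rightarrow> com" where
  "roots_body c =
    ''x'' ::= Arr ''ord'' (Reg ''j'');;
    ''part''\<lbrakk>Reg ''x''\<rbrakk> ::= Const 0;;
    ''plab''\<lbrakk>Reg ''x''\<rbrakk> ::= Const 0;;
    If (Less (Arr ''hang'' (Reg ''x'')) (Reg ''n''))
      (''root''\<lbrakk>Reg ''x''\<rbrakk> ::= Arr ''root'' (Arr ''hang'' (Reg ''x'')))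
      (''root''\<lbrakk>Reg ''x''\<rbrakk> ::= Reg ''x'';;
       If (Less (scaled (c - 1) (Arr ''R'' (Reg ''x''))) (Reg ''X'')) Skip (''st'' ::= Reg ''x''));;
    ''j'' ::= Plus (Reg ''j'') (Const 1)"

definition start_code :: com where
  "start_code =
    ''q''\<lbrakk>Const 0\<rbrakk> ::= Reg ''st'';;
    ''part''\<lbrakk>Reg ''st''\<rbrakk> ::= Const 1;;
    ''plab''\<lbrakk>Reg ''st''\<rbrakk> ::= Const 1;;
    ''lab'' ::= Const 1;;
    ''hd'' ::= Const 0;;
    ''tl'' ::= Const 1;;
    ''e'' ::= Arr ''off'' (Reg ''st'')"

definition visit_part :: "nat \<Rightarrow> com" where
  "visit_part c =
    ''y'' ::= Arr ''root'' (Reg ''x'');;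
    If (Less (Arr ''plab'' (Reg ''y'')) (Const 1))
      (If (And (Not (Less (Arr ''hang'' (Reg ''y'')) (Reg ''n'')))
            (And (Not (Less (scaled (c - 1) (Arr ''R'' (Reg ''y''))) (Reg ''X'')))
              (Less (Reg ''lab'') (Reg ''k''))))
        (''lab'' ::= Plus (Reg ''lab'') (Const 1);;
         ''plab''\<lbrakk>Reg ''y''\<rbrakk> ::= Reg ''lab'')
        (''plab''\<lbrakk>Reg ''y''\<rbrakk> ::= Arr ''part'' (Arr ''q'' (Reg ''hd''))))
      Skip;;
    ''part''\<lbrakk>Reg ''x''\<rbrakk> ::= Arr ''plab'' (Reg ''y'');;
    ''q''\<lbrakk>Reg ''tl''\<rbrakk> ::= Reg ''x'';;
    ''tl'' ::= Plus (Reg ''tl'') (Const 1)"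

definition bfs_body :: "nat \<Rightarrow> com" where
  "bfs_body c =
    If (Less (Reg ''e'') (Arr ''off'' (Plus (Arr ''q'' (Reg ''hd'')) (Const 1))))
      (''x'' ::= Arr ''adj'' (Reg ''e'');;
       If (Less (Arr ''part'' (Reg ''x'')) (Const 1)) (visit_part c) Skip;;
       ''e'' ::= Plus (Reg ''e'') (Const 1))
      (''hd'' ::= Plus (Reg ''hd'') (Const 1);;
       ''e'' ::= Arr ''off'' (Arr ''q'' (Reg ''hd'')))"

definition label_code :: "nat \<Rightarrow> com" where
  "label_code c =
    ''j'' ::= Const 0;;
    While (Less (Reg ''j'') (Reg ''n'')) (roots_body c);;
    start_code;;
    While (Less (Reg ''hd'') (Reg ''tl'')) (bfs_body c)"

section \<open>Correctness of the labelling program\<close>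

context machine
begin

definition labelling :: "(nat \<Rightarrow> nat) \<Rightarrow> bool" where
  "labelling part \<longleftrightarrow> (\<forall>v<n. 1 \<le> part v \<and> part v \<le> k) \<and>
    (\<forall>l\<in>{1..k}. {v. v < n \<and> part v = l} \<noteq> {} \<and> con {v. v < n \<and> part v = l} \<and>
      X \<le> (c - 1) * (\<Sum>v\<in>{v. v < n \<and> part v = l}. w v))"

end

locale labeller = machine + dfs_end +
  fixes ord :: "nat \<Rightarrow> nat"
  assumes ordered: "ordered ord n V A" and many: "k \<le> card {v. good v}"
begin

lemma ord_inj: "inj_on ord {..<n}"
  using ordered by (simp add: ordered_def)

lemma ord_image: "ord ` {..<n} = {..<n}"
  using ordered V_all by (auto simp: ordered_def)

lemma ord_less: "i < n \<Longrightarrow> ord i < n"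
  using ord_image by blast

lemma hang_less: "v < n \<Longrightarrow> hang v \<noteq> n \<Longrightarrow> hang v < n"
  using hang_white hang_A A_V V_less by blast

lemma hang_before:
  assumes "i < n" "hang (ord i) \<noteq> n"
  shows "hang (ord i) \<in> ord ` {..<i}"
proof -
  have "ord i \<in> V" using hang_white ord_less assms by blast
  then have "hang (ord i) \<in> A (ord i)" "A (ord i) \<subseteq> ord ` {..<i}"
    using hang_A assms ordered by (simp_all add: ordered_def)
  then show ?thesis by blast
qed

definition label_pre :: "state \<Rightarrow> bool" where
  "label_pre s \<longleftrightarrow> agrees s \<and> arr s ''hang'' = hang \<and> arr s ''R'' = R \<and> arr s ''ord'' = ord"

text \<open>The recursion for \<open>root\<close> at a single vertex, so that it can be asserted for
  a partially filled array.\<close>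

definition is_root :: "(nat \<Rightarrow> nat) \<Rightarrow> nat \<Rightarrow> bool" where
  "is_root \<rho> v \<longleftrightarrow> \<rho> v = (if hang v = n then v else \<rho> (hang v))"

definition roots_inv :: "nat \<Rightarrow> state \<Rightarrow> bool" where
  "roots_inv m s \<longleftrightarrow> label_pre s \<and> reg s ''j'' \<le> n \<and> n - reg s ''j'' \<le> m \<and>
    (\<forall>i<reg s ''j''. arr s ''part'' (ord i) = 0 \<and> arr s ''plab'' (ord i) = 0 \<and>
      is_root (arr s ''root'') (ord i) \<and> (good (ord i) \<longrightarrow> good (reg s ''st'')))"

lemma roots_step:
  assumes inv: "roots_inv m s" and g: "reg s ''j'' < n"
  shows "\<exists>m'<m. roots_inv m' (run (roots_body c) s)"
proof -
  define j x where "j = reg s ''j''" and "x = ord j"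
  let ?s = "run (roots_body c) s"
  have j: "j < n" using g by (simp add: j_def)
  have x: "x < n" using ord_less j by (simp add: x_def)
  have ag: "reg s ''n'' = n" "reg s ''k'' = k" "reg s ''X'' = X"
    "arr s ''w'' = w" "arr s ''off'' = off" "arr s ''adj'' = nb"
    "arr s ''hang'' = hang" "arr s ''R'' = R" "arr s ''ord'' = ord"
    using inv by (auto simp: roots_inv_def label_pre_def agrees_def)
  have all: "arr s ''part'' (ord i) = 0 \<and> arr s ''plab'' (ord i) = 0 \<and>
      is_root (arr s ''root'') (ord i) \<and> (good (ord i) \<longrightarrow> good (reg s ''st''))" if "i < j" for i
    using inv that by (simp add: roots_inv_def j_def)
  let ?root = "(arr s ''root'')(x := if hang x = n then x else arr s ''root'' (hang x))"
  have hx: "hang x = n \<or> hang x < n" using hang_less x by blast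
  have st: "reg ?s ''j'' = Suc j" "arr ?s ''part'' = (arr s ''part'')(x := 0)"
    "arr ?s ''plab'' = (arr s ''plab'')(x := 0)" "arr ?s ''root'' = ?root"
    "reg ?s ''st'' = (if good x then x else reg s ''st'')"
    using ag hx x by (auto simp: roots_body_def j_def x_def good_def)
  have "label_pre ?s" using ag by (simp add: roots_body_def label_pre_def agrees_def)
  moreover have "arr ?s ''part'' (ord i) = 0 \<and> arr ?s ''plab'' (ord i) = 0 \<and>
      is_root ?root (ord i) \<and> (good (ord i) \<longrightarrow> good (reg ?s ''st''))" if "i < Suc j" for i
  proof -
    \<comment> \<open>Every vertex handled so far, and \<open>x\<close> itself, hangs strictly
      earlier in \<open>ord\<close> or nowhere. So writing the entry of \<open>x\<close> preserves
      all equations established before.\<close>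
    have nx: "hang (ord i) \<noteq> x" if a: "i \<le> j" "hang (ord i) \<noteq> n" for i
    proof -
      have "hang (ord i) \<in> ord ` {..<i}" using hang_before a j by simp
      then obtain i' where "i' < i" "hang (ord i) = ord i'" by blast
      then show ?thesis using inj_onD[OF ord_inj, of i' j] a j by (auto simp: x_def)
    qed
    show ?thesis
    proof (cases "i = j")
      case True
      then show ?thesis using nx[of j] by (auto simp: st is_root_def x_def)
    next
      case False
      then have i: "i < j" using that by simp
      then have "ord i \<noteq> x" using ord_inj j by (auto simp: x_def inj_on_def)
      then show ?thesis using all[OF i] nx[of i] i by (auto simp: st is_root_def)
    qed
  qed
  ultimately have "roots_inv (n - Suc j) ?s"
    unfolding roots_inv_def st using j by simp
  moreover have "n - Suc j < m" using inv j by (auto simp: roots_inv_def j_def)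
  ultimately show ?thesis by blast
qed

definition bfs_inv :: "nat \<Rightarrow> state \<Rightarrow> bool" where
  "bfs_inv m s \<longleftrightarrow> label_pre s \<and> (\<forall>v<n. is_root (arr s ''root'') v) \<and>
    bfs n E off nb k (arr s ''root'') good (arr s ''q'') (arr s ''part'') (arr s ''plab'')
      (reg s ''lab'') (reg s ''hd'') (reg s ''tl'') (reg s ''e'') \<and>
    pieces.remaining n off (arr s ''q'') (reg s ''hd'') (reg s ''tl'') (reg s ''e'') \<le> m"

lemma pieces:
  fixes root :: "nat \<Rightarrow> nat"
  assumes "\<forall>v<n. is_root root v"
  shows "pieces n E off nb k root good"
proof -
  have r: "\<And>v. v < n \<Longrightarrow> root v = (if hang v = n then v else root (hang v))"
    using assms by (simp add: is_root_def)
  show ?thesis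
  proof (unfold_locales, goal_cases)
    case 1 then show ?case by (rule k)
  next
    case 2 then show ?case by (rule conn)
  next
    case (3 v) then show ?case using root_path[of root, OF r] by blast
  next
    case (4 v) then show ?case using root_path[of root, OF r] r by metis
  next
    case (5 v) then show ?case using piece_con[of root, OF r] by blast
  next
    case (6 v) then show ?case by (simp add: good_def)
  next
    case (7 v) then show ?case using r by (simp add: good_def)
  next
    case 8 then show ?case by (rule many)
  qed
qed

lemma start:
  assumes "\<exists>m. roots_inv m s" "\<not> reg s ''j'' < n"
  shows "bfs_inv volume (run start_code s)"
proof -
  let ?s = "run start_code s" and ?st = "reg s ''st''"
  have ag: "label_pre s" and j: "reg s ''j'' = n"
    and all: "\<And>i. i < n \<Longrightarrow> arr s ''part'' (ord i) = 0 \<and> arr s ''plab'' (ord i) = 0 \<and>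
      is_root (arr s ''root'') (ord i) \<and> (good (ord i) \<longrightarrow> good ?st)"
    using assms by (auto simp: roots_inv_def)
  have all': "arr s ''part'' v = 0 \<and> arr s ''plab'' v = 0 \<and>
      is_root (arr s ''root'') v \<and> (good v \<longrightarrow> good ?st)" if v: "v < n" for v
  proof -
    have "v \<in> ord ` {..<n}" using v ord_image by simp
    then obtain i where "i < n" "v = ord i" by blast
    then show ?thesis using all[of i] by simp
  qed
  have "{v. good v} \<noteq> {}"
  proof
    assume "{v. good v} = {}"
    then have "card {v. good v} = 0" by (simp only: card.empty)
    then show False using many k by linarith
  qed
  then have good: "good ?st" using all' by (auto simp: good_def)
  interpret pieces n E off nb k "arr s ''root''" good
    by (rule pieces) (use all' in blast)
  have st: "arr ?s ''root'' = arr s ''root''" "arr ?s ''part'' = (arr s ''part'')(?st := 1)"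
    "arr ?s ''plab'' = (arr s ''plab'')(?st := 1)" "arr ?s ''q'' 0 = ?st" "reg ?s ''lab'' = 1"
    "reg ?s ''hd'' = 0" "reg ?s ''tl'' = 1" "reg ?s ''e'' = off ?st"
    using ag by (simp_all add: start_code_def label_pre_def agrees_def)
  have "bfs n E off nb k (arr s ''root'') good (arr ?s ''q'') (arr ?s ''part'') (arr ?s ''plab'') 1 0 1 (off ?st)"
    by (rule bfs_init[of ?st "arr ?s ''q''" "arr ?s ''part''" "arr ?s ''plab''", OF good st(4)]) (use all' in \<open>auto simp: st\<close>)
  moreover have "label_pre ?s" using ag by (simp add: start_code_def label_pre_def agrees_def)
  ultimately show ?thesis
    unfolding bfs_inv_def st volume_def using all' remaining_le by auto
qed

lemma bfs_step:
  assumes inv: "bfs_inv m s" and g: "reg s ''hd'' < reg s ''tl''"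
  shows "\<exists>m'<m. bfs_inv m' (run (bfs_body c) s)"
proof -
  define root q part plab lab head tail e where defs: "root = arr s ''root''" "q = arr s ''q''"
    "part = arr s ''part''" "plab = arr s ''plab''" "lab = reg s ''lab''" "head = reg s ''hd''"
    "tail = reg s ''tl''" "e = reg s ''e''"
  have ag: "reg s ''n'' = n" "reg s ''k'' = k" "reg s ''X'' = X"
    "arr s ''w'' = w" "arr s ''off'' = off" "arr s ''adj'' = nb"
    "arr s ''hang'' = hang" "arr s ''R'' = R" "arr s ''ord'' = ord"
    using inv by (auto simp: bfs_inv_def label_pre_def agrees_def)
  have rt: "\<forall>v<n. is_root root v" using inv by (simp add: bfs_inv_def defs)
  interpret bfs n E off nb k root good q part plab lab head tail e
    using inv by (simp add: bfs_inv_def defs)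
  have m: "remaining q head tail e \<le> m" using inv by (simp add: bfs_inv_def defs)
  have ht: "head < tail" using g by (simp add: defs)
  let ?s = "run (bfs_body c) s"
  have pre: "label_pre ?s" "arr ?s ''root'' = root"
    using ag by (simp_all add: label_pre_def agrees_def bfs_body_def visit_part_def defs)
  have intro: "\<exists>m'<m. bfs_inv m' ?s"
    if "bfs n E off nb k root good (arr ?s ''q'') (arr ?s ''part'') (arr ?s ''plab'')
      (reg ?s ''lab'') (reg ?s ''hd'') (reg ?s ''tl'') (reg ?s ''e'')"
      "remaining (arr ?s ''q'') (reg ?s ''hd'') (reg ?s ''tl'') (reg ?s ''e'') < remaining q head tail e"
    using that pre rt m
    by (intro exI[of _ "remaining (arr ?s ''q'') (reg ?s ''hd'') (reg ?s ''tl'') (reg ?s ''e'')"])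
      (simp add: bfs_inv_def)
  show ?thesis
  proof (cases "e < off (Suc (q head))")
    case False
    have "reg ?s ''hd'' = Suc head" "reg ?s ''e'' = off (q (Suc head))" "reg ?s ''tl'' = tail"
      "reg ?s ''lab'' = lab" "arr ?s ''q'' = q" "arr ?s ''part'' = part" "arr ?s ''plab'' = plab"
      using False ag by (simp_all add: bfs_body_def defs)
    then show ?thesis
      using step_head[OF ht False] remaining_head[OF ht False] by (intro intro) simp_all
  next
    case lt: True
    define y where "y = nb e"
    have qn: "q head < n" using q_less ht by blast
    have "y \<in> nb ` {off (q head)..<off (Suc (q head))}" using lt e_ge ht by (auto simp: y_def)
    then have yE: "E (q head) y" using nb qn by blast
    then have yn: "y < n" using E_sym E_less by blast
    show ?thesis
    proof (cases "part y = 0")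
      case False
      then have yq: "nb e \<in> q ` {..<tail}" using part[OF yn] y_def by simp
      have "reg ?s ''hd'' = head" "reg ?s ''e'' = Suc e" "reg ?s ''tl'' = tail"
        "reg ?s ''lab'' = lab" "arr ?s ''q'' = q" "arr ?s ''part'' = part" "arr ?s ''plab'' = plab"
        using False lt ag by (simp_all add: bfs_body_def y_def defs)
      then show ?thesis
        using skip[OF ht lt yq] remaining_skip[OF ht lt] by (intro intro) simp_all
    next
      case True
      define r where "r = root y"
      \<comment> \<open>One description for three outcomes: the piece already has a label, opens a
        new one, or joins the class of the queue head. Enqueuing \<open>y\<close> and advancing
        \<open>e\<close> then follow uniformly.\<close>
      define lab' where "lab' = (if plab r = 0 \<and> good r \<and> lab < k then Suc lab else lab)"
      define plab' where "plab' = (if plab r \<noteq> 0 then plab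
        else if good r \<and> lab < k then plab(r := Suc lab) else plab(r := part (q head)))"
      have rn: "r < n" using root_less yn by (simp add: r_def)
      have gr: "good r \<longleftrightarrow> \<not> hang r < n \<and> \<not> (c - 1) * R r < X"
        using rn hang_less by (auto simp: good_def)
      have b: "bfs n E off nb k root good q part plab' lab' head tail e"
      proof (cases "plab r = 0")
        case z: True
        show ?thesis
        proof (cases "good r \<and> lab < k")
          case True
          then show ?thesis using new_label z by (simp add: lab'_def plab'_def)
        next
          case False
          then have "lab' = lab" "plab' = plab(r := part (q head))"
            using z by (auto simp: lab'_def plab'_def)
          then show ?thesis using join_label[OF ht yE] z False by (simp add: r_def)
        qed
      next
        case False
        then show ?thesis using bfs_axioms by (simp add: lab'_def plab'_def)
      qed
      then interpret B: bfs n E off nb k root good q part plab' lab' head tail e .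
      have "part (q head) \<noteq> 0" using part[OF qn] ht by blast
      then have nz: "plab' (root y) \<noteq> 0" by (auto simp: plab'_def r_def)
      interpret B2: bfs n E off nb k root good "q(tail := y)" "part(y := plab' (root y))" plab' lab' head "Suc tail" e
        by (rule B.visit[OF ht yn True nz])
      have ht': "head < Suc tail" "e < off (Suc ((q(tail := y)) head))" using ht lt by auto
      have yq: "nb e \<in> (q(tail := y)) ` {..<Suc tail}" by (auto simp: y_def)
      have "reg ?s ''hd'' = head" "reg ?s ''e'' = Suc e" "reg ?s ''tl'' = Suc tail"
        "reg ?s ''lab'' = lab'" "arr ?s ''q'' = q(tail := y)" "arr ?s ''part'' = part(y := plab' (root y))"
        "arr ?s ''plab'' = plab'"
        using True lt ag gr by (simp_all add: bfs_body_def visit_part_def y_def r_def defs lab'_def plab'_def)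
      then show ?thesis
        using B2.skip[OF ht' yq] remaining_skip[OF ht lt] remaining_visit[OF ht]
        by (intro intro) simp_all
    qed
  qed
qed

lemma bfs_end:
  assumes "bfs_inv m s" "\<not> reg s ''hd'' < reg s ''tl''"
  shows "labelling (arr s ''part'')"
proof -
  let ?part = "arr s ''part''" and ?root = "arr s ''root''"
  have r: "\<And>v. v < n \<Longrightarrow> ?root v = (if hang v = n then v else ?root (hang v))"
    using assms by (simp add: is_root_def bfs_inv_def)
  interpret bfs n E off nb k ?root good "arr s ''q''" ?part "arr s ''plab''"
      "reg s ''lab''" "reg s ''hd''" "reg s ''tl''" "reg s ''e''"
    using assms by (simp add: bfs_inv_def)
  have "{v. v < n \<and> ?part v = l} \<noteq> {} \<and> X \<le> (c - 1) * (\<Sum>v\<in>{v. v < n \<and> ?part v = l}. w v)"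
    if l: "l \<in> {1..k}" for l
  proof -
    obtain g where g: "good g" "{v. v < n \<and> ?root v = g} \<subseteq> {v. v < n \<and> ?part v = l}"
      using class_end(2)[OF assms(2) l] by blast
    have "X \<le> (c - 1) * (\<Sum>v\<in>{v. v < n \<and> ?root v = g}. w v)"
      using piece_weight(2)[of ?root, OF r g(1)] .
    also have "\<dots> \<le> (c - 1) * (\<Sum>v\<in>{v. v < n \<and> ?part v = l}. w v)"
      using g(2) by (intro mult_le_mono2 sum_mono2) auto
    finally show ?thesis using g good_less good_root by blast
  qed
  then show ?thesis
    unfolding labelling_def using all_labelled[OF assms(2)] lab_end[OF assms(2)] class_end(1)[OF assms(2)] by auto
qed

lemma label_code:
  "triple label_pre (label_code c)
    (2 + (n + 1) * (4 + max_cost (roots_body c)) + max_cost start_code +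
      (volume + 1) * (4 + max_cost (bfs_body c))) (\<lambda>s. agrees s \<and> labelling (arr s ''part''))"
proof -
  have 1: "triple label_pre (''j'' ::= Const 0) 2 (roots_inv n)"
    by (rule triple_conseq[OF triple_run[where P = label_pre and Q = "roots_inv n"]])
      (auto simp: agrees_def label_pre_def roots_inv_def)
  have 2: "triple (roots_inv n) (While (Less (Reg ''j'') (Reg ''n'')) (roots_body c))
      ((n + 1) * (1 + bcost (Less (Reg ''j'') (Reg ''n'')) + max_cost (roots_body c)))
      (\<lambda>s. (\<exists>m. roots_inv m s) \<and> \<not> bval (Less (Reg ''j'') (Reg ''n'')) s)"
  proof (rule triple_while, rule triple_run)
    show "loop_free (roots_body c)" by (simp add: roots_body_def)
    fix m s assume "roots_inv m s \<and> bval (Less (Reg ''j'') (Reg ''n'')) s"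
    then show "\<exists>m'<m. roots_inv m' (run (roots_body c) s)"
      by (intro roots_step) (auto simp: roots_inv_def label_pre_def agrees_def)
  qed
  have 3: "triple (\<lambda>s. (\<exists>m. roots_inv m s) \<and> \<not> bval (Less (Reg ''j'') (Reg ''n'')) s)
      start_code (max_cost start_code) (bfs_inv volume)"
  proof (rule triple_run)
    fix s assume "(\<exists>m. roots_inv m s) \<and> \<not> bval (Less (Reg ''j'') (Reg ''n'')) s"
    then show "bfs_inv volume (run start_code s)"
      by (intro start) (auto simp: roots_inv_def label_pre_def agrees_def)
  qed (simp add: start_code_def)
  have 4: "triple (bfs_inv volume) (While (Less (Reg ''hd'') (Reg ''tl'')) (bfs_body c))
      ((volume + 1) * (1 + bcost (Less (Reg ''hd'') (Reg ''tl'')) + max_cost (bfs_body c)))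
      (\<lambda>s. (\<exists>m. bfs_inv m s) \<and> \<not> bval (Less (Reg ''hd'') (Reg ''tl'')) s)"
  proof (rule triple_while, rule triple_run)
    show "loop_free (bfs_body c)" by (simp add: bfs_body_def visit_part_def)
    fix m s assume "bfs_inv m s \<and> bval (Less (Reg ''hd'') (Reg ''tl'')) s"
    then show "\<exists>m'<m. bfs_inv m' (run (bfs_body c) s)"
      by (intro bfs_step) auto
  qed
  show ?thesis
    unfolding label_code_def
    using triple_seq[OF 1 triple_seq[OF 2 triple_seq[OF 3 4]]]
    by (rule triple_conseq) (use bfs_end in \<open>auto simp: algebra_simps bfs_inv_def label_pre_def\<close>)
qed

end

section \<open>Searching for the value\<close>

text \<open>\<open>part\<close> is written only after the count has reached \<open>k\<close>, so a
  failed probe leaves the last successful labelling intact.\<close>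

definition probe_code :: "nat \<Rightarrow> com" where
  "probe_code c =
    search_code c;;
    If (Less (Reg ''cnt'') (Reg ''k'')) Skip (label_code c;; ''lo'' ::= Reg ''X'')"

text \<open>Halving is not available on the machine, so the powers of two met while doubling are stored
  in \<open>pw\<close> and reused in decreasing order for the binary search.\<close>

definition double_code :: com where
  "double_code =
    ''X'' ::= Plus (Reg ''X'') (Reg ''X'');;
    ''i'' ::= Plus (Reg ''i'') (Const 1);;
    ''pw''\<lbrakk>Reg ''i''\<rbrakk> ::= Reg ''X''"

definition refine_code :: com where
  "refine_code =
    ''i'' ::= Minus (Reg ''i'') (Const 1);;
    ''X'' ::= Plus (Reg ''lo'') (Arr ''pw'' (Reg ''i''))"

text \<open>Bisection restarts at \<open>lo = 0\<close>, so that its interval has length exactly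
  \<open>2 ^ i\<close>. This repeats at most one probe, the one of the last successful
  power.\<close>

definition bcp_code :: "nat \<Rightarrow> com" where
  "bcp_code c =
    ((''X'' ::= Const 1;; ''i'' ::= Const 0;; ''pw''\<lbrakk>Const 0\<rbrakk> ::= Const 1);; probe_code c);;
    While (Not (Less (Reg ''cnt'') (Reg ''k''))) (double_code;; probe_code c);;
    ''lo'' ::= Const 0;;
    While (Less (Const 0) (Reg ''i'')) (refine_code;; probe_code c)"

lemmas written_simps = probe_code_def search_code_def label_code_def init_body_def dfs_body_def
  scan_code_def finish_code_def visit_code_def roots_body_def start_code_def bfs_body_def visit_part_def

lemma probe_frame:
  assumes "exec (probe_code c) s t s'"
  shows "reg s' ''i'' = reg s ''i''" "arr s' ''pw'' = arr s ''pw''"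
  using assms by (auto intro!: exec_frame_reg exec_frame_arr simp: written_simps)

lemma search_frame:
  assumes "exec (search_code c) s t s'"
  shows "reg s' ''lo'' = reg s ''lo''" "arr s' ''part'' = arr s ''part''"
  using assms by (auto intro!: exec_frame_reg exec_frame_arr simp: written_simps)

lemma label_frame:
  assumes "exec (label_code c) s t s'"
  shows "reg s' ''cnt'' = reg s ''cnt''"
  using assms by (auto intro!: exec_frame_reg exec_frame_arr simp: written_simps)

context machine
begin

text \<open>The sets need not cover the graph. A partition of larger minimum weight is thus a
  packing for every smaller guess, and singletons suffice for the guess 1.\<close>

definition packing :: "nat set set \<Rightarrow> bool" where
  "packing F \<longleftrightarrow> finite F \<and> disjoint F \<and>
    (\<forall>T\<in>F. T \<subseteq> {..<n} \<and> T \<noteq> {} \<and> con T \<and> X \<le> (\<Sum>v\<in>T. w v))"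

definition search_time :: nat where
  "search_time = 6 + (n + 1) * (4 + max_cost (init_body c)) + 4 +
      (2 * volume + 1) * (1 + bcost dfs_guard + max_cost (dfs_body c))"

definition label_time :: nat where
  "label_time = 2 + (n + 1) * (4 + max_cost (roots_body c)) + max_cost start_code +
      (volume + 1) * (4 + max_cost (bfs_body c))"

definition probe_time :: nat where
  "probe_time = search_time + label_time + 6"

lemma probe:
  assumes "agrees s"
  shows "\<exists>t s'. exec (probe_code c) s t s' \<and> t \<le> probe_time \<and> agrees s' \<and>
    reg s' ''i'' = reg s ''i'' \<and> arr s' ''pw'' = arr s ''pw'' \<and>
    (k \<le> reg s' ''cnt'' \<and> reg s' ''lo'' = X \<and> labelling (arr s' ''part'') \<or>
     reg s' ''cnt'' < k \<and> reg s' ''lo'' = reg s ''lo'' \<and> (\<forall>F. packing F \<longrightarrow> card F < k) \<and>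
       arr s' ''part'' = arr s ''part'')"
proof -
  obtain t s1 where 1: "exec (search_code c) s t s1" "t \<le> search_time" "searched s1"
    using search_code assms unfolding triple_def search_time_def by blast
  have ag1: "agrees s1" using 1 by (simp add: searched_def)
  define hang R ord where defs: "hang = arr s1 ''hang''" "R = arr s1 ''R''" "ord = arr s1 ''ord''"
  obtain V A where e: "dfs_end n E off nb w c X V A (arr s1 ''par'') hang R (arr s1 ''ptr'') n"
      and o: "ordered ord n V A"
      and cnt: "reg s1 ''cnt'' = card {v. v < n \<and> hang v = n \<and> X \<le> (c - 1) * R v}"
    using 1(3) unfolding searched_def defs by blast
  interpret dfs_end n E off nb w c X V A "arr s1 ''par''" hang R "arr s1 ''ptr''" n by (rule e)
  have cnt': "reg s1 ''cnt'' = card {v. good v}" using cnt by (simp add: good_def)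
  show ?thesis
  proof (cases "reg s1 ''cnt'' < k")
    case True
    have "card F < k" if "packing F" for F
    proof -
      have "card F \<le> card {v. good v}"
        using that by (intro packing_bound) (auto simp: packing_def disjoint_def)
      then show ?thesis using True cnt' by simp
    qed
    moreover have ex: "exec (probe_code c) s (t + (1 + bcost (Less (Reg ''cnt'') (Reg ''k'')) + 1)) s1"
    proof -
      have "bval (Less (Reg ''cnt'') (Reg ''k'')) s1" using True ag1 by (simp add: agrees_def)
      from exec.Seq[OF 1(1) exec.IfTrue[OF this exec.Skip]] show ?thesis
        unfolding probe_code_def .
    qed
    ultimately show ?thesis
      using ag1 True search_frame[OF 1(1)] probe_frame[OF ex] 1(2)
      by (intro exI[of _ "t + (1 + bcost (Less (Reg ''cnt'') (Reg ''k'')) + 1)"] exI[of _ s1])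
        (auto simp: probe_time_def)
  next
    case False
    interpret labeller n E off nb w c X k V A "arr s1 ''par''" hang R "arr s1 ''ptr''" n ord
      by unfold_locales (use o False cnt' in auto)
    have "label_pre s1" 
      unfolding label_pre_def using ag1 by (simp add: defs)
    then obtain u s2 where 2: "exec (label_code c) s1 u s2" "u \<le> label_time" "agrees s2" "labelling (arr s2 ''part'')"
      using label_code unfolding triple_def label_time_def by blast
    let ?s3 = "s2\<lparr>reg := (reg s2)(''lo'' := aval (Reg ''X'') s2)\<rparr>"
    let ?t = "t + (1 + bcost (Less (Reg ''cnt'') (Reg ''k'')) + (u + (1 + acost (Reg ''X''))))"
    have ex: "exec (probe_code c) s ?t ?s3"
      unfolding probe_code_def
      by (intro exec.Seq[OF 1(1)] exec.IfFalse exec.Seq[OF 2(1)] exec.Assign)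
        (use False ag1 in \<open>auto simp: agrees_def\<close>)
    have "agrees ?s3" "labelling (arr ?s3 ''part'')" "reg ?s3 ''lo'' = X" "k \<le> reg ?s3 ''cnt''"
      using 2 False label_frame[OF 2(1)] by (auto simp: agrees_def)
    then show ?thesis
      using probe_frame[OF ex] 1(2) 2(2) ex
      by (intro exI[of _ ?t] exI[of _ ?s3]) (auto simp: probe_time_def)
  qed
qed

end

section \<open>Doubling and bisection over the guess\<close>

locale optimum = machine n E off nb w c 0 k
  for n :: nat and E off nb w c k +
  fixes L :: nat
  assumes ok_bound: "machine.labelling n E w c Y k part \<Longrightarrow> Y < 2 ^ L"
    and one_packing: "\<exists>F. machine.packing n E w 1 F \<and> k \<le> card F"
begin

text \<open>The guess varies from probe to probe, so the locale fixes the dummy guess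
  \<open>0\<close> and refers to \<open>machine\<close> at \<open>Y\<close> explicitly.
  \<open>ok\<close> and \<open>bad\<close> are not complementary: for guesses above the optimum by a
  factor of at most \<open>c - 1\<close>, both may hold.\<close>

definition ok :: "nat \<Rightarrow> (nat \<Rightarrow> nat) \<Rightarrow> bool" where
  "ok Y part \<longleftrightarrow> machine.labelling n E w c Y k part"

definition bad :: "nat \<Rightarrow> bool" where
  "bad Y \<longleftrightarrow> (\<forall>F. machine.packing n E w Y F \<longrightarrow> card F < k)"

definition base :: "state \<Rightarrow> bool" where
  "base s \<longleftrightarrow> reg s ''n'' = n \<and> reg s ''k'' = k \<and> arr s ''w'' = w \<and> arr s ''off'' = off \<and> arr s ''adj'' = nb"

lemma probe_after:
  assumes "loop_free p" "base (run p s)"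
  shows "\<exists>t s'. exec (p;; probe_code c) s t s' \<and> t \<le> max_cost p + probe_time \<and> base s' \<and>
    reg s' ''X'' = reg (run p s) ''X'' \<and>
    reg s' ''i'' = reg (run p s) ''i'' \<and> arr s' ''pw'' = arr (run p s) ''pw'' \<and>
    (k \<le> reg s' ''cnt'' \<and> reg s' ''lo'' = reg (run p s) ''X'' \<and> ok (reg (run p s) ''X'') (arr s' ''part'') \<or>
     reg s' ''cnt'' < k \<and> reg s' ''lo'' = reg (run p s) ''lo'' \<and> bad (reg (run p s) ''X'') \<and>
       arr s' ''part'' = arr (run p s) ''part'')"
proof -
  define s1 Y where "s1 = run p s" and "Y = reg s1 ''X''"
  obtain t where t: "t \<le> max_cost p" "exec p s t s1" using exec_run[OF assms(1)] s1_def by blast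
  interpret M: machine n E off nb w c Y k by (rule machine_axioms)
  have "M.agrees s1" 
    unfolding M.agrees_def using assms(2) by (simp add: base_def s1_def Y_def)
  from M.probe[OF \<open>M.agrees s1\<close>] obtain u s' where u: "exec (probe_code c) s1 u s'" "u \<le> probe_time"
    "M.agrees s'" "reg s' ''i'' = reg s1 ''i''" "arr s' ''pw'' = arr s1 ''pw''"
    "k \<le> reg s' ''cnt'' \<and> reg s' ''lo'' = Y \<and> M.labelling (arr s' ''part'') \<or>
     reg s' ''cnt'' < k \<and> reg s' ''lo'' = reg s1 ''lo'' \<and> (\<forall>F. M.packing F \<longrightarrow> card F < k) \<and>
       arr s' ''part'' = arr s1 ''part''"
    by blast
  have "base s'" "reg s' ''X'' = Y" using u(3) by (simp_all add: base_def M.agrees_def)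
  then show ?thesis
    using u t exec.Seq[OF t(2) u(1)] unfolding ok_def bad_def s1_def[symmetric] Y_def[symmetric]
    by (intro exI[of _ "t + u"] exI[of _ s']) simp
qed

definition double_inv :: "nat \<Rightarrow> state \<Rightarrow> bool" where
  "double_inv m s \<longleftrightarrow> base s \<and> L - reg s ''i'' \<le> m \<and> reg s ''i'' \<le> L \<and> reg s ''X'' = 2 ^ reg s ''i'' \<and>
    (\<forall>j\<le>reg s ''i''. arr s ''pw'' j = 2 ^ j) \<and>
    (k \<le> reg s ''cnt'' \<and> ok (2 ^ reg s ''i'') (arr s ''part'') \<or> reg s ''cnt'' < k \<and> bad (2 ^ reg s ''i''))"

definition refine_inv :: "nat \<Rightarrow> state \<Rightarrow> bool" where
  "refine_inv m s \<longleftrightarrow> base s \<and> reg s ''i'' \<le> m \<and>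
    (\<forall>j\<le>reg s ''i''. arr s ''pw'' j = 2 ^ j) \<and>
    bad (reg s ''lo'' + 2 ^ reg s ''i'') \<and> (reg s ''lo'' = 0 \<or> ok (reg s ''lo'') (arr s ''part''))"

lemma double_step:
  "triple (\<lambda>s. double_inv m s \<and> bval (Not (Less (Reg ''cnt'') (Reg ''k''))) s)
    (double_code;; probe_code c) (max_cost double_code + probe_time) (\<lambda>s. \<exists>m'<m. double_inv m' s)"
  unfolding triple_def
proof (intro allI impI)
  fix s assume a: "double_inv m s \<and> bval (Not (Less (Reg ''cnt'') (Reg ''k''))) s"
  define i where "i = reg s ''i''"
  have s: "base s" "L - i \<le> m" "reg s ''X'' = 2 ^ i" "\<forall>j\<le>i. arr s ''pw'' j = 2 ^ j" "ok (2 ^ i) (arr s ''part'')"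
    using a by (auto simp: double_inv_def i_def base_def)
  \<comment> \<open>A labelling for the guess \<open>2 ^ i\<close> forces
    \<open>2 ^ i < 2 ^ L\<close>; this bounds the number of doublings.\<close>
  have iL: "i < L" using ok_bound s(5) unfolding ok_def by fastforce
  let ?r = "run double_code s"
  have d: "(2::nat) ^ i + 2 ^ i = 2 ^ Suc i" by simp
  have r: "base ?r" "reg ?r ''X'' = 2 ^ Suc i" "reg ?r ''i'' = Suc i" "arr ?r ''pw'' = (arr s ''pw'')(Suc i := 2 ^ Suc i)"
    using s d by (simp_all add: double_code_def base_def i_def del: power_Suc)
  have lf: "loop_free double_code" by (simp add: double_code_def)
  obtain t s' where e: "exec (double_code;; probe_code c) s t s'" "t \<le> max_cost double_code + probe_time"
    and s': "base s'" "reg s' ''X'' = 2 ^ Suc i" "reg s' ''i'' = Suc i"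
      "arr s' ''pw'' = (arr s ''pw'')(Suc i := 2 ^ Suc i)"
      "k \<le> reg s' ''cnt'' \<and> ok (2 ^ Suc i) (arr s' ''part'') \<or> reg s' ''cnt'' < k \<and> bad (2 ^ Suc i)"
    using probe_after[OF lf r(1)] unfolding r by blast
  have "double_inv (L - Suc i) s'"
    unfolding double_inv_def s' using s'(1,5) s(4) iL by (auto simp: le_Suc_eq)
  moreover have "L - Suc i < m" using iL s(2) by simp
  ultimately show "\<exists>t s'. exec (double_code;; probe_code c) s t s' \<and>
      t \<le> max_cost double_code + probe_time \<and> (\<exists>m'<m. double_inv m' s')"
    using e by blast
qed

lemma refine_step:
  "triple (\<lambda>s. refine_inv m s \<and> bval (Less (Const 0) (Reg ''i'')) s)
    (refine_code;; probe_code c) (max_cost refine_code + probe_time) (\<lambda>s. \<exists>m'<m. refine_inv m' s)"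
  unfolding triple_def
proof (intro allI impI)
  fix s assume a: "refine_inv m s \<and> bval (Less (Const 0) (Reg ''i'')) s"
  define lo where "lo = reg s ''lo''"
  obtain i where i: "reg s ''i'' = Suc i" using a by (auto dest: gr0_implies_Suc)
  have s: "base s" "Suc i \<le> m" "\<forall>j\<le>Suc i. arr s ''pw'' j = 2 ^ j" "bad (lo + 2 ^ Suc i)"
    "lo = 0 \<or> ok lo (arr s ''part'')"
    using a i by (auto simp: refine_inv_def lo_def)
  let ?r = "run refine_code s"
  have r: "base ?r" "reg ?r ''X'' = lo + 2 ^ i" "reg ?r ''i'' = i" "arr ?r ''pw'' = arr s ''pw''"
    "reg ?r ''lo'' = lo" "arr ?r ''part'' = arr s ''part''"
    using s i by (simp_all add: refine_code_def base_def lo_def)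
  have lf: "loop_free refine_code" by (simp add: refine_code_def)
  obtain t s' where e: "exec (refine_code;; probe_code c) s t s'" "t \<le> max_cost refine_code + probe_time"
    and s': "base s'" "reg s' ''i'' = i" "arr s' ''pw'' = arr s ''pw''"
      "reg s' ''lo'' = lo + 2 ^ i \<and> ok (lo + 2 ^ i) (arr s' ''part'') \<or>
       reg s' ''lo'' = lo \<and> bad (lo + 2 ^ i) \<and> arr s' ''part'' = arr s ''part''"
    using probe_after[OF lf r(1)] unfolding r by blast
  \<comment> \<open>On success \<open>lo\<close> rises to the middle and the upper end stays, on
    failure the upper end drops to the middle. Either way the upper end is bad.\<close>
  have "lo + 2 ^ Suc i = (lo + 2 ^ i) + 2 ^ i" by simp
  then have "bad (lo + 2 ^ i + 2 ^ i)" using s(4) by metis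
  then have "refine_inv i s'"
    unfolding refine_inv_def s'(2,3) using s'(1,4) s by auto
  moreover have "i < m" using s(2) by simp
  ultimately show "\<exists>t s'. exec (refine_code;; probe_code c) s t s' \<and>
      t \<le> max_cost refine_code + probe_time \<and> (\<exists>m'<m. refine_inv m' s')"
    using e by blast
qed

text \<open>The outcome of a probe need not be monotone in \<open>X\<close>; the search only maintains that the last
  labelling is good for \<open>lo\<close> and that the upper end of the interval exceeds the optimum.\<close>

lemma bcp_code:
  assumes "base s"
  shows "\<exists>t s'. exec (bcp_code c) s t s' \<and>
    t \<le> (7 + probe_time) + ((L + 1) * (5 + (max_cost double_code + probe_time)) +
      (2 + (L + 1) * (4 + (max_cost refine_code + probe_time)))) \<and>
    (\<exists>Y\<ge>1. ok Y (arr s' ''part'') \<and> bad (Suc Y))"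
proof -
  let ?p = "''X'' ::= Const 1;; ''i'' ::= Const 0;; ''pw''\<lbrakk>Const 0\<rbrakk> ::= Const 1"
  have 1: "triple base (?p;; probe_code c) (7 + probe_time) (double_inv L)"
    unfolding triple_def
  proof (intro allI impI)
    fix s assume b: "base s"
    let ?r = "run ?p s"
    have r: "base ?r" "reg ?r ''X'' = 1" "reg ?r ''i'' = 0" "arr ?r ''pw'' = (arr s ''pw'')(0 := 1)"
      using b by (simp_all add: base_def)
    obtain t s' where e: "exec (?p;; probe_code c) s t s'" "t \<le> max_cost ?p + probe_time"
      and s': "base s'" "reg s' ''X'' = 1" "reg s' ''i'' = 0" "arr s' ''pw'' = (arr s ''pw'')(0 := 1)"
        "k \<le> reg s' ''cnt'' \<and> ok 1 (arr s' ''part'') \<or> reg s' ''cnt'' < k \<and> bad 1"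
      using probe_after[OF _ r(1)] unfolding r by auto
    have "double_inv L s'" unfolding double_inv_def s' using s'(1,5) by simp
    moreover have "t \<le> 7 + probe_time" using e(2) by simp
    ultimately show "\<exists>t s'. exec (?p;; probe_code c) s t s' \<and> t \<le> 7 + probe_time \<and> double_inv L s'"
      using e(1) by blast
  qed
  note 2 = triple_while[OF double_step, of L]
  have 3: "triple (\<lambda>s. (\<exists>m. double_inv m s) \<and> \<not> bval (Not (Less (Reg ''cnt'') (Reg ''k''))) s)
      (''lo'' ::= Const 0) 2 (refine_inv L)"
    by (rule triple_conseq[OF triple_run[where Q = "refine_inv L" and
          P = "\<lambda>s. (\<exists>m. double_inv m s) \<and> \<not> bval (Not (Less (Reg ''cnt'') (Reg ''k''))) s"]])
      (auto simp: refine_inv_def double_inv_def base_def)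
  note 4 = triple_while[OF refine_step, of L]
  obtain t s' where e: "exec (bcp_code c) s t s'"
    "t \<le> (7 + probe_time) + ((L + 1) * (1 + bcost (Not (Less (Reg ''cnt'') (Reg ''k''))) + (max_cost double_code + probe_time)) +
      (2 + (L + 1) * (1 + bcost (Less (Const 0) (Reg ''i'')) + (max_cost refine_code + probe_time))))"
    and post: "\<exists>m. refine_inv m s'" "\<not> bval (Less (Const 0) (Reg ''i'')) s'"
    using triple_seq[OF 1 triple_seq[OF 2 triple_seq[OF 3 4]]] assms
    unfolding triple_def bcp_code_def by blast
  have b: "bad (Suc (reg s' ''lo''))" "reg s' ''lo'' = 0 \<or> ok (reg s' ''lo'') (arr s' ''part'')"
    using post by (auto simp: refine_inv_def)
  \<comment> \<open>This excludes the default \<open>lo = 0\<close>, for which \<open>part\<close>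
    would carry no guarantee.\<close>
  moreover have "\<not> bad 1" using one_packing by (auto simp: bad_def not_less)
  ultimately have "reg s' ''lo'' \<noteq> 0" by (metis One_nat_def)
  then have "\<exists>Y\<ge>1. ok Y (arr s' ''part'') \<and> bad (Suc Y)"
    using b by (intro exI[of _ "reg s' ''lo''"]) auto
  moreover have "t \<le> (7 + probe_time) + ((L + 1) * (5 + (max_cost double_code + probe_time)) +
      (2 + (L + 1) * (4 + (max_cost refine_code + probe_time))))"
    using e(2) by (simp add: algebra_simps)
  ultimately show ?thesis using e(1) by blast
qed

end

section \<open>Graphs given by adjacency lists\<close>

lemma finite_edges: "simple_graph G \<Longrightarrow> finite (edges G)"
  by (auto simp: simple_graph_def intro: finite_subset[of _ "Pow (verts G)"])

text \<open>Allows the number of vertices to be absorbed into the number of edges. Every vertex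
  except \<open>r\<close> is charged to an edge leading one step closer to \<open>r\<close>; if two
  shared an edge, each would be closer than the other.\<close>

lemma card_verts_le:
  assumes "simple_graph G" "connected_graph G"
  shows "card (verts G) \<le> card (edges G) + 1"
proof -
  define Q where "Q = {(x, y). {x, y} \<in> edges G}"
  obtain r where r: "r \<in> verts G" using assms by (auto simp: connected_graph_def)
  define d where "d v = (LEAST i. (r, v) \<in> Q ^^ i)" for v
  have ex: "\<exists>u. {u, v} \<in> edges G \<and> d v = Suc (d u)" if v: "v \<in> verts G" "v \<noteq> r" for v
  proof -
    have "(r, v) \<in> Q\<^sup>*" using assms(2) r v by (simp add: connected_graph_def Q_def)
    then obtain i where "(r, v) \<in> Q ^^ i" using rtrancl_imp_relpow by blast
    then have dv: "(r, v) \<in> Q ^^ d v" unfolding d_def by (rule LeastI)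
    then obtain j where j: "d v = Suc j" using v(2) by (cases "d v") auto
    then obtain u where u: "(r, u) \<in> Q ^^ j" "(u, v) \<in> Q" using dv by auto
    have "(r, u) \<in> Q ^^ d u" unfolding d_def by (rule LeastI[of _ j]) (rule u)
    then have "(r, v) \<in> Q ^^ Suc (d u)" using u by auto
    then have "d v \<le> Suc (d u)" unfolding d_def by (rule Least_le)
    moreover have "d u \<le> j" unfolding d_def by (rule Least_le) (rule u)
    ultimately show ?thesis using j u by (auto simp: Q_def)
  qed
  then obtain p where p: "\<And>v. v \<in> verts G - {r} \<Longrightarrow> {p v, v} \<in> edges G \<and> d v = Suc (d (p v))"
    by (metis Diff_iff singletonI)
  have "inj_on (\<lambda>v. {p v, v}) (verts G - {r})"
  proof (rule inj_onI, rule ccontr)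
    fix u v assume uv: "u \<in> verts G - {r}" "v \<in> verts G - {r}" "{p u, u} = {p v, v}" "u \<noteq> v"
    then have "u = p v" "v = p u" by (auto simp: doubleton_eq_iff)
    then show False using p[OF uv(1)] p[OF uv(2)] by simp
  qed
  then have "card (verts G - {r}) \<le> card (edges G)"
    using p finite_edges[OF assms(1)] by (intro card_inj_on_le[of "\<lambda>v. {p v, v}"]) auto
  then show ?thesis using r assms(1) by (simp add: simple_graph_def card_Diff_singleton)
qed

text \<open>Handshake count: the ordered adjacent pairs are grouped by their edge, and an edge has
  at most two orientations.\<close>

lemma sum_degrees_le:
  assumes "simple_graph G"
  shows "(\<Sum>v\<in>verts G. card {u. {v, u} \<in> edges G}) \<le> 2 * card (edges G)"
proof -
  have sub: "u \<in> verts G" if "{v, u} \<in> edges G" for u v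
    using assms that by (auto simp: simple_graph_def)
  have sub': "v \<in> verts G" if "{v, u} \<in> edges G" for u v
    using assms that by (auto simp: simple_graph_def)
  have fin: "finite {u. {v, u} \<in> edges G}" for v
    by (rule finite_subset[of _ "verts G"]) (use assms sub in \<open>auto simp: simple_graph_def\<close>)
  have two: "card {(v, u). {v, u} = e} \<le> 2" if "e \<in> edges G" for e
  proof -
    have "card e = 2" using assms that by (simp add: simple_graph_def)
    then obtain a b where "e = {a, b}" by (auto simp: card_2_iff)
    then have "{(v, u). {v, u} = e} \<subseteq> set [(a, b), (b, a)]" by (auto simp: doubleton_eq_iff)
    then have "card {(v, u). {v, u} = e} \<le> card (set [(a, b), (b, a)])"
      by (rule card_mono[OF finite_set])
    also have "\<dots> \<le> length [(a, b), (b, a)]" by (rule card_length)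
    also have "\<dots> = 2" by simp
    finally show ?thesis .
  qed
  have "(\<Sum>v\<in>verts G. card {u. {v, u} \<in> edges G}) = card (SIGMA v:verts G. {u. {v, u} \<in> edges G})"
    using assms fin by (simp add: simple_graph_def)
  also have "(SIGMA v:verts G. {u. {v, u} \<in> edges G}) = (\<Union>e\<in>edges G. {(v, u). {v, u} = e})"
    using sub' by auto
  also have "card \<dots> \<le> (\<Sum>e\<in>edges G. card {(v, u). {v, u} = e})"
    by (intro card_UN_le finite_edges assms)
  also have "\<dots> \<le> (\<Sum>e\<in>edges G. 2)" by (intro sum_mono two)
  finally show ?thesis by simp
qed

text \<open>Otherwise \<open>v\<close> with \<open>S\<close> induces exactly the star:
  \<open>v\<close> goes to the centre 0 and any numbering of \<open>S\<close> gives the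
  leaves.\<close>

lemma star_free_indep:
  assumes "simple_graph G" "star_free c G" "S \<subseteq> {u. {v, u} \<in> edges G}" "card S = c" "c \<noteq> 0"
  shows "\<exists>a\<in>S. \<exists>b\<in>S. {a, b} \<in> edges G"
proof (rule ccontr)
  assume none: "\<not> ?thesis"
  have e: "e \<subseteq> verts G \<and> card e = 2" if "e \<in> edges G" for e
    using assms that by (auto simp: simple_graph_def)
  have vS: "v \<notin> S" using assms(3) e[of "{v}"] by auto
  have fS: "finite S" using assms(4,5) card.infinite by metis
  then obtain g where g: "bij_betw g S {1..c}"
    using assms(4) by (metis card_atLeastAtMost diff_Suc_1 finite_atLeastAtMost finite_same_card_bij)
  define f where "f = g(v := 0)"
  have fs: "s \<in> S \<Longrightarrow> f s = g s" for s using vS by (auto simp: f_def)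
  have fv: "f v = 0" by (simp add: f_def)
  have gim: "g ` S = {1..c}" using g by (simp add: bij_betw_def)
  let ?U = "insert v S"
  have "S \<noteq> {}" using assms(4,5) by auto
  then have "v \<in> verts G" using assms(3) e by blast
  then have U: "?U \<subseteq> verts G" using assms(3) e by blast
  have "f ` ?U = {0..c}"
  proof -
    have "f ` S = g ` S" using fs by (rule image_cong[OF refl])
    then show ?thesis using gim by (auto simp: f_def)
  qed
  moreover have "inj_on f ?U"
  proof -
    have "inj_on f S" using g fs by (simp add: bij_betw_def inj_on_def)
    moreover have "f ` (S - {v}) \<subseteq> {1..c}"
      unfolding gim[symmetric] using fs by (intro image_subsetI) simp
    then have "f v \<notin> f ` (S - {v})" by (auto simp: f_def)
    ultimately show ?thesis by simp
  qed
  moreover have ed: "{e \<in> edges G. e \<subseteq> ?U} = (\<lambda>s. {v, s}) ` S"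
  proof
    show "{e \<in> edges G. e \<subseteq> ?U} \<subseteq> (\<lambda>s. {v, s}) ` S"
    proof
      fix x assume x: "x \<in> {e \<in> edges G. e \<subseteq> ?U}"
      then obtain a b where ab: "x = {a, b}" "a \<noteq> b" using e card_2_iff by (metis (no_types, lifting) mem_Collect_eq)
      then have "{a, b} \<in> edges G" "a = v \<or> a \<in> S" "b = v \<or> b \<in> S" using x by auto
      then have "a = v \<and> b \<in> S \<or> b = v \<and> a \<in> S" using none ab(2) by blast
      then show "x \<in> (\<lambda>s. {v, s}) ` S" using ab(1) by auto
    qed
  qed (use assms(3) in auto)
  have "(\<lambda>x. f ` x) ` {e \<in> edges G. e \<subseteq> ?U} = {{0, i} |i. i \<in> {1..c}}"
  proof -
    have "(\<lambda>x. f ` x) ` {e \<in> edges G. e \<subseteq> ?U} = (\<lambda>s. {0, g s}) ` S"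
      unfolding ed image_image
    proof (rule image_cong[OF refl])
      show "f ` {v, s} = {0, g s}" if "s \<in> S" for s using fs[OF that] fv by simp
    qed
    also have "\<dots> = (\<lambda>i. {0, i}) ` (g ` S)" by (simp add: image_image)
    finally show ?thesis unfolding gim Setcompr_eq_image Collect_mem_eq .
  qed
  ultimately have "isomorphic (induced G ?U) (star c)"
    unfolding isomorphic_def induced_def star_def bij_betw_def by auto
  then show False using assms(2) U by (auto simp: star_free_def)
qed

lemma take_concat_nth:
  assumes "v < length xs" "j < length (xs ! v)"
  shows "length (concat (take v xs)) + j < length (concat xs)"
    "concat xs ! (length (concat (take v xs)) + j) = xs ! v ! j"
proof -
  have "concat xs = concat (take v xs) @ xs ! v @ concat (drop (Suc v) xs)"
    by (metis assms(1) concat.simps(2) concat_append id_take_nth_drop)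
  then show "length (concat (take v xs)) + j < length (concat xs)"
    "concat xs ! (length (concat (take v xs)) + j) = xs ! v ! j"
    using assms(2) by (simp_all add: nth_append)
qed

section \<open>From the memory encoding to the abstract graph and back\<close>

locale bcp_input =
  fixes c :: nat and G :: "nat graph" and w :: "nat \<Rightarrow> nat" and k :: nat and adj :: "nat list list"
  assumes c: "3 \<le> c"
    and simple: "simple_graph G"
    and connected: "connected_graph G"
    and free: "star_free c G"
    and weights: "v \<in> verts G \<Longrightarrow> 1 \<le> w v"
    and k_pos: "1 \<le> k"
    and k_le: "k \<le> card (verts G)"
    and adj: "adjacency_lists G adj"
begin

definition n :: nat where "n = length adj"

definition E :: "nat \<Rightarrow> nat \<Rightarrow> bool" where "E u v \<longleftrightarrow> {u, v} \<in> edges G"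

definition off :: "nat \<Rightarrow> nat" where
  "off = list_arr (map (\<lambda>v. length (concat (take v adj))) [0..<Suc n])"

definition nb :: "nat \<Rightarrow> nat" where "nb = list_arr (concat adj)"

text \<open>The weights as stored: equal to \<open>w\<close> on the vertices and 0 beyond, whereas
  \<open>w\<close> is arbitrary there.\<close>

definition W :: "nat \<Rightarrow> nat" where "W = list_arr (map w [0..<n])"

lemma verts: "verts G = {..<n}"
  using adj by (auto simp: adjacency_lists_def n_def)

lemma W_eq: "v < n \<Longrightarrow> W v = w v"
  by (simp add: W_def list_arr_def)

lemma off_eq: "v \<le> n \<Longrightarrow> off v = length (concat (take v adj))"
  by (simp add: off_def list_arr_def del: upt_Suc)

lemma off_Suc: "v < n \<Longrightarrow> off (Suc v) = off v + length (adj ! v)"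
  by (simp add: off_eq take_Suc_conv_app_nth n_def)

lemma nb_eq: "v < n \<Longrightarrow> j < length (adj ! v) \<Longrightarrow> nb (off v + j) = adj ! v ! j"
  using take_concat_nth[of v adj j] by (simp add: nb_def list_arr_def off_eq n_def)

lemma edge_verts: "{u, v} \<in> edges G \<Longrightarrow> u \<in> verts G"
  using simple by (auto simp: simple_graph_def)

sublocale adj_graph n E off nb
proof
  show "E u v \<Longrightarrow> E v u" for u v by (simp add: E_def insert_commute)
  show "\<not> E v v" for v using simple by (auto simp: E_def simple_graph_def)
  show "E u v \<Longrightarrow> u < n" for u v using edge_verts verts by (auto simp: E_def)
  show "v < n \<Longrightarrow> off v \<le> off (Suc v)" for v by (simp add: off_Suc)
  show "nb ` {off v..<off (Suc v)} = {u. E v u}" if v: "v < n" for v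
  proof -
    have "{off v..<off (Suc v)} = (\<lambda>j. off v + j) ` {..<length (adj ! v)}"
      unfolding off_Suc[OF v] by (simp add: lessThan_atLeast0 add.commute)
    then have "nb ` {off v..<off (Suc v)} = (\<lambda>j. adj ! v ! j) ` {..<length (adj ! v)}"
      using nb_eq[OF v] by (auto simp: image_image)
    also have "\<dots> = set (adj ! v)" by (auto simp: set_conv_nth)
    finally show ?thesis using adj v by (simp add: adjacency_lists_def n_def E_def)
  qed
qed

lemma con_iff:
  assumes "T \<subseteq> verts G"
  shows "connected_graph (induced G T) \<longleftrightarrow> T \<noteq> {} \<and> con T"
proof -
  have "{(x, y). {x, y} \<in> edges (induced G T)} = adj_in T"
    by (auto simp: induced_def adj_in_def E_def)
  then show ?thesis by (simp add: connected_graph_def con_def induced_def)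
qed

sublocale machine n E off nb W c X k for X
proof
  show "3 \<le> c" by (rule c)
  show "1 \<le> k" by (rule k_pos)
  show "\<exists>a\<in>S. \<exists>b\<in>S. E a b" if "S \<subseteq> {u. E v u}" "card S = c" for S v
    using star_free_indep[OF simple free, of S v] that c by (simp add: E_def)
  have "connected_graph (induced G (verts G))"
  proof -
    have "{e \<in> edges G. e \<subseteq> verts G} = edges G" using simple by (auto simp: simple_graph_def)
    then show ?thesis using connected by (simp add: connected_graph_def induced_def)
  qed
  then show "con {..<n}" using con_iff[OF order_refl] verts by simp
qed

definition M :: nat where "M = card (edges G)"

lemma n_le: "n \<le> M + 1"
  using card_verts_le[OF simple connected] by (simp add: verts M_def)

lemma volume_le: "volume \<le> 2 * M + n"
proof -
  have "off (Suc v) - off v + 1 = card {u. {v, u} \<in> edges G} + 1" if "v < n" for v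
  proof -
    have "length (adj ! v) = card (set (adj ! v))"
      using adj that distinct_card[of "adj ! v"] by (simp add: adjacency_lists_def n_def)
    moreover have "set (adj ! v) = {u. {v, u} \<in> edges G}"
      using adj that by (simp add: adjacency_lists_def n_def)
    ultimately show ?thesis using off_Suc[OF that] by simp
  qed
  then have "volume = (\<Sum>v<n. card {u. {v, u} \<in> edges G} + 1)"
    unfolding volume_def by (intro sum.cong) auto
  then have "volume = (\<Sum>v<n. card {u. {v, u} \<in> edges G}) + n"
    unfolding sum.distrib by simp
  then show ?thesis using sum_degrees_le[OF simple] by (simp add: verts M_def)
qed

definition parts :: "(nat \<Rightarrow> nat) \<Rightarrow> nat set set" where
  "parts p = (\<lambda>i. {v \<in> verts G. p v = i}) ` {1..k}"

lemma labelling_partition: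
  assumes "labelling Y p"
  shows "connected_partition G k (parts p)" "Y \<le> (c - 1) * min_weight w (parts p)"
proof -
  let ?T = "\<lambda>i. {v. v < n \<and> p v = i}"
  have P: "parts p = ?T ` {1..k}" by (simp add: parts_def verts)
  have l: "\<And>v. v < n \<Longrightarrow> 1 \<le> p v \<and> p v \<le> k"
    "\<And>i. i \<in> {1..k} \<Longrightarrow> ?T i \<noteq> {} \<and> con (?T i) \<and> Y \<le> (c - 1) * (\<Sum>v\<in>?T i. W v)"
    using assms unfolding labelling_def by blast+
  have "inj_on ?T {1..k}"
  proof (rule inj_onI)
    fix i j assume a: "i \<in> {1..k}" "?T i = ?T j"
    obtain v where v: "v \<in> ?T i" using l(2)[OF a(1)] by blast
    have "v \<in> ?T j" using v unfolding a(2) .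
    then show "i = j" using v by simp
  qed
  then have "card (parts p) = k" by (simp add: P card_image)
  moreover have "partition_on (verts G) (parts p)"
    unfolding partition_on_def
  proof (intro conjI)
    show "\<Union>(parts p) = verts G" using l(1) by (auto simp: P verts)
    show "disjoint (parts p)" by (auto simp: P disjoint_def)
    show "{} \<notin> parts p" using l(2) unfolding P by blast
  qed
  moreover have "connected_graph (induced G T)" if T: "T \<in> parts p" for T
  proof -
    obtain i where i: "i \<in> {1..k}" "T = ?T i" using T unfolding P by blast
    then show ?thesis using l(2)[OF i(1)] con_iff[of "?T i"] by (auto simp: verts)
  qed
  ultimately show "connected_partition G k (parts p)" by (simp add: connected_partition_def)
  have "parts p \<noteq> {}" using k_pos by (simp add: P)
  then have "min_weight w (parts p) \<in> (\<lambda>T. \<Sum>v\<in>T. w v) ` parts p"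
    unfolding min_weight_def by (intro Min_in) (auto simp: P)
  then obtain i where i: "i \<in> {1..k}" "min_weight w (parts p) = (\<Sum>v\<in>?T i. w v)" by (auto simp: P)
  have "(\<Sum>v\<in>?T i. w v) = (\<Sum>v\<in>?T i. W v)" using W_eq by (intro sum.cong) auto
  then show "Y \<le> (c - 1) * min_weight w (parts p)" using l(2)[OF i(1)] i(2) by simp
qed

lemma partition_packing:
  assumes P: "connected_partition G k P"
  shows "packing (min_weight w P) P" "card P = k"
proof -
  show k': "card P = k" using P by (simp add: connected_partition_def)
  have part: "partition_on {..<n} P" using P by (simp add: connected_partition_def verts)
  then have sub: "T \<subseteq> {..<n}" "T \<noteq> {}" if "T \<in> P" for T
    using that by (auto simp: partition_on_def)
  have fin: "finite P" using k' k_pos card.infinite by fastforce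
  have "min_weight w P \<le> (\<Sum>v\<in>T. W v)" if "T \<in> P" for T
  proof -
    have "min_weight w P \<le> (\<Sum>v\<in>T. w v)"
      unfolding min_weight_def using fin that by (intro Min_le) auto
    also have "\<dots> = (\<Sum>v\<in>T. W v)" using W_eq sub(1)[OF that] by (intro sum.cong) auto
    finally show ?thesis .
  qed
  moreover have "con T" if "T \<in> P" for T
    using that P con_iff[of T] sub(1)[OF that] by (simp add: connected_partition_def verts)
  ultimately show "packing (min_weight w P) P"
    unfolding packing_def using fin sub part by (simp add: partition_on_def)
qed

abbreviation opt :: nat where "opt \<equiv> max_min_value G w k"

lemma finite_values: "finite {min_weight w P |P. connected_partition G k P}"
proof -
  have "{P. connected_partition G k P} \<subseteq> Pow (Pow (verts G))"
    by (auto simp: connected_partition_def partition_on_def)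
  then have "finite {P. connected_partition G k P}"
    by (rule finite_subset) (simp add: verts)
  then show ?thesis by simp
qed

lemma opt_ge: "connected_partition G k P \<Longrightarrow> min_weight w P \<le> opt"
  unfolding max_min_value_def using finite_values by (intro Max_ge) auto

text \<open>A success exhibits a partition of minimum weight at least \<open>Y / (c - 1)\<close>,
  which the optimum dominates. This is what makes the number of probes logarithmic in the
  optimum.\<close>

lemma labelling_le: "labelling Y p \<Longrightarrow> Y \<le> (c - 1) * opt"
  using labelling_partition[of Y p] opt_ge by (meson le_trans mult_le_mono2)

text \<open>\<open>P0\<close> makes the set of values nonempty, so that the maximum is attained. It
  is supplied by the output of the program, so existence of a connected \<open>k\<close>-partition
  comes from the algorithm itself.\<close>

lemma opt_less:
  assumes "connected_partition G k P0" "\<And>F. packing (Suc Y) F \<Longrightarrow> card F < k"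
  shows "opt \<le> Y"
proof -
  have "opt \<in> {min_weight w P |P. connected_partition G k P}"
    unfolding max_min_value_def using finite_values assms(1) by (intro Max_in) auto
  then obtain P where P: "connected_partition G k P" "opt = min_weight w P" by auto
  have "\<not> Suc Y \<le> opt"
  proof
    assume "Suc Y \<le> opt"
    then have "packing (Suc Y) P"
      using partition_packing(1)[OF P(1)] P(2) by (auto simp: packing_def intro: le_trans)
    then show False using assms(2) partition_packing(2)[OF P(1)] by blast
  qed
  then show ?thesis by simp
qed

text \<open>The summand \<open>c\<close> covers the approximation factor, since
  \<open>c - 1 < 2 ^ c\<close>.\<close>

definition L :: nat where "L = c + nat \<lceil>log 2 (real opt)\<rceil>"

lemma opt_L: "(c - 1) * opt < 2 ^ L"
proof (cases "opt = 0")
  case False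
  have "log 2 (real opt) \<le> real (nat \<lceil>log 2 (real opt)\<rceil>)" by linarith
  then have "real opt \<le> 2 powr real (nat \<lceil>log 2 (real opt)\<rceil>)"
    by (subst log_le_iff[symmetric]) (use False in auto)
  then have "real opt \<le> real (2 ^ nat \<lceil>log 2 (real opt)\<rceil>)" by (simp add: powr_realpow)
  then have 1: "opt \<le> 2 ^ nat \<lceil>log 2 (real opt)\<rceil>" by linarith
  have "c - 1 < 2 ^ c" using less_exp[of c] by linarith
  then have "(c - 1) * opt < 2 ^ c * opt" using False by simp
  also have "\<dots> \<le> 2 ^ c * 2 ^ nat \<lceil>log 2 (real opt)\<rceil>" using 1 by simp
  finally show ?thesis by (simp add: L_def power_add)
qed simp

lemma L_le: "real L \<le> (real c + 2) * max 1 (log 2 (real opt))"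
proof -
  have "real L \<le> real c * 1 + (max 1 (log 2 (real opt)) + 1)" unfolding L_def by linarith
  also have "\<dots> \<le> real c * max 1 (log 2 (real opt)) + (max 1 (log 2 (real opt)) + max 1 (log 2 (real opt)))"
    by (intro add_mono mult_left_mono) auto
  finally show ?thesis by (simp add: algebra_simps)
qed

text \<open>Positive weights and \<open>k\<close> being at most the number of vertices enter here:
  \<open>k\<close> singletons form a packing for the guess 1.\<close>

lemma one_packing: "\<exists>F. packing 1 F \<and> k \<le> card F"
proof (intro exI[of _ "(\<lambda>v. {v}) ` {..<k}"] conjI)
  have kn: "k \<le> n" using k_le by (simp add: verts)
  have "1 \<le> W v" if "v < n" for v using weights that W_eq by (simp add: verts)
  moreover have "con {v}" for v by (simp add: con_def)
  ultimately show "packing 1 ((\<lambda>v. {v}) ` {..<k})"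
    using kn unfolding packing_def by (auto simp: disjoint_def)
  show "k \<le> card ((\<lambda>v. {v}) ` {..<k})" by (subst card_image) auto
qed

sublocale optimum n E off nb W c k L
proof
  show "Y < 2 ^ L" if "labelling Y p" for Y p
    using labelling_le[OF that] opt_L by (rule le_less_trans)
  show "\<exists>F. packing 1 F \<and> k \<le> card F" by (rule one_packing)
qed

text \<open>It depends on \<open>c\<close> alone. The outer factor 3 charges the initial probe and
  one probe in a round of each of the two loops; the inner 18 collects the fixed costs of a
  probe.\<close>

definition step_factor :: nat where
  "step_factor = 18 + max_cost double_code + max_cost refine_code +
    3 * (18 + 3 * max_cost (init_body c) + 9 * (1 + bcost dfs_guard + max_cost (dfs_body c)) +
      3 * (4 + max_cost (roots_body c)) + 12 + max_cost start_code + 5 * (4 + max_cost (bfs_body c)))"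

lemma base_input: "base (input_state adj w k)"
  unfolding base_def by (simp add: input_state_def Let_def n_def W_def off_def nb_def fun_eq_iff)

lemma time_le:
  assumes "t \<le> (7 + probe_time) + ((L + 1) * (5 + (max_cost double_code + probe_time)) +
      (2 + (L + 1) * (4 + (max_cost refine_code + probe_time))))"
  shows "t \<le> (L + 1) * (step_factor * max 1 M)"
proof -
  define m where "m = max 1 M"
  \<comment> \<open>With \<open>n\<close> at most \<open>M + 1\<close> and \<open>volume\<close> at
    most \<open>2 M + n\<close>, the three left sides are at most \<open>M + 2\<close>,
    \<open>3 M + 2\<close> and \<open>6 M + 3\<close>. The maximum in \<open>m\<close> covers the
    graph without edges.\<close>
  have nm: "n + 1 \<le> 3 * m" and vm: "volume + 1 \<le> 5 * m" "2 * volume + 1 \<le> 9 * m" and m1: "1 \<le> m"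
    using n_le volume_le by (auto simp: m_def)
  define a b d e f g h where defs: "a = max_cost (init_body c)"
    "b = 1 + bcost dfs_guard + max_cost (dfs_body c)" "d = 4 + max_cost (roots_body c)"
    "e = max_cost start_code" "f = 4 + max_cost (bfs_body c)" "g = max_cost double_code"
    "h = max_cost refine_code"
  have up: "x \<le> x * m" for x using m1 by simp
  have 1: "(n + 1) * (4 + a) \<le> 3 * m * (4 + a)" "(2 * volume + 1) * b \<le> 9 * m * b"
    "(n + 1) * d \<le> 3 * m * d" "(volume + 1) * f \<le> 5 * m * f"
    by (intro mult_le_mono1 nm vm)+
  have p: "probe_time = 18 + (n + 1) * (4 + a) + (2 * volume + 1) * b + (n + 1) * d + e + (volume + 1) * f"
    by (simp add: probe_time_def search_time_def label_time_def defs)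
  have "probe_time \<le> 18 * m + 3 * m * (4 + a) + 9 * m * b + 3 * m * d + e * m + 5 * m * f"
    unfolding p by (intro add_mono 1 up)
  also have "\<dots> = (18 + 3 * a + 9 * b + 3 * d + 12 + e + 5 * f) * m" by (simp add: algebra_simps)
  finally have "probe_time \<le> (18 + 3 * a + 9 * b + 3 * d + 12 + e + 5 * f) * m" .
  then have pt: "3 * probe_time \<le> 3 * (18 + 3 * a + 9 * b + 3 * d + 12 + e + 5 * f) * m"
    unfolding mult.assoc by (rule mult_le_mono2)
  have "t \<le> (L + 1) * (18 + g + h + 3 * probe_time)"
    using assms by (simp add: defs algebra_simps)
  also have "\<dots> \<le> (L + 1) * ((18 + g + h) * m + 3 * (18 + 3 * a + 9 * b + 3 * d + 12 + e + 5 * f) * m)"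
    by (intro mult_le_mono2 add_mono up pt)
  also have "\<dots> = (L + 1) * (step_factor * m)"
    by (simp add: step_factor_def defs algebra_simps)
  finally show ?thesis by (simp add: m_def)
qed

text \<open>The final guess \<open>Y\<close> separates the two values: \<open>Suc Y\<close> is bad,
  so the optimum is at most \<open>Y\<close>, while the labelling for \<open>Y\<close> gives parts
  of weight at least \<open>Y / (c - 1)\<close>.\<close>

lemma bcp_code_correct:
  "\<exists>t s. exec (bcp_code c) (input_state adj w k) t s \<and>
    approximation (real c - 1) G w k (output_parts G k s) \<and>
    real t \<le> (real c + 3) * real step_factor * max 1 (log 2 (real opt)) * max 1 (real (card (edges G)))"
proof -
  obtain t s Y where e: "exec (bcp_code c) (input_state adj w k) t s"
    and t: "t \<le> (L + 1) * (step_factor * max 1 M)"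
    and Y: "ok Y (arr s ''part'')" "bad (Suc Y)"
    using bcp_code[OF base_input] time_le by blast
  have out: "output_parts G k s = parts (arr s ''part'')" by (simp add: output_parts_def parts_def)
  note lab = labelling_partition[OF Y(1)[unfolded ok_def]]
  have "opt \<le> Y" using opt_less[OF lab(1)] Y(2) by (simp add: bad_def)
  also note lab(2)
  finally have "real opt \<le> real ((c - 1) * min_weight w (parts (arr s ''part'')))"
    by (rule of_nat_mono)
  then have "real opt \<le> (real c - 1) * real (min_weight w (parts (arr s ''part'')))"
    using c by (simp add: of_nat_diff)
  then have "approximation (real c - 1) G w k (output_parts G k s)"
    unfolding approximation_def out using lab(1) c by (simp add: divide_le_eq mult.commute)
  moreover have "real t \<le> (real c + 3) * real step_factor * max 1 (log 2 (real opt)) * max 1 (real (card (edges G)))"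
  proof -
    have "real t \<le> real ((L + 1) * (step_factor * max 1 M))" using t by (rule of_nat_mono)
    also have "\<dots> = (real L + 1) * (real step_factor * max 1 (real M))" by (simp add: of_nat_max algebra_simps)
    also have "\<dots> \<le> ((real c + 3) * max 1 (log 2 (real opt))) * (real step_factor * max 1 (real M))"
    proof (rule mult_right_mono)
      show "real L + 1 \<le> (real c + 3) * max 1 (log 2 (real opt))"
        using L_le by (simp add: algebra_simps)
    qed simp
    finally show ?thesis by (simp add: M_def mult_ac)
  qed
  ultimately show ?thesis using e by blast
qed

end

text \<open>Program and constant are chosen before the instance and depend on \<open>c\<close> only.
  The maxima with 1 account for optimum 1, where the logarithm vanishes, and for the one-vertex
  graph, which has no edge.\<close>

theorem theorem2:
  fixes c :: nat
  assumes "c \<ge> 3"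
  shows "\<exists>(prog :: com) (C :: real).
    \<forall>(G :: nat graph) (w :: nat \<Rightarrow> nat) (k :: nat) (adj :: nat list list).
      simple_graph G \<longrightarrow> connected_graph G \<longrightarrow> star_free c G \<longrightarrow>
      (\<forall>v\<in>verts G. w v \<ge> 1) \<longrightarrow>
      1 \<le> k \<longrightarrow> k \<le> card (verts G) \<longrightarrow>
      adjacency_lists G adj \<longrightarrow>
      (\<exists>t s. exec prog (input_state adj w k) t s \<and>
        approximation (real c - 1) G w k (output_parts G k s) \<and>
        real t \<le> C * max 1 (log 2 (real (max_min_value G w k))) * max 1 (real (card (edges G))))"
proof (intro exI[of _ "bcp_code c"] exI[of _ "(real c + 3) * real (bcp_input.step_factor c)"] allI impI)
  fix G :: "nat graph" and w :: "nat \<Rightarrow> nat" and k :: nat and adj :: "nat list list"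
  assume "simple_graph G" "connected_graph G" "star_free c G" "\<forall>v\<in>verts G. w v \<ge> 1"
    "1 \<le> k" "k \<le> card (verts G)" "adjacency_lists G adj"
  then interpret bcp_input c G w k adj
    by unfold_locales (use assms in auto)
  show "\<exists>t s. exec (bcp_code c) (input_state adj w k) t s \<and>
        approximation (real c - 1) G w k (output_parts G k s) \<and>
        real t \<le> (real c + 3) * real step_factor * max 1 (log 2 (real (max_min_value G w k))) *
          max 1 (real (card (edges G)))"
    by (rule bcp_code_correct)
qed

end
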